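(* For the (non-linear) Gauss map, let $J_n$ be the limit set of the iterated function system consisting of the maps $g_k(x)=\frac1{x+k}$, $k=1,\dots,n$, on $[0,1]$, let $h_n$ be its Hausdorff dimension, and let $H_n$ be the $h_n$-dimensional Hausdorff measure of $J_n$. Then $$\lim_{n\to\infty}\frac{1-H_n}{(1-h_n)\ln n}=1$$ and $$\lim_{n\to\infty}\frac{n(1-H_n)}{\ln n}=\frac{6}{\pi^2}.$$
   Context: $\mathbb N=\{1,2,\dots\}$. The maps $g_k:[0,1]\to[0,1]$, $g_k(x)=\frac1{x+k}$, are the inverse branches of the Gauss map $x\mapsto\{1/x\}$. For a finite word $\omega=(\omega_1,\dots,\omega_m)$ of positive integers put $g_\omega=g_{\omega_1}\circ\dots\circ g_{\omega_m}$. The limit set is $$J_n=\bigcap_{k=1}^\infty\ \bigcup_{\omega\in\{1,\dots,n\}^k}g_\omega([0,1]),$$ i.e. the set of irrational numbers in $[0,1]$ all of whose continued fraction entries are at most $n$. $h_n=\dim_H(J_n)$ and $H_n=H_{h_n}(J_n)$, where $H_h$ is the $h$-dimensional Hausdorff measure normalized by $H_h(A)=\lim_{\delta\to0}\inf\{\sum_i\mathrm{diam}^h(U_i): A\subset\bigcup_iU_i,\ \mathrm{diam}(U_i)\le\delta\}$ (so $H_1$ is Lebesgue measure on $\mathbb R$). *)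

theory Defs
  imports "HOL-Analysis.Analysis"
begin

text \<open>Hausdorff measure, normalized without a volume constant. A cover is a sequence of sets, finite
  covers being padded by empty sets; hence the empty set must have weight zero also for exponent
  zero, whereas a nonempty set then has weight one (note that \<open>0 powr 0 = 0\<close>). Boundedness is
  required because \<^const>\<open>diameter\<close> is unspecified on unbounded sets.\<close>

definition diam_pow :: "real \<Rightarrow> 'a::metric_space set \<Rightarrow> ennreal" where
  "diam_pow h U = (if U = {} then 0 else if h = 0 then 1 else ennreal (diameter U powr h))"

definition hausdorff_premeasure :: "real \<Rightarrow> real \<Rightarrow> 'a::metric_space set \<Rightarrow> ennreal" where
  "hausdorff_premeasure h \<delta> A =
     (INF U \<in> {U :: nat \<Rightarrow> 'a set. A \<subseteq> (\<Union>i. U i) \<and> (\<forall>i. bounded (U i) \<and> diameter (U i) \<le> \<delta>)}.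
        \<Sum>i. diam_pow h (U i))"

definition hausdorff_measure :: "real \<Rightarrow> 'a::metric_space set \<Rightarrow> ennreal" where
  "hausdorff_measure h A = Lim (at_right 0) (\<lambda>\<delta>. hausdorff_premeasure h \<delta> A)"

lemma hausdorff_premeasure_antimono:
  fixes A :: "'a::metric_space set"
  assumes "\<delta> \<le> \<delta>'"
  shows "hausdorff_premeasure h \<delta>' A \<le> hausdorff_premeasure h \<delta> A"
  unfolding hausdorff_premeasure_def
proof (rule INF_superset_mono)
  show "{U :: nat \<Rightarrow> 'a set. A \<subseteq> (\<Union>i. U i) \<and> (\<forall>i. bounded (U i) \<and> diameter (U i) \<le> \<delta>)}
      \<subseteq> {U. A \<subseteq> (\<Union>i. U i) \<and> (\<forall>i. bounded (U i) \<and> diameter (U i) \<le> \<delta>')}"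
  proof (rule Collect_mono, intro impI conjI allI)
    fix U :: "nat \<Rightarrow> 'a set" and i
    assume U: "A \<subseteq> (\<Union>i. U i) \<and> (\<forall>i. bounded (U i) \<and> diameter (U i) \<le> \<delta>)"
    show "A \<subseteq> (\<Union>i. U i)" "bounded (U i)" using U by simp_all
    have "diameter (U i) \<le> \<delta>" using U by simp
    then show "diameter (U i) \<le> \<delta>'" using assms by linarith
  qed
qed simp

text \<open>The limit in the definition always exists.\<close>

lemma tendsto_hausdorff_premeasure_SUP:
  "((\<lambda>\<delta>. hausdorff_premeasure h \<delta> A) \<longlongrightarrow> (SUP \<delta>\<in>{0<..}. hausdorff_premeasure h \<delta> A)) (at_right 0)"
proof (rule order_tendstoI)
  fix a assume "a < (SUP \<delta>\<in>{0<..}. hausdorff_premeasure h \<delta> A)"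
  then obtain \<delta> where \<delta>: "\<delta> > 0" "a < hausdorff_premeasure h \<delta> A"
    by (auto simp: less_SUP_iff)
  have "eventually (\<lambda>x. x \<in> {0<..<\<delta>}) (at_right (0::real))"
    using \<delta>(1) by (rule eventually_at_right_real)
  then show "eventually (\<lambda>x. a < hausdorff_premeasure h x A) (at_right 0)"
  proof eventually_elim
    case (elim x)
    then have "hausdorff_premeasure h \<delta> A \<le> hausdorff_premeasure h x A"
      by (intro hausdorff_premeasure_antimono) simp
    with \<delta>(2) show ?case by (rule less_le_trans)
  qed
next
  fix a assume a: "(SUP \<delta>\<in>{0<..}. hausdorff_premeasure h \<delta> A) < a"
  have "eventually (\<lambda>x. x > 0) (at_right (0::real))"
    by (simp add: eventually_at_right_less)
  then show "eventually (\<lambda>x. hausdorff_premeasure h x A < a) (at_right 0)"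
  proof eventually_elim
    case (elim x)
    then have "hausdorff_premeasure h x A \<le> (SUP \<delta>\<in>{0<..}. hausdorff_premeasure h \<delta> A)"
      by (intro SUP_upper) simp
    then show ?case using a by (rule le_less_trans)
  qed
qed

lemma hausdorff_measure_eq_SUP:
  "hausdorff_measure h A = (SUP \<delta>\<in>{0<..}. hausdorff_premeasure h \<delta> A)"
  unfolding hausdorff_measure_def
  by (rule tendsto_Lim) (simp_all add: tendsto_hausdorff_premeasure_SUP)

definition hausdorff_dim :: "'a::metric_space set \<Rightarrow> ennreal" where
  "hausdorff_dim A = Inf {ennreal s |s. s \<ge> 0 \<and> hausdorff_measure s A = 0}"

definition gauss_branch :: "nat \<Rightarrow> real \<Rightarrow> real" where
  "gauss_branch k x = 1 / (x + real k)"

definition gauss_word :: "nat list \<Rightarrow> real \<Rightarrow> real" where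
  "gauss_word \<omega> = foldr (\<lambda>k f. gauss_branch k \<circ> f) \<omega> id"

definition gauss_limit_set :: "nat \<Rightarrow> real set" where
  "gauss_limit_set n =
     (\<Inter>k\<in>{1..}. \<Union>\<omega>\<in>{\<omega>. length \<omega> = k \<and> set \<omega> \<subseteq> {1..n}}. gauss_word \<omega> ` {0..1})"

text \<open>Both quantities below are finite (the dimension is at most one, and the limit set of a finite
  system has finite measure in its dimension), so \<^const>\<open>enn2real\<close>, which sends an infinite value
  to zero, loses nothing.\<close>

definition gauss_dim :: "nat \<Rightarrow> real" where
  "gauss_dim n = enn2real (hausdorff_dim (gauss_limit_set n))"

definition gauss_measure :: "nat \<Rightarrow> real" where
  "gauss_measure n = enn2real (hausdorff_measure (gauss_dim n) (gauss_limit_set n))"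

end

theory Submission
  imports Defs
begin

text \<open>Let \<open>h\<close> be the zero of the pressure of the first \<open>n\<close> branches and let \<open>\<Lambda>\<close> be a finitely additive
  \<open>h\<close>-conformal probability, i.e. a positive functional with \<open>\<Lambda> 1 = 1\<close> that is invariant under the transfer
  operator. Testing the invariance on the Gauss density \<open>1 / (1 + x)\<close> gives
  \<open>\<Lambda> (\<Sum>k\<le>n. ((k + x) powr (2 (1 - h)) - 1) / ((k + x) (k + x + 1))) = \<Lambda> (1 / (x + n + 1))\<close>. Since the Gauss map
  contracts the oscillation of monotone functions, \<open>\<Lambda>\<close> differs from the Lebesgue integral by \<open>O(1 / n)\<close> on
  them, and hence \<open>n (1 - h)\<close> tends to the inverse of
  \<open>2 \<integral>\<^sub>1\<^sup>\<infinity> ln u / (u (u + 1)) du = \<pi>\<^sup>2 / 6\<close>.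

  The reciprocal of the Hausdorff measure is the supremum of \<open>\<Lambda>(F) / |F| powr h\<close> over short intervals \<open>F\<close>.
  Intervals inside a cylinder are blown up until they are not; then the comparison with Lebesgue measure on each
  branch bounds the ratio by \<open>n powr (1 - h)\<close> up to a factor \<open>1 + O(1 / n)\<close>. The interval
  \<open>{1 / (n + 1)..2 / n}\<close>, whose distortion under all branches is \<open>1 + O(1 / n)\<close>, attains this bound up to such a
  factor, and its images exhaust the limit set. Thus \<open>- ln H\<^sub>n = (1 - h) ln n + O(1 / n)\<close>.\<close>

subsection \<open>Transfer operators and the critical exponent\<close>


text \<open>The main term \<open>(1 - h) * ln n\<close> has order \<open>ln n / n\<close>, so every
  error has to be \<open>O(1/n)\<close>, while the constants in front (24, 576, 700) are immaterial.
  In particular bounded distortion, which costs a fixed factor, is too weak: the estimates are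
  stated for a Moebius family \<open>mob t\<close> on which the branches act exactly. Finite
  additivity of \<open>\<Lambda>\<close> avoids the construction of a Gibbs measure and makes
  indicators legitimate test functions at once. The price is paid in the lower bound for the
  Hausdorff measure: covers are reduced to finite ones by compactness, and the limit set is replaced
  by its finite-level approximations. The comparison with Lebesgue measure has an additive error,
  which is worthless for short intervals. It is applied only after every cylinder has been expanded
  to unit size, and the errors can be absorbed only if the interval contains a whole first-level
  cylinder. This is what forces the blow-up and the separate treatment of intervals that touch two
  neighbouring cylinders.\<close>

declare One_nat_def [simp del]

definition bdd01 :: "(real \<Rightarrow> real) \<Rightarrow> bool" where
  "bdd01 f \<longleftrightarrow> (\<exists>B. \<forall>x\<in>{0..1}. \<bar>f x\<bar> \<le> B)"

definition transfer :: "real \<Rightarrow> nat set \<Rightarrow> (real \<Rightarrow> real) \<Rightarrow> real \<Rightarrow> real" where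
  "transfer s K f x = (\<Sum>k\<in>K. (x + real k) powr (-(2 * s)) * f (gauss_branch k x))"

named_theorems bdd01_intros

lemma bdd01I: "(\<And>x. x \<in> {0..1} \<Longrightarrow> \<bar>f x\<bar> \<le> B) \<Longrightarrow> bdd01 f"
  unfolding bdd01_def by blast

lemma bdd01_const [bdd01_intros]: "bdd01 (\<lambda>_. c)"
  by (auto simp: bdd01_def)

lemma bdd01_id [bdd01_intros]: "bdd01 (\<lambda>x. x)"
  by (rule bdd01I[of _ 1]) auto

lemma bdd01_add [bdd01_intros]: "bdd01 f \<Longrightarrow> bdd01 g \<Longrightarrow> bdd01 (\<lambda>x. f x + g x)"
  unfolding bdd01_def by (meson abs_triangle_ineq add_mono order_trans)

lemma bdd01_mult [bdd01_intros]:
  assumes "bdd01 f" "bdd01 g" shows "bdd01 (\<lambda>x. f x * g x)"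
proof -
  obtain A B where "\<forall>x\<in>{0..1}. \<bar>f x\<bar> \<le> A" "\<forall>x\<in>{0..1}. \<bar>g x\<bar> \<le> B"
    using assms by (auto simp: bdd01_def)
  then show ?thesis
    by (intro bdd01I[of _ "A * B"]) (simp add: abs_mult, meson abs_ge_zero mult_mono order_trans atLeastAtMost_iff)
qed

lemma bdd01_minus [bdd01_intros]: "bdd01 f \<Longrightarrow> bdd01 (\<lambda>x. - f x)"
  by (auto simp: bdd01_def)

lemma bdd01_diff [bdd01_intros]: "bdd01 f \<Longrightarrow> bdd01 g \<Longrightarrow> bdd01 (\<lambda>x. f x - g x)"
  using bdd01_add[of f "\<lambda>x. - g x"] bdd01_minus[of g] by simp

lemma bdd01_sum [bdd01_intros]: "(\<And>i. i \<in> I \<Longrightarrow> bdd01 (f i)) \<Longrightarrow> bdd01 (\<lambda>x. \<Sum>i\<in>I. f i x)"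
  by (induction I rule: infinite_finite_induct) (auto intro!: bdd01_intros)

lemma bdd01_of_bool [bdd01_intros]: "bdd01 (\<lambda>x. of_bool (P x))"
  by (rule bdd01I[of _ 1]) auto

lemma bdd01_mono_on: "mono_on {0..1} f \<Longrightarrow> bdd01 f"
  by (intro bdd01I[of f "\<bar>f 0\<bar> + \<bar>f 1\<bar>"]) (smt (verit) atLeastAtMost_iff mono_onD)

lemma bdd01_antimono_on: "antimono_on {0..1} f \<Longrightarrow> bdd01 f"
  by (intro bdd01I[of f "\<bar>f 0\<bar> + \<bar>f 1\<bar>"]) (smt (verit) atLeastAtMost_iff monotone_onD)

lemma bdd01_continuous: "continuous_on {0..1} f \<Longrightarrow> bdd01 f"
  using compact_imp_bounded[OF compact_continuous_image[of "{0..1::real}" f]]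
  by (auto simp: bdd01_def bounded_iff)

lemma gauss_branch_nonneg: "0 \<le> x \<Longrightarrow> 0 \<le> gauss_branch k x"
  by (simp add: gauss_branch_def)

lemma gauss_branch_le1: "0 \<le> x \<Longrightarrow> k \<ge> 1 \<Longrightarrow> gauss_branch k x \<le> 1"
  by (simp add: gauss_branch_def field_simps)

lemma gauss_branch_in: "x \<in> {0..1} \<Longrightarrow> k \<ge> 1 \<Longrightarrow> gauss_branch k x \<in> {0..1}"
  by (simp add: gauss_branch_nonneg gauss_branch_le1)

lemma gauss_branch_antimono: "0 \<le> x \<Longrightarrow> x \<le> y \<Longrightarrow> k \<ge> 1 \<Longrightarrow> gauss_branch k y \<le> gauss_branch k x"
  by (simp add: gauss_branch_def frac_le)

lemma bdd01_comp_branch [bdd01_intros]: "bdd01 f \<Longrightarrow> k \<ge> 1 \<Longrightarrow> bdd01 (\<lambda>x. f (gauss_branch k x))"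
  using gauss_branch_in unfolding bdd01_def by blast

lemma bdd01_shift_powr [bdd01_intros]: "k \<ge> 1 \<Longrightarrow> bdd01 (\<lambda>x. (x + real k) powr a)"
  by (rule bdd01_continuous) (auto intro!: continuous_intros)

lemma bdd01_transfer [bdd01_intros]: "bdd01 f \<Longrightarrow> K \<subseteq> {1..} \<Longrightarrow> bdd01 (transfer s K f)"
  unfolding transfer_def by (intro bdd01_intros) auto

lemma transfer_add: "transfer s K (\<lambda>x. f x + g x) = (\<lambda>x. transfer s K f x + transfer s K g x)"
  by (auto simp: transfer_def algebra_simps sum.distrib)

lemma transfer_cmult: "transfer s K (\<lambda>x. c * f x) = (\<lambda>x. c * transfer s K f x)"
  by (auto simp: transfer_def algebra_simps sum_distrib_left)

lemma transfer_mono: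
  assumes "\<And>x. x \<in> {0..1} \<Longrightarrow> f x \<le> g x" "K \<subseteq> {1..}" "x \<in> {0..1}"
  shows "transfer s K f x \<le> transfer s K g x"
  unfolding transfer_def using assms gauss_branch_in
  by (intro sum_mono mult_left_mono) auto

lemma transfer_nonneg:
  assumes "\<And>x. x \<in> {0..1} \<Longrightarrow> 0 \<le> f x" "K \<subseteq> {1..}" "x \<in> {0..1}"
  shows "0 \<le> transfer s K f x"
  unfolding transfer_def using assms gauss_branch_in
  by (intro sum_nonneg mult_nonneg_nonneg) auto

lemma transfer_cong:
  assumes "\<And>x. x \<in> {0..1} \<Longrightarrow> f x = g x" "K \<subseteq> {1..}" "x \<in> {0..1}"
  shows "transfer s K f x = transfer s K g x"
  unfolding transfer_def using assms gauss_branch_in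
  by (intro sum.cong) auto

lemma transfer_iter_add: "(transfer s K ^^ N) (\<lambda>x. f x + g x) = (\<lambda>x. (transfer s K ^^ N) f x + (transfer s K ^^ N) g x)"
  by (induction N) (simp_all add: transfer_add)

lemma transfer_iter_cmult: "(transfer s K ^^ N) (\<lambda>x. c * f x) = (\<lambda>x. c * (transfer s K ^^ N) f x)"
  by (induction N) (simp_all add: transfer_cmult)

lemma transfer_iter_mono:
  assumes "\<And>x. x \<in> {0..1} \<Longrightarrow> f x \<le> g x" "K \<subseteq> {1..}" "x \<in> {0..1}"
  shows "(transfer s K ^^ N) f x \<le> (transfer s K ^^ N) g x"
  using assms(3)
proof (induction N arbitrary: x)
  case (Suc N)
  then show ?case using transfer_mono[of "(transfer s K ^^ N) f" "(transfer s K ^^ N) g" K x s] assms(2) by simp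
qed (use assms in auto)

lemma bdd01_transfer_iter [bdd01_intros]: "bdd01 f \<Longrightarrow> K \<subseteq> {1..} \<Longrightarrow> bdd01 ((transfer s K ^^ N) f)"
  by (induction N) (auto intro: bdd01_intros)

text \<open>Modelled on \<open>(q + q' * x) powr (- 2 * s)\<close> with \<open>0 <= q' <= q\<close>,
  the powers of derivatives of inverse branches: they decrease, but not faster than
  \<open>(1 + x) powr (- 2 * s)\<close>. The second condition gives distortion
  \<open>1 + O(1/l)\<close> on \<open>{0..1/l}\<close> and not merely a bounded factor on
  \<open>{0..1}\<close>.\<close>

definition distortion_cone :: "real \<Rightarrow> (real \<Rightarrow> real) set" where
  "distortion_cone s = {f. (\<forall>x\<in>{0..1}. 0 \<le> f x) \<and> antimono_on {0..1} f
     \<and> mono_on {0..1} (\<lambda>x. (1 + x) powr (2 * s) * f x)}"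

lemma distortion_cone_const: "c \<ge> 0 \<Longrightarrow> s \<ge> 0 \<Longrightarrow> (\<lambda>_. c) \<in> distortion_cone s"
  by (auto simp: distortion_cone_def intro!: monotone_onI mult_right_mono powr_mono2)

text \<open>The two monotonicity conditions feed each other, since \<open>gauss_branch k\<close>
  reverses the order. Decrease of the image uses
  \<open>(x + k) * (1 + gauss_branch k x) = x + k + 1\<close> and the second condition; the second
  condition for the image uses the first one and the fact that \<open>(1 + x) / (x + k)\<close> does
  not decrease for \<open>k >= 1\<close>.\<close>

lemma transfer_distortion_cone:
  assumes f: "f \<in> distortion_cone s" and K: "K \<subseteq> {1..}" and s: "s \<ge> 0"
  shows "transfer s K f \<in> distortion_cone s"
proof -
  have pos: "0 \<le> f x" if "x \<in> {0..1}" for x using f that by (auto simp: distortion_cone_def)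
  have anti: "f y \<le> f x" if "0 \<le> x" "x \<le> y" "y \<le> 1" for x y
    using f that by (auto simp: distortion_cone_def monotone_on_def)
  have mon: "(1 + x) powr (2 * s) * f x \<le> (1 + y) powr (2 * s) * f y" if "0 \<le> x" "x \<le> y" "y \<le> 1" for x y
    using f that by (auto simp: distortion_cone_def monotone_on_def)
  have a: "(y + real k) powr (-(2 * s)) * f (gauss_branch k y) \<le> (x + real k) powr (-(2 * s)) * f (gauss_branch k x)"
    if k: "k \<in> K" and xy: "0 \<le> x" "x \<le> y" "y \<le> 1" for k x y
  proof -
    have k1: "k \<ge> 1" using k K by auto
    have gx: "gauss_branch k x \<in> {0..1}" and gy: "gauss_branch k y \<in> {0..1}"
      and gxy: "gauss_branch k y \<le> gauss_branch k x"
      using k1 xy gauss_branch_in[of x k] gauss_branch_in[of y k] gauss_branch_antimono[of x y k] by simp_all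
    have eq: "(z + real k) powr (-(2 * s)) * w
        = (z + real k + 1) powr (-(2 * s)) * ((1 + gauss_branch k z) powr (2 * s) * w)" if "z \<ge> 0" for z w
    proof -
      have "1 + gauss_branch k z = (z + real k + 1) / (z + real k)"
        using k1 that by (simp add: gauss_branch_def field_simps)
      then have e: "(1 + gauss_branch k z) powr (2 * s) = (z + real k + 1) powr (2 * s) / (z + real k) powr (2 * s)"
        by (simp only: powr_divide)
      have "(z + real k + 1) powr (2 * s) \<noteq> 0" using k1 that by simp
      then show ?thesis unfolding e powr_minus
        by (simp add: divide_inverse)
    qed
    show ?thesis
      unfolding eq[OF xy(1)] eq[of y, OF order_trans[OF xy(1,2)]]
    proof (rule mult_mono)
      show "(y + real k + 1) powr (-(2 * s)) \<le> (x + real k + 1) powr (-(2 * s))"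
        using xy s by (intro powr_mono2') auto
      show "(1 + gauss_branch k y) powr (2 * s) * f (gauss_branch k y)
          \<le> (1 + gauss_branch k x) powr (2 * s) * f (gauss_branch k x)"
        using gx gy gxy by (intro mon) auto
      show "0 \<le> (1 + gauss_branch k y) powr (2 * s) * f (gauss_branch k y)"
        using pos[OF gy] by simp
    qed simp
  qed
  have b: "(1 + x) powr (2 * s) * ((x + real k) powr (-(2 * s)) * f (gauss_branch k x))
       \<le> (1 + y) powr (2 * s) * ((y + real k) powr (-(2 * s)) * f (gauss_branch k y))"
    if k: "k \<in> K" and xy: "0 \<le> x" "x \<le> y" "y \<le> 1" for k x y
  proof -
    have k1: "k \<ge> 1" using k K by auto
    have gx: "gauss_branch k x \<in> {0..1}" and gy: "gauss_branch k y \<in> {0..1}"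
      and gxy: "gauss_branch k y \<le> gauss_branch k x"
      using k1 xy gauss_branch_in[of x k] gauss_branch_in[of y k] gauss_branch_antimono[of x y k] by simp_all
    have eq: "(1 + z) powr (2 * s) * ((z + real k) powr (-(2 * s)) * w) = ((1 + z) / (z + real k)) powr (2 * s) * w"
      if "z \<ge> 0" for z w using k1 that by (simp add: powr_divide powr_minus field_simps)
    have "x + real k * y \<ge> y + real k * x"
    proof -
      have "0 \<le> (real k - 1) * (y - x)" using k1 xy by simp
      then show ?thesis by (simp add: algebra_simps)
    qed
    then have le: "(1 + x) / (x + real k) \<le> (1 + y) / (y + real k)"
      using k1 xy by (simp add: divide_simps) (simp add: algebra_simps)
    show ?thesis
      unfolding eq[OF xy(1)] eq[of y, OF order_trans[OF xy(1,2)]]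
    proof (rule mult_mono)
      show "((1 + x) / (x + real k)) powr (2 * s) \<le> ((1 + y) / (y + real k)) powr (2 * s)"
        using xy s le by (intro powr_mono2) auto
      show "f (gauss_branch k x) \<le> f (gauss_branch k y)"
        using gx gy gxy by (intro anti) auto
      show "0 \<le> f (gauss_branch k x)" using pos[OF gx] .
    qed simp
  qed
  show ?thesis
    unfolding distortion_cone_def
    using a b transfer_nonneg[of f K _ s] pos K
    by (auto simp: transfer_def sum_distrib_left intro!: monotone_onI sum_mono)
qed

lemma transfer_iter_distortion_cone:
  "f \<in> distortion_cone s \<Longrightarrow> K \<subseteq> {1..} \<Longrightarrow> s \<ge> 0 \<Longrightarrow> (transfer s K ^^ N) f \<in> distortion_cone s"
  by (induction N) (auto intro: transfer_distortion_cone)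

lemma distortion_cone_bounds:
  assumes "f \<in> distortion_cone s" "x \<in> {0..1}" "s \<ge> 0"
  shows "0 \<le> f x" "f x \<le> f 0" "f 0 \<le> (1 + x) powr (2 * s) * f x" "f 0 \<le> 4 powr s * f x"
proof -
  show 1: "0 \<le> f x" and "f x \<le> f 0"
    using assms by (auto simp: distortion_cone_def monotone_on_def)
  have "mono_on {0..1} (\<lambda>x. (1 + x) powr (2 * s) * f x)"
    using assms by (simp add: distortion_cone_def)
  from mono_onD[OF this, of 0 x] have "(1 + 0) powr (2 * s) * f 0 \<le> (1 + x) powr (2 * s) * f x"
    using assms by simp
  then show 2: "f 0 \<le> (1 + x) powr (2 * s) * f x" by simp
  have "(1 + x) powr (2 * s) \<le> 2 powr (2 * s)" using assms by (intro powr_mono2) auto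
  also have "\<dots> = 4 powr s" by (simp add: powr_powr[symmetric])
  finally show "f 0 \<le> 4 powr s * f x" using 1 2 by (meson mult_right_mono order_trans)
qed

text \<open>The partition functions \<open>Z\<^sub>N(s) = \<Sum> q\<^sub>\<omega> powr (-2s)\<close>, summed over words of length \<open>N\<close>.\<close>

definition partition_fun :: "nat \<Rightarrow> real \<Rightarrow> nat \<Rightarrow> real" where
  "partition_fun n s N = (transfer s {1..n} ^^ N) (\<lambda>_. 1) 0"

lemma partition_fun_0 [simp]: "partition_fun n s 0 = 1"
  by (simp add: partition_fun_def)

lemma one_iter_cone: "s \<ge> 0 \<Longrightarrow> (transfer s {1..n} ^^ N) (\<lambda>_. 1) \<in> distortion_cone s"
  by (intro transfer_iter_distortion_cone distortion_cone_const) auto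

lemma partition_fun_nonneg: "s \<ge> 0 \<Longrightarrow> 0 \<le> partition_fun n s N"
  unfolding partition_fun_def by (rule distortion_cone_bounds[OF one_iter_cone]) auto

text \<open>The \<open>N\<close>-th iterate of 1 lies in the cone, so its values on
  \<open>{0..1}\<close> are between \<open>Z_N / 4 powr s\<close> and \<open>Z_N\<close>; the
  \<open>M\<close>-th iterate is then applied to these constants.\<close>

lemma partition_fun_add_le:
  assumes s: "s \<ge> 0"
  shows "partition_fun n s (M + N) \<le> partition_fun n s M * partition_fun n s N"
    and "partition_fun n s M * partition_fun n s N \<le> 4 powr s * partition_fun n s (M + N)"
proof -
  let ?L = "transfer s {1..n}"
  have eq: "partition_fun n s (M + N) = (?L ^^ M) ((?L ^^ N) (\<lambda>_. 1)) 0"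
    by (simp add: partition_fun_def funpow_add)
  have c: "(?L ^^ M) (\<lambda>_. c * 1) 0 = c * partition_fun n s M" for c
    by (subst transfer_iter_cmult) (simp add: partition_fun_def)
  have "(?L ^^ M) ((?L ^^ N) (\<lambda>_. 1)) 0 \<le> (?L ^^ M) (\<lambda>_. partition_fun n s N * 1) 0"
    using distortion_cone_bounds(2)[OF one_iter_cone[OF s]] s
    by (intro transfer_iter_mono) (auto simp: partition_fun_def)
  then show "partition_fun n s (M + N) \<le> partition_fun n s M * partition_fun n s N"
    unfolding eq c by (simp only: mult.commute)
  have "(?L ^^ M) (\<lambda>_. partition_fun n s N * 1) 0 \<le> (?L ^^ M) (\<lambda>x. 4 powr s * (?L ^^ N) (\<lambda>_. 1) x) 0"
    using distortion_cone_bounds(4)[OF one_iter_cone[OF s]] s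
    by (intro transfer_iter_mono) (auto simp: partition_fun_def)
  then show "partition_fun n s M * partition_fun n s N \<le> 4 powr s * partition_fun n s (M + N)"
    unfolding eq c transfer_iter_cmult by (simp only: mult.commute[of "partition_fun n s M"] c[of 1, simplified])
qed

lemma partition_fun_mult_le:
  assumes "s \<ge> 0"
  shows "partition_fun n s (M * N) \<le> partition_fun n s M ^ N"
proof (induction N)
  case (Suc N)
  have "partition_fun n s (M * Suc N) \<le> partition_fun n s M * partition_fun n s (M * N)"
    using partition_fun_add_le(1)[OF assms, of n M "M * N"] by simp
  also have "\<dots> \<le> partition_fun n s M * partition_fun n s M ^ N"
    using Suc partition_fun_nonneg[OF assms] by (intro mult_left_mono) auto
  finally show ?case by simp
qed simp

lemma partition_fun_mult_ge:
  assumes "s \<ge> 0"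
  shows "partition_fun n s M ^ Suc N \<le> (4 powr s) ^ N * partition_fun n s (M * Suc N)"
proof (induction N)
  case (Suc N)
  have "partition_fun n s M ^ Suc (Suc N) \<le> partition_fun n s M * ((4 powr s) ^ N * partition_fun n s (M * Suc N))"
    using Suc partition_fun_nonneg[OF assms] by (simp add: mult_left_mono)
  also have "\<dots> = (4 powr s) ^ N * (partition_fun n s M * partition_fun n s (M * Suc N))" by simp
  also have "\<dots> \<le> (4 powr s) ^ N * (4 powr s * partition_fun n s (M + M * Suc N))"
    using partition_fun_add_le(2)[OF assms] by (intro mult_left_mono) auto
  finally show ?case by (simp add: algebra_simps)
qed simp

lemma continuous_partition_fun: "continuous_on UNIV (\<lambda>s. partition_fun n s N)"
proof -
  have "x \<ge> 0 \<Longrightarrow> continuous_on UNIV (\<lambda>s. (transfer s {1..n} ^^ N) (\<lambda>_. 1) x)" for x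
  proof (induction N arbitrary: x)
    case (Suc N)
    have "continuous_on UNIV (\<lambda>s. \<Sum>k\<in>{1..n}. (x + real k) powr (-(2 * s)) * (transfer s {1..n} ^^ N) (\<lambda>_. 1) (gauss_branch k x))"
      using Suc gauss_branch_nonneg by (intro continuous_intros) auto
    then show ?case by (subst (asm) transfer_def[symmetric]) simp
  qed simp
  then show ?thesis by (simp add: partition_fun_def)
qed

lemma partition_fun_at_zero: "partition_fun n 0 N = real n ^ N"
proof -
  have "x \<ge> 0 \<Longrightarrow> (transfer 0 {1..n} ^^ N) (\<lambda>_. 1) x = real n ^ N" for x
  proof (induction N arbitrary: x)
    case (Suc N)
    have "(\<Sum>k = 1..n. (x + real k) powr (- (2 * 0)) * (transfer 0 {1..n} ^^ N) (\<lambda>_. 1) (gauss_branch k x))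
       = (\<Sum>k = 1..n. real n ^ N)"
      using Suc gauss_branch_nonneg by (intro sum.cong) auto
    also have "\<dots> = real n ^ Suc N" by simp
    finally show ?case unfolding funpow.simps comp_apply by (subst transfer_def)
  qed simp
  then show ?thesis by (simp add: partition_fun_def)
qed

text \<open>At word length one the digit 1 contributes 1 for every exponent, so length two is taken:
  the denominators \<open>1 + j * k\<close> are at least 2 and the sum is at most
  \<open>(n / 2 ^ n)^2\<close>. The exponent \<open>n\<close> is just a convenient large
  value.\<close>

lemma partition_fun_two_small:
  assumes "n \<ge> 1" shows "partition_fun n (real n) 2 < 1"
proof -
  let ?s = "real n"
  have "partition_fun n ?s 2 = (\<Sum>j=1..n. \<Sum>k=1..n. real j powr (-(2 * ?s)) * (1 / real j + real k) powr (-(2 * ?s)))"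
    unfolding partition_fun_def
    by (simp add: numeral_2_eq_2 transfer_def gauss_branch_def sum_distrib_left)
  also have "\<dots> \<le> (\<Sum>j=1..n. \<Sum>k=1..n. 2 powr (-(2 * ?s)))"
  proof (intro sum_mono)
    fix j k assume jk: "j \<in> {1..n}" "k \<in> {1..n}"
    have "real j powr (-(2 * ?s)) * (1 / real j + real k) powr (-(2 * ?s)) = (1 + real j * real k) powr (-(2 * ?s))"
    proof -
      have "real j * (1 / real j + real k) = 1 + real j * real k" using jk by (simp add: field_simps)
      then show ?thesis using jk by (subst powr_mult[symmetric]) auto
    qed
    also have "\<dots> \<le> 2 powr (-(2 * ?s))"
    proof (rule powr_mono2')
      have "real 1 * real 1 \<le> real j * real k" using jk by (intro mult_mono) auto
      then show "2 \<le> 1 + real j * real k" by simp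
    qed auto
    finally show "real j powr (-(2 * ?s)) * (1 / real j + real k) powr (-(2 * ?s)) \<le> 2 powr (-(2 * ?s))" .
  qed
  also have "\<dots> = (real n / 2 ^ n)\<^sup>2"
  proof -
    have "(2::real) powr (-(2 * ?s)) = 1 / (2 ^ n)\<^sup>2"
      by (simp add: powr_minus field_simps powr_realpow[symmetric] powr_powr)
    then show ?thesis by (simp add: power2_eq_square)
  qed
  also have "\<dots> < 1"
  proof -
    have "real n < 2 ^ n" using of_nat_less_iff[of n "2^n", where ?'a=real] by simp
    then show ?thesis by (intro power_strict_decreasing[of 0, simplified] power_less_one_iff[THEN iffD2]) (auto simp: power_less_one_iff)
  qed
  finally show ?thesis .
qed

text \<open>The zero of the pressure, in the strong form that the partition functions stay bounded
  on both sides. The lower bound comes from the choice of \<open>h\<close> as an infimum and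
  continuity, the upper one from supermultiplicativity up to \<open>4 powr s\<close>.\<close>

proposition critical_exponent:
  assumes n: "n \<ge> 1"
  obtains h where "h \<ge> 0" "\<And>N. 1 \<le> partition_fun n h N" "\<And>N. partition_fun n h N \<le> 4 powr h"
proof -
  define S where "S = {s. s \<ge> 0 \<and> (\<exists>N. partition_fun n s N < 1)}"
  define h where "h = Inf S"
  have ne: "real n \<in> S"
    unfolding S_def using partition_fun_two_small[OF n] by (intro CollectI conjI exI[of _ "2::nat"]) simp_all
  have bb: "bdd_below S" by (auto simp: S_def bdd_below_def)
  have h0: "h \<ge> 0" unfolding h_def
  proof (rule cInf_greatest)
    show "S \<noteq> {}" using ne by blast
  qed (auto simp: S_def)
  have cont: "isCont (\<lambda>s. partition_fun n s N) s" for s N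
    using continuous_partition_fun[of n N] by (simp add: continuous_on_eq_continuous_at)
  have 1: "1 \<le> partition_fun n h N" for N
  proof (rule ccontr)
    assume "\<not> ?thesis"
    then have lt: "partition_fun n h N < 1" by simp
    moreover have "1 \<le> real n ^ N" using n by (intro one_le_power) simp
    \<comment> \<open>Needed so that exponents slightly below \<open>h\<close> are still nonnegative
      and compete for the infimum.\<close>
    ultimately have "h \<noteq> 0" by (auto simp: partition_fun_at_zero)
    then have "h > 0" using h0 by simp
    have "\<forall>\<^sub>F s in at h. partition_fun n s N < 1"
      using cont[of h N] lt by (auto simp: isCont_def dest: order_tendstoD)
    then obtain d where d: "d > 0" "\<And>s. s \<noteq> h \<Longrightarrow> dist s h < d \<Longrightarrow> partition_fun n s N < 1"
      by (auto simp: eventually_at)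
    define s where "s = max (h / 2) (h - d / 2)"
    have "s < h" "s \<ge> 0" "dist s h < d"
      using \<open>h > 0\<close> d(1) by (auto simp: s_def dist_real_def)
    then have "s \<in> S" using d(2)[of s] by (auto simp: S_def)
    then have "h \<le> s" unfolding h_def using bb by (rule cInf_lower)
    then show False using \<open>s < h\<close> by simp
  qed
  have 2: "partition_fun n h N \<le> 4 powr h" for N
  proof (rule ccontr)
    assume "\<not> ?thesis"
    then have gt: "partition_fun n h N - 4 powr h > 0" by simp
    have "((\<lambda>s. partition_fun n s N - 4 powr s) \<longlongrightarrow> partition_fun n h N - 4 powr h) (at h)"
      using cont[of h N] by (auto simp: isCont_def intro!: tendsto_intros)
    then have "\<forall>\<^sub>F s in at h. partition_fun n s N - 4 powr s > 0"
      using gt by (rule order_tendstoD)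
    then obtain d where d: "d > 0" "\<And>s. s \<noteq> h \<Longrightarrow> dist s h < d \<Longrightarrow> partition_fun n s N > 4 powr s"
      by (auto simp: eventually_at)
    obtain s where s: "s \<in> S" "s < h + d"
      using cInf_less_iff[of S "h + d"] ne bb d(1) by (auto simp: h_def)
    have "h \<le> s" unfolding h_def using s bb by (intro cInf_lower)
    then have gs: "partition_fun n s N > 4 powr s" using d(2)[of s] gt s by (cases "s = h") (auto simp: dist_real_def)
    obtain M where M: "partition_fun n s M < 1" and s0: "s \<ge> 0" using s by (auto simp: S_def)
    have "M \<noteq> 0" using M by (intro notI) simp
    then obtain m where m: "M = Suc m" by (cases M) auto
    have "1 \<le> 4 powr s" using s0 by (simp add: ge_one_powr_ge_zero)
    then have "N \<noteq> 0" using gs by (intro notI) simp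
    \<comment> \<open>At length \<open>N * M\<close> two estimates collide: cutting into blocks of
      length \<open>M\<close> gives a value at most 1, cutting into blocks of length
      \<open>N\<close> gives one above \<open>4 powr s\<close>.\<close>
    have "partition_fun n s (N * M) \<le> partition_fun n s M ^ N"
      using partition_fun_mult_le[OF s0, of n M N] by (simp add: mult.commute)
    also have "\<dots> \<le> 1" using M partition_fun_nonneg[OF s0] by (intro power_le_one) auto
    finally have a: "partition_fun n s (N * M) \<le> 1" .
    have "(4 powr s) ^ M < partition_fun n s N ^ M"
      using gs m by (intro power_strict_mono) auto
    also have "\<dots> \<le> (4 powr s) ^ m * partition_fun n s (N * M)"
      using partition_fun_mult_ge[OF s0, of n N m] by (simp add: m)
    also have "\<dots> \<le> (4 powr s) ^ m * 1" using a by (intro mult_left_mono) auto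
    also have "\<dots> \<le> (4 powr s) ^ M" using \<open>1 \<le> 4 powr s\<close> by (simp add: m mult_le_cancel_right1)
    finally show False by simp
  qed
  show thesis using that h0 1 2 by blast
qed

subsection \<open>Conformal invariant means\<close>


text \<open>Tychonoff compactness supplies one functional for all coordinates simultaneously. Every
  closed condition that holds eventually along the sequence is inherited, which is how linearity,
  positivity and invariance are obtained.\<close>

lemma product_cluster_point:
  fixes A :: "nat \<Rightarrow> 'a \<Rightarrow> real"
  assumes "\<And>N f. A N f \<in> {- B f..B f}"
  obtains l where "\<And>P. closed P \<Longrightarrow> eventually (\<lambda>N. A N \<in> P) sequentially \<Longrightarrow> l \<in> P"
proof -
  let ?K = "PiE UNIV (\<lambda>f. {- B f..B f})"
  have "compactin (product_topology (\<lambda>f. euclidean) UNIV) ?K"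
    by (subst compactin_PiE) auto
  then have "compact ?K" by (simp add: euclidean_product_topology)
  moreover have "filtermap A sequentially \<noteq> bot" by (simp add: filtermap_bot_iff)
  moreover have "eventually (\<lambda>x. x \<in> ?K) (filtermap A sequentially)"
    using assms by (auto simp: eventually_filtermap PiE_def)
  ultimately obtain l where l: "inf (nhds l) (filtermap A sequentially) \<noteq> bot"
    unfolding compact_filter by blast
  have "l \<in> P" if P: "closed P" "eventually (\<lambda>N. A N \<in> P) sequentially" for P
  proof (rule ccontr)
    assume "l \<notin> P"
    then have "eventually (\<lambda>x. x \<in> - P) (nhds l)" using P(1) by (intro eventually_nhds_in_open) auto
    moreover have "eventually (\<lambda>x. x \<in> P) (filtermap A sequentially)" using P(2) by (simp add: eventually_filtermap)
    ultimately have "eventually (\<lambda>x. x \<in> - P \<and> x \<in> P) (inf (nhds l) (filtermap A sequentially))"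
      by (auto simp: eventually_inf)
    then show False using l by (simp add: trivial_limit_def)
  qed
  then show thesis using that by blast
qed

lemma closed_eval_le: "closed {l :: 'a \<Rightarrow> real. l f \<le> l g}"
  by (intro closed_Collect_le continuous_on_product_coordinates)

text \<open>\<open>mean_transfer\<close> makes \<open>\<Lambda>\<close> a fixed point of the dual
  transfer operator. The laws concern functions bounded on \<open>{0..1}\<close> only. By
  \<open>n2\<close> the branch \<open>k = 2\<close> is available, which gains uniformly from
  lowering the exponent, whereas the branch \<open>k = 1\<close> gains nothing at
  \<open>x = 0\<close>.\<close>

locale conformal_mean =
  fixes n :: nat and h :: real and \<Lambda> :: "(real \<Rightarrow> real) \<Rightarrow> real"
  assumes n2: "n \<ge> 2" and h_nonneg: "h \<ge> 0"
    and mean_add: "\<And>f g. bdd01 f \<Longrightarrow> bdd01 g \<Longrightarrow> \<Lambda> (\<lambda>x. f x + g x) = \<Lambda> f + \<Lambda> g"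
    and mean_cmult: "\<And>c f. bdd01 f \<Longrightarrow> \<Lambda> (\<lambda>x. c * f x) = c * \<Lambda> f"
    and mean_mono: "\<And>f g. bdd01 f \<Longrightarrow> bdd01 g \<Longrightarrow> (\<And>x. x \<in> {0..1} \<Longrightarrow> f x \<le> g x) \<Longrightarrow> \<Lambda> f \<le> \<Lambda> g"
    and mean_one: "\<Lambda> (\<lambda>_. 1) = 1"
    and mean_transfer: "\<And>f. bdd01 f \<Longrightarrow> \<Lambda> (transfer h {1..n} f) = \<Lambda> f"

text \<open>A cluster point of the normalised averages of \<open>L\<^sup>j f(0)\<close>, taken in a product of compact intervals
  indexed by all bounded functions, is an invariant mean; no regularity of \<open>f\<close> is needed.\<close>

proposition conformal_mean_exists:
  assumes n: "n \<ge> 2"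
  obtains h \<Lambda> where "conformal_mean n h \<Lambda>"
proof -
  obtain h where h: "h \<ge> 0" "\<And>N. 1 \<le> partition_fun n h N" "\<And>N. partition_fun n h N \<le> 4 powr h"
    using critical_exponent[of n] n by (metis le_trans one_le_numeral)
  define L where "L = transfer h {1..n}"
  define W where "W N = (\<Sum>j<N. partition_fun n h j)" for N
  define Q where "Q N f = (\<Sum>j<N. (L ^^ j) f 0)" for N f
  \<comment> \<open>The value 0 at unbounded functions keeps every coordinate in a compact interval;
    the index \<open>Suc N\<close> keeps the denominator positive.\<close>
  define A where "A N f = (if bdd01 f then Q (Suc N) f / W (Suc N) else 0)" for N f
  define B where "B f = (SOME B. \<forall>x\<in>{0..1}. \<bar>f x\<bar> \<le> B)" for f :: "real \<Rightarrow> real"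
  have B: "\<bar>f x\<bar> \<le> B f" if "bdd01 f" "x \<in> {0..1}" for f x
    using that someI_ex[of "\<lambda>B. \<forall>x\<in>{0..1}. \<bar>f x\<bar> \<le> B"] unfolding bdd01_def B_def by blast
  have W: "W (Suc N) \<ge> real (Suc N)" for N
  proof -
    have "(\<Sum>j<Suc N. 1) \<le> W (Suc N)" unfolding W_def using h(2) by (intro sum_mono) auto
    then show ?thesis by simp
  qed
  have Wpos: "W (Suc N) > 0" for N using W[of N] by linarith
  have L0: "(L ^^ j) f 0 \<le> (L ^^ j) g 0" if "\<And>x. x \<in> {0..1} \<Longrightarrow> f x \<le> g x" for j f g
    unfolding L_def using that by (intro transfer_iter_mono) auto
  have Lc: "(L ^^ j) (\<lambda>_. c) 0 = c * partition_fun n h j" for j c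
    using transfer_iter_cmult[where f = "\<lambda>_. 1" and s = h and K = "{1..n}" and N = j and c = c] by (simp add: L_def partition_fun_def fun_eq_iff)
  have bnd: "\<bar>(L ^^ j) f 0\<bar> \<le> B f * partition_fun n h j" if "bdd01 f" for j f
  proof -
    have "(L ^^ j) f 0 \<le> B f * partition_fun n h j"
      using L0[of f "\<lambda>_. B f" j] B[OF that] by (simp add: Lc abs_le_iff)
    moreover have "- (B f) * partition_fun n h j \<le> (L ^^ j) f 0"
      using L0[of "\<lambda>_. - B f" f j] B[OF that] unfolding Lc by (smt (verit))
    ultimately show ?thesis by (simp add: abs_le_iff)
  qed
  have A_bnd: "A N f \<in> {- (if bdd01 f then B f else 0)..(if bdd01 f then B f else 0)}" for N f
  proof (cases "bdd01 f")
    case True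
    have "\<bar>Q (Suc N) f\<bar> \<le> (\<Sum>j<Suc N. B f * partition_fun n h j)"
      unfolding Q_def using bnd[OF True] by (intro order_trans[OF sum_abs] sum_mono)
    also have "\<dots> = B f * W (Suc N)" unfolding W_def by (simp only: sum_distrib_left)
    finally have "\<bar>Q (Suc N) f / W (Suc N)\<bar> \<le> B f" using Wpos[of N] by (simp add: field_simps)
    then show ?thesis using True unfolding A_def abs_le_iff by auto
  qed (simp add: A_def)
  obtain \<Lambda> where \<Lambda>: "\<And>P. closed P \<Longrightarrow> eventually (\<lambda>N. A N \<in> P) sequentially \<Longrightarrow> \<Lambda> \<in> P"
    using product_cluster_point[of A "\<lambda>f. if bdd01 f then B f else 0"] A_bnd by blast
  have "conformal_mean n h \<Lambda>"
  proof
    show "n \<ge> 2" "h \<ge> 0" using n h by auto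
  next
    fix f g assume fg: "bdd01 f" "bdd01 g"
    have "\<Lambda> \<in> {l. l (\<lambda>x. f x + g x) = l f + l g}"
      using fg by (intro \<Lambda> closed_Collect_eq continuous_intros continuous_on_product_coordinates)
        (auto simp: A_def Q_def L_def bdd01_add transfer_iter_add sum.distrib add_divide_distrib)
    then show "\<Lambda> (\<lambda>x. f x + g x) = \<Lambda> f + \<Lambda> g" by simp
  next
    fix f c assume f: "bdd01 f"
    then have bc: "bdd01 (\<lambda>x. c * f x)" by (intro bdd01_intros)
    have "\<Lambda> \<in> {l. l (\<lambda>x. c * f x) = c * l f}"
      using f bc by (intro \<Lambda> closed_Collect_eq continuous_intros continuous_on_product_coordinates)
        (auto simp: A_def Q_def L_def transfer_iter_cmult algebra_simps simp flip: sum_distrib_left)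
    then show "\<Lambda> (\<lambda>x. c * f x) = c * \<Lambda> f" by simp
  next
    fix f g assume fg: "bdd01 f" "bdd01 g" "\<And>x. x \<in> {0..1} \<Longrightarrow> f x \<le> g x"
    have "Q N f \<le> Q N g" for N unfolding Q_def using fg L0 by (intro sum_mono) auto
    then have "\<Lambda> \<in> {l. l f \<le> l g}"
      using fg less_imp_le[OF Wpos] by (intro \<Lambda> closed_eval_le always_eventually allI) (simp add: A_def divide_right_mono)
    then show "\<Lambda> f \<le> \<Lambda> g" by simp
  next
    have "\<Lambda> \<in> {l. l (\<lambda>_. 1) = 1}"
    proof (intro \<Lambda> closed_Collect_eq continuous_on_product_coordinates continuous_intros)
      have "Q (Suc N) (\<lambda>_. 1) = W (Suc N)" for N by (simp add: Q_def W_def Lc)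
      then show "\<forall>\<^sub>F N in sequentially. A N \<in> {l. l (\<lambda>_. 1) = 1}"
        using Wpos by (auto simp: A_def bdd01_const order_less_imp_not_eq2)
    qed
    then show "\<Lambda> (\<lambda>_. 1) = 1" by simp
  next
    fix f assume f: "bdd01 f"
    then have Lf: "bdd01 (L f)" unfolding L_def by (intro bdd01_intros) auto
    have "\<bar>\<Lambda> (L f) - \<Lambda> f\<bar> \<le> \<epsilon>" if \<epsilon>: "\<epsilon> > 0" for \<epsilon>
    proof -
      have "\<Lambda> \<in> {l. \<bar>l (L f) - l f\<bar> \<le> \<epsilon>}"
      proof (intro \<Lambda> closed_Collect_le continuous_intros continuous_on_product_coordinates)
        define C where "C = B f * 4 powr h + B f"
        have diff: "\<bar>A N (L f) - A N f\<bar> \<le> C / real (Suc N)" for N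
        proof -
          \<comment> \<open>Telescoping leaves two end terms. They are bounded because
            \<open>partition_fun n h\<close> is bounded above, while \<open>W\<close> grows at least
            linearly because \<open>partition_fun n h\<close> is at least 1.\<close>
          have Qd: "Q m (L f) - Q m f = (L ^^ m) f 0 - f 0" for m
            unfolding Q_def by (induction m) (simp_all add: funpow_swap1)
          have B0: "0 \<le> B f" using B[OF f, of 0] by simp
          have "\<bar>(L ^^ Suc N) f 0 - f 0\<bar> \<le> B f * partition_fun n h (Suc N) + B f"
            using bnd[OF f, of "Suc N"] B[OF f, of 0] by simp
          also have "\<dots> \<le> C" unfolding C_def using h(3)[of "Suc N"] B0 by (simp add: mult_left_mono)
          finally have "\<bar>Q (Suc N) (L f) - Q (Suc N) f\<bar> \<le> C" by (simp add: Qd)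
          then have "\<bar>A N (L f) - A N f\<bar> \<le> C / W (Suc N)"
            using f Lf Wpos[of N] by (simp add: A_def divide_right_mono flip: diff_divide_distrib)
          also have "\<dots> \<le> C / real (Suc N)"
            using W[of N] B0 by (intro divide_left_mono) (auto simp: C_def Wpos intro!: mult_pos_pos)
          finally show ?thesis .
        qed
        have "(\<lambda>N. C / real (Suc N)) \<longlonglongrightarrow> 0"
          using LIMSEQ_Suc[OF lim_const_over_n[of C]] by simp
        then have "\<forall>\<^sub>F N in sequentially. C / real (Suc N) < \<epsilon>" using \<epsilon> by (rule order_tendstoD)
        then show "\<forall>\<^sub>F N in sequentially. A N \<in> {l. \<bar>l (L f) - l f\<bar> \<le> \<epsilon>}"
          by eventually_elim (use diff in \<open>auto intro: order_trans less_imp_le\<close>)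
      qed
      then show ?thesis by simp
    qed
    then show "\<Lambda> (transfer h {1..n} f) = \<Lambda> f"
      using field_le_epsilon[of "\<bar>\<Lambda> (L f) - \<Lambda> f\<bar>" 0] by (force simp: L_def)
  qed
  then show thesis by (rule that)
qed

context conformal_mean begin

lemma mean_const: "\<Lambda> (\<lambda>_. c) = c"
  using mean_cmult[of "\<lambda>_. 1" c] mean_one by (simp add: bdd01_const)

lemma mean_uminus: "bdd01 f \<Longrightarrow> \<Lambda> (\<lambda>x. - f x) = - \<Lambda> f"
  using mean_cmult[of f "-1"] by simp

lemma mean_diff: "bdd01 f \<Longrightarrow> bdd01 g \<Longrightarrow> \<Lambda> (\<lambda>x. f x - g x) = \<Lambda> f - \<Lambda> g"
  using mean_add[of f "\<lambda>x. - g x"] mean_uminus[of g] bdd01_minus[of g] by simp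

lemma mean_cong: "bdd01 f \<Longrightarrow> bdd01 g \<Longrightarrow> (\<And>x. x \<in> {0..1} \<Longrightarrow> f x = g x) \<Longrightarrow> \<Lambda> f = \<Lambda> g"
  by (intro antisym mean_mono) auto

lemma mean_nonneg: "bdd01 f \<Longrightarrow> (\<And>x. x \<in> {0..1} \<Longrightarrow> 0 \<le> f x) \<Longrightarrow> 0 \<le> \<Lambda> f"
  using mean_mono[of "\<lambda>_. 0" f] by (simp add: mean_const bdd01_const)

lemma mean_le_const: "bdd01 f \<Longrightarrow> (\<And>x. x \<in> {0..1} \<Longrightarrow> f x \<le> c) \<Longrightarrow> \<Lambda> f \<le> c"
  using mean_mono[of f "\<lambda>_. c"] by (simp add: mean_const bdd01_const)

lemma mean_ge_const: "bdd01 f \<Longrightarrow> (\<And>x. x \<in> {0..1} \<Longrightarrow> c \<le> f x) \<Longrightarrow> c \<le> \<Lambda> f"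
  using mean_mono[of "\<lambda>_. c" f] by (simp add: mean_const bdd01_const)

lemma mean_sum:
  assumes "\<And>i. i \<in> I \<Longrightarrow> bdd01 (f i)"
  shows "\<Lambda> (\<lambda>x. \<Sum>i\<in>I. f i x) = (\<Sum>i\<in>I. \<Lambda> (f i))"
  using assms
  by (induction I rule: infinite_finite_induct) (auto simp: mean_const mean_add bdd01_sum)

end

subsection \<open>Comparison with Lebesgue measure\<close>


text \<open>In this form exponent 1 leaves telescoping weights, and
  \<open>(x + k) powr (2 - 2 * s)\<close> is the perturbation for \<open>s\<close> near 1.\<close>

lemma transfer_inverse_density:
  assumes "x \<ge> 0"
  shows "transfer s {1..n} (\<lambda>y. 1 / (1 + y)) x
    = (\<Sum>k=1..n. (x + real k) powr (2 - 2 * s) / ((x + real k) * (x + real k + 1)))"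
  unfolding transfer_def
proof (rule sum.cong)
  fix k assume k: "k \<in> {1..n}"
  have "(x + real k) powr (2 - 2 * s) = (x + real k) powr (- (2 * s)) * (x + real k) powr 2"
    by (simp flip: powr_add)
  also have "(x + real k) powr 2 = (x + real k) ^ 2"
    using assms k by (simp add: powr_numeral)
  finally show "(x + real k) powr (- (2 * s)) * (1 / (1 + gauss_branch k x))
      = (x + real k) powr (2 - 2 * s) / ((x + real k) * (x + real k + 1))"
    using assms k by (simp add: gauss_branch_def power2_eq_square divide_simps)
qed simp

lemma gauss_density_telescope:
  assumes "x \<ge> 0"
  shows "(\<Sum>k=1..n. 1 / ((x + real k) * (x + real k + 1))) = 1 / (1 + x) - 1 / (x + real n + 1)"
proof (induction n)
  case (Suc n)
  have "1 / ((x + real (Suc n)) * (x + real (Suc n) + 1)) = 1 / (x + real n + 1) - 1 / (x + real (Suc n) + 1)"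
    using assms by (simp add: divide_simps)
  then show ?case using Suc by simp
qed (simp add: add.commute)

lemma transfer_one_inverse_density:
  assumes "x \<ge> 0"
  shows "transfer 1 {1..n} (\<lambda>y. 1 / (1 + y)) x = 1 / (1 + x) - 1 / (x + real n + 1)"
proof -
  have "transfer 1 {1..n} (\<lambda>y. 1 / (1 + y)) x = (\<Sum>k=1..n. 1 / ((x + real k) * (x + real k + 1)))"
    using assms by (subst transfer_inverse_density) (auto intro!: sum.cong)
  then show ?thesis using gauss_density_telescope[OF assms] by simp
qed

section \<open>Contraction of the lumped Gauss-Kuzmin operator on monotone functions\<close>

lemma abel_sum_nonneg:
  fixes a w :: "nat \<Rightarrow> real"
  assumes "\<And>m. m \<le> n \<Longrightarrow> 0 \<le> (\<Sum>k=1..m. a k)"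
    and "\<And>k. 1 \<le> k \<Longrightarrow> k < n \<Longrightarrow> w (Suc k) \<le> w k" and "\<And>k. 1 \<le> k \<Longrightarrow> k \<le> n \<Longrightarrow> 0 \<le> w k"
  shows "0 \<le> (\<Sum>k=1..n. a k * w k)"
proof (cases "n = 0")
  case False
  \<comment> \<open>Abel summation as an induction: replacing \<open>w m\<close> by
    \<open>w (Suc m)\<close> can only lower the multiple of a nonnegative partial sum.\<close>
  have "m \<le> n \<Longrightarrow> m \<ge> 1 \<Longrightarrow> w m * (\<Sum>k=1..m. a k) \<le> (\<Sum>k=1..m. a k * w k)" for m
  proof (induction m)
    case (Suc m)
    show ?case
    proof (cases "m = 0")
      case False
      have "w (Suc m) * (\<Sum>k=1..m. a k) \<le> w m * (\<Sum>k=1..m. a k)"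
        using Suc False assms(1)[of m] assms(2)[of m] by (intro mult_right_mono) auto
      then show ?thesis using Suc False by (simp add: algebra_simps)
    qed (use Suc in simp)
  qed simp
  from this[of n] False assms(1)[of n] assms(3)[of n] show ?thesis
    by (smt (verit) le_refl less_one linorder_not_le mult_nonneg_nonneg)
qed simp

text \<open>All digits above \<open>n\<close> are lumped together at the point \<open>0\<close>, so that the weights sum up to one although the
  sum is finite.\<close>

definition markov :: "nat \<Rightarrow> (real \<Rightarrow> real) \<Rightarrow> real \<Rightarrow> real" where
  "markov n u x = (\<Sum>k=1..n. (1 + x) / ((x + real k) * (x + real k + 1)) * u (gauss_branch k x))
     + (1 + x) / (x + real n + 1) * u 0"

lemma markov_weights:
  assumes "x \<ge> 0"
  shows "(\<Sum>k=1..n. (1 + x) / ((x + real k) * (x + real k + 1))) = real n / (x + real n + 1)"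
proof -
  have "(\<Sum>k=1..n. (1 + x) / ((x + real k) * (x + real k + 1)))
      = (1 + x) * (1 / (1 + x) - 1 / (x + real n + 1))"
    by (subst gauss_density_telescope[OF assms, of n, symmetric]) (simp add: sum_distrib_left)
  also have "\<dots> = 1 - (1 + x) / (x + real n + 1)" using assms by (simp add: right_diff_distrib)
  also have "\<dots> = ((x + real n + 1) - (1 + x)) / (x + real n + 1)"
    using assms by (simp only: diff_divide_distrib) simp
  finally show ?thesis by simp
qed

lemma markov_minus: "markov n (\<lambda>x. - u x) x = - markov n u x"
  by (simp add: markov_def sum_negf)

text \<open>All weights, including that of the lump, sum to one; after subtraction of
  \<open>u 0\<close> the lump drops out.\<close>

lemma markov_shift:
  assumes "x \<ge> 0"
  shows "markov n u x = u 0 + (\<Sum>k=1..n. (1 + x) / ((x + real k) * (x + real k + 1)) * (u (gauss_branch k x) - u 0))"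
proof -
  let ?p = "\<lambda>k. (1 + x) / ((x + real k) * (x + real k + 1))"
  have "(\<Sum>k=1..n. ?p k * (u (gauss_branch k x) - u 0)) = (\<Sum>k=1..n. ?p k * u (gauss_branch k x)) - (\<Sum>k=1..n. ?p k) * u 0"
    by (simp only: right_diff_distrib sum_subtractf sum_distrib_right)
  moreover have "real n / (x + real n + 1) + (1 + x) / (x + real n + 1) = 1"
    using assms by (simp flip: add_divide_distrib)
  then have "(1 + x) / (x + real n + 1) = 1 - (\<Sum>k=1..n. ?p k)"
    using markov_weights[OF assms, of n] by simp
  ultimately show ?thesis unfolding markov_def by (simp only: left_diff_distrib mult_1)
qed

text \<open>Two effects of the same sign: \<open>u (gauss_branch k x)\<close> decreases in
  \<open>x\<close>, and the weights move to larger digits as \<open>x\<close> grows, their partial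
  sums being \<open>m / (x + m + 1)\<close>. Larger digits mean smaller points, so Abel summation
  settles the second effect.\<close>

lemma markov_antimono:
  assumes u: "mono_on {0..1} u"
  shows "antimono_on {0..1} (markov n u)"
proof (rule monotone_onI)
  fix x y :: real assume xy: "x \<in> {0..1}" "y \<in> {0..1}" "x \<le> y"
  let ?p = "\<lambda>x k. (1 + x) / ((x + real k) * (x + real k + 1))"
  let ?v = "\<lambda>x k. u (gauss_branch k x) - u 0"
  have x0: "x \<ge> 0" "y \<ge> 0" using xy by auto
  have "(\<Sum>k=1..n. ?p x k * ?v y k) \<le> (\<Sum>k=1..n. ?p x k * ?v x k)"
  proof (intro sum_mono mult_left_mono diff_right_mono)
    fix k assume "k \<in> {1..n}"
    then show "u (gauss_branch k y) \<le> u (gauss_branch k x)"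
      using xy gauss_branch_in[of x k] gauss_branch_in[of y k] gauss_branch_antimono[of x y k]
      by (intro mono_onD[OF u]) auto
  qed (use x0 in auto)
  moreover have "0 \<le> (\<Sum>k=1..n. (?p x k - ?p y k) * ?v y k)"
  proof (rule abel_sum_nonneg)
    fix m
    have "real m / (y + real m + 1) \<le> real m / (x + real m + 1)"
      using xy by (intro divide_left_mono) auto
    then show "0 \<le> (\<Sum>k=1..m. ?p x k - ?p y k)"
      unfolding sum_subtractf markov_weights[OF x0(1)] markov_weights[OF x0(2)] by simp
  next
    fix k :: nat assume k: "1 \<le> k"
    have "gauss_branch (Suc k) y \<le> gauss_branch k y"
      using k x0 by (simp add: gauss_branch_def frac_le)
    then show "?v y (Suc k) \<le> ?v y k"
      using k xy gauss_branch_in[of y k] gauss_branch_in[of y "Suc k"]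
      by (simp add: mono_onD[OF u])
    show "0 \<le> ?v y k"
      using k xy gauss_branch_in[of y k] mono_onD[OF u, of 0 "gauss_branch k y"] by simp
  qed
  ultimately show "markov n u y \<le> markov n u x"
    unfolding markov_shift[OF x0(1)] markov_shift[OF x0(2)] by (simp add: algebra_simps sum_subtractf)
qed

text \<open>The points and weights at \<open>x = 1\<close> are those at \<open>x = 0\<close> with
  the digit raised by one and the weight doubled. Hence the difference is at most the first term at
  \<open>x = 0\<close>, which has weight \<open>1/2\<close>.\<close>

lemma markov_contraction:
  assumes u: "mono_on {0..1} u" and n: "n \<ge> 1"
  shows "markov n u 0 - markov n u 1 \<le> (u 1 - u 0) / 2"
proof -
  let ?q = "\<lambda>k. 1 / (real k * (real k + 1)) * (u (1 / real k) - u 0)"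
  have q0: "0 \<le> ?q k" if "k \<ge> 1" for k
    using that by (intro mult_nonneg_nonneg) (auto intro!: mono_onD[OF u])
  have a: "markov n u 0 = u 0 + (\<Sum>k=1..n. ?q k)"
    by (subst markov_shift) (simp_all add: gauss_branch_def)
  have "(\<Sum>k=1..n. ?q (Suc k)) \<le> (\<Sum>k=1..n. 2 * ?q (Suc k))"
  proof (rule sum_mono)
    fix k assume "k \<in> {1..n}" show "?q (Suc k) \<le> 2 * ?q (Suc k)" using q0[of "Suc k"] by linarith
  qed
  also have "\<dots> = (\<Sum>k=1..n. (1 + 1) / ((1 + real k) * (1 + real k + 1)) * (u (gauss_branch k 1) - u 0))"
    by (intro sum.cong) (auto simp: gauss_branch_def add_ac)
  also have "\<dots> = markov n u 1 - u 0" by (subst markov_shift) simp_all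
  finally have b: "u 0 + (\<Sum>k=1..n. ?q (Suc k)) \<le> markov n u 1" by simp
  have "(\<Sum>k=1..n. ?q k) = ?q 1 + (\<Sum>k=Suc 1..n. ?q k)"
    using n by (rule sum.atLeast_Suc_atMost)
  also have "\<dots> \<le> ?q 1 + (\<Sum>k=Suc 1..Suc n. ?q k)"
    using q0 by (intro add_left_mono sum_mono2) auto
  also have "(\<Sum>k=Suc 1..Suc n. ?q k) = (\<Sum>k=1..n. ?q (Suc k))" by (rule sum.shift_bounds_cl_Suc_ivl)
  finally have "(\<Sum>k=1..n. ?q k) \<le> ?q 1 + (\<Sum>k=1..n. ?q (Suc k))" .
  moreover have "?q 1 = (u 1 - u 0) / 2" by simp
  ultimately show ?thesis using a b by linarith
qed

section \<open>Change of variables along the branches\<close>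

lemma integrable_continuous_times_mono:
  fixes u \<phi> :: "real \<Rightarrow> real"
  assumes "mono_on {0..1} u \<or> antimono_on {0..1} u" and \<phi>: "continuous_on {0..1} \<phi>"
  shows "(\<lambda>x. \<phi> x * u x) absolutely_integrable_on {0..1}"
proof -
  have main: "(\<lambda>x. \<phi> x * v x) absolutely_integrable_on {0..1}" if v: "mono_on {0..1} v" for v
  proof (rule absolutely_integrable_bounded_measurable_product_real)
    show "\<phi> \<in> borel_measurable (lebesgue_on {0..1})"
      using \<phi> by (intro continuous_imp_measurable_on_sets_lebesgue) auto
    show "bounded (\<phi> ` {0..1})"
      using \<phi> by (intro compact_imp_bounded compact_continuous_image) auto
    have "(\<lambda>x. v x - v 0) integrable_on {0..1}"
      using v by (intro integrable_on_mono_on) (auto simp: monotone_on_def)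
    then have "(\<lambda>x. v x - v 0) absolutely_integrable_on {0..1}"
      using v by (intro nonnegative_absolutely_integrable_1) (auto simp: monotone_on_def)
    then have "(\<lambda>x. (v x - v 0) + v 0) absolutely_integrable_on {0..1}"
      by (intro set_integral_add absolutely_integrable_on_const) auto
    then show "v absolutely_integrable_on {0..1}" by simp
  qed auto
  show ?thesis
    using assms(1)
  proof
    assume "antimono_on {0..1} u"
    then have "(\<lambda>x. \<phi> x * - u x) absolutely_integrable_on {0..1}"
      by (intro main) (auto simp: monotone_on_def)
    then have "(\<lambda>x. (-1) *\<^sub>R (\<phi> x * - u x)) absolutely_integrable_on {0..1}"
      by (rule absolutely_integrable_scaleR_left)
    then show ?thesis by simp
  qed (rule main)
qed

lemma gauss_branch_image: "k \<ge> 1 \<Longrightarrow> gauss_branch k ` {0..1} = {1 / (real k + 1)..1 / real k}"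
proof (intro equalityI subsetI)
  fix y assume "k \<ge> 1" "y \<in> {1 / (real k + 1)..1 / real k}"
  moreover from this have "y > 0" by (auto intro: less_le_trans[of 0 "1 / (real k + 1)"])
  ultimately have "1 / y - real k \<in> {0..1} \<and> gauss_branch k (1 / y - real k) = y"
    by (auto simp: gauss_branch_def field_simps)
  then show "y \<in> gauss_branch k ` {0..1}" by (metis imageI)
qed (auto simp: gauss_branch_def frac_le)

lemma integral_gauss_branch:
  assumes f: "f absolutely_integrable_on {0..1}" and k: "k \<ge> 1"
  shows "(\<lambda>x. f (gauss_branch k x) / (x + real k)^2) absolutely_integrable_on {0..1}"
    and "integral {0..1} (\<lambda>x. f (gauss_branch k x) / (x + real k)^2) = integral {1 / (real k + 1)..1 / real k} f"
proof -
  let ?g' = "\<lambda>x. - 1 / (x + real k)^2"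
  have der: "(gauss_branch k has_field_derivative ?g' x) (at x within {0..1})" if "x \<in> {0..1}" for x
    unfolding gauss_branch_def using that k
    by (auto intro!: derivative_eq_intros simp: power2_eq_square divide_simps)
  have inj: "inj_on (gauss_branch k) {0..1}"
    using k by (auto simp: inj_on_def gauss_branch_def)
  have f': "f absolutely_integrable_on gauss_branch k ` {0..1}"
    unfolding gauss_branch_image[OF k] using f
    by (rule absolutely_integrable_on_subinterval) (use k in \<open>auto simp: field_simps\<close>)
  have "(\<lambda>x. \<bar>?g' x\<bar> * f (gauss_branch k x)) absolutely_integrable_on {0..1} \<and>
        integral {0..1} (\<lambda>x. \<bar>?g' x\<bar> * f (gauss_branch k x)) = integral (gauss_branch k ` {0..1}) f"
    using f' by (subst has_absolute_integral_change_of_variables_1'[OF _ der inj]) auto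
  then show "(\<lambda>x. f (gauss_branch k x) / (x + real k)^2) absolutely_integrable_on {0..1}"
    and "integral {0..1} (\<lambda>x. f (gauss_branch k x) / (x + real k)^2) = integral {1 / (real k + 1)..1 / real k} f"
    by (simp_all add: gauss_branch_image[OF k])
qed

lemma transfer_one_eq: "x \<ge> 0 \<Longrightarrow> transfer 1 {1..n} f x = (\<Sum>k=1..n. f (gauss_branch k x) / (x + real k)^2)"
  unfolding transfer_def by (intro sum.cong) (auto simp: powr_minus powr_numeral divide_simps)

lemma integral_transfer_one:
  assumes f: "f absolutely_integrable_on {0..1}"
  shows "transfer 1 {1..n} f integrable_on {0..1}"
    and "integral {0..1} (transfer 1 {1..n} f) = integral {1 / (real n + 1)..1} f"
proof -
  let ?s = "\<lambda>x. \<Sum>k=1..n. f (gauss_branch k x) / (x + real k)^2"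
  have i: "(\<lambda>x. f (gauss_branch k x) / (x + real k)^2) integrable_on {0..1}" if "k \<in> {1..n}" for k
    using integral_gauss_branch(1)[OF f, of k] that absolutely_integrable_on_def by auto
  have s: "?s integrable_on {0..1}" using i by (intro integrable_sum) auto
  then show "transfer 1 {1..n} f integrable_on {0..1}"
    by (rule integrable_eq) (simp add: transfer_one_eq)
  have "integral {0..1} (transfer 1 {1..n} f) = integral {0..1} ?s"
    by (rule integral_cong) (simp add: transfer_one_eq)
  also have "\<dots> = (\<Sum>k=1..n. integral {1 / (real k + 1)..1 / real k} f)"
    using i integral_gauss_branch(2)[OF f] by (subst integral_sum) auto
  also have "\<dots> = integral {1 / (real n + 1)..1} f"
  proof (induction n)
    case (Suc n)
    have "f integrable_on {0..1}" using f absolutely_integrable_on_def by blast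
    then have "f integrable_on {1 / (real (Suc n) + 1)..1}"
      by (rule integrable_subinterval_real) (auto simp: field_simps)
    then have "integral {1 / (real (Suc n) + 1)..1 / real (Suc n)} f + integral {1 / real (Suc n)..1} f
        = integral {1 / (real (Suc n) + 1)..1} f"
      by (intro Henstock_Kurzweil_Integration.integral_combine) (auto simp: field_simps)
    then show ?case using Suc by (simp add: add.commute)
  qed simp
  finally show "integral {0..1} (transfer 1 {1..n} f) = integral {1 / (real n + 1)..1} f" .
qed

text \<open>\<open>markov n\<close> is the exponent-one transfer operator conjugated by the Gauss
  density, plus the lump. This links its contraction to the invariance of \<open>\<Lambda>\<close>
  on one side and to the change of variables on the other.\<close>

lemma inverse_density_markov:
  assumes "x \<ge> 0"
  shows "1 / (1 + x) * markov n u x = transfer 1 {1..n} (\<lambda>y. 1 / (1 + y) * u y) x + u 0 / (x + real n + 1)"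
proof -
  have "1 / (1 + x) * ((1 + x) / ((x + real k) * (x + real k + 1)) * w)
      = 1 / (1 + gauss_branch k x) * w / (x + real k)^2" if "k \<in> {1..n}" for k w
  proof -
    have "1 + gauss_branch k x = (x + real k + 1) / (x + real k)"
      using assms that by (simp add: gauss_branch_def field_simps)
    then show ?thesis using assms that by (simp add: power2_eq_square)
  qed
  then have "(\<Sum>k=1..n. 1 / (1 + x) * ((1 + x) / ((x + real k) * (x + real k + 1)) * u (gauss_branch k x)))
      = (\<Sum>k=1..n. 1 / (1 + gauss_branch k x) * u (gauss_branch k x) / (x + real k)^2)"
    by (intro sum.cong) auto
  moreover have "1 / (1 + x) * ((1 + x) / (x + real n + 1) * u 0) = u 0 / (x + real n + 1)"
    using assms by simp
  ultimately show ?thesis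
    unfolding markov_def transfer_one_eq[OF assms] distrib_left sum_distrib_left by (simp only:)
qed

lemma integral_inverse_density: "integral {0..1} (\<lambda>x. 1 / (1 + x)) = ln (2::real)"
proof -
  have "((\<lambda>x. 1 / (1 + x)) has_integral ln (1 + 1) - ln (1 + 0)) {0..1::real}"
    by (rule fundamental_theorem_of_calculus)
      (auto intro!: derivative_eq_intros simp flip: has_real_derivative_iff_has_vector_derivative)
  then show ?thesis by (simp add: integral_unique)
qed


section \<open>Uniform comparison on monotone functions\<close>

definition mono01 :: "(real \<Rightarrow> real) \<Rightarrow> bool" where
  "mono01 u \<longleftrightarrow> (mono_on {0..1} u \<or> antimono_on {0..1} u) \<and> (\<forall>x\<in>{0..1}. 0 \<le> u x \<and> u x \<le> 1)"

lemma bdd01_mono01: "mono01 u \<Longrightarrow> bdd01 u"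
  by (rule bdd01I[of _ 1]) (auto simp: mono01_def)

lemma bdd01_divide [bdd01_intros]: "bdd01 f \<Longrightarrow> bdd01 (\<lambda>x. f x / c)"
  using bdd01_mult[OF _ bdd01_const, of f "1 / c"] by simp

lemma bdd01_inverse_shift [bdd01_intros]: "c > 0 \<Longrightarrow> bdd01 (\<lambda>x. a / (x + c))"
  by (rule bdd01_continuous) (auto intro!: continuous_intros)

lemma bdd01_inverse_shift' [bdd01_intros]: "c > 0 \<Longrightarrow> bdd01 (\<lambda>x. a / (c + x))"
  by (rule bdd01_continuous) (auto intro!: continuous_intros)

lemma bdd01_inverse_shift_Suc [bdd01_intros]: "bdd01 (\<lambda>x. a / (x + real n + 1))"
  by (rule bdd01_continuous) (auto intro!: continuous_intros)

lemma transfer_exponent_antimono: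
  assumes "x \<in> {0..1}" "s \<le> t" "\<And>y. y \<in> {0..1} \<Longrightarrow> 0 \<le> f y"
  shows "transfer t {1..n} f x \<le> transfer s {1..n} f x"
  unfolding transfer_def
proof (intro sum_mono mult_right_mono powr_mono)
  fix k assume "k \<in> {1..n}"
  then show "1 \<le> x + real k" "0 \<le> f (gauss_branch k x)"
    using assms gauss_branch_in[OF assms(1), of k] by auto
qed (use assms in auto)

lemma markov_mono01:
  assumes "mono01 u"
  shows "mono_on {0..1} (markov n u) \<or> antimono_on {0..1} (markov n u)"
proof -
  have "mono_on {0..1} u \<or> mono_on {0..1} (\<lambda>x. - u x)"
    using assms by (auto simp: mono01_def monotone_on_def)
  then show ?thesis
  proof
    assume "mono_on {0..1} (\<lambda>x. - u x)"
    then have "antimono_on {0..1} (markov n (\<lambda>x. - u x))" by (rule markov_antimono)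
    then show ?thesis by (simp add: monotone_on_def markov_minus)
  qed (auto dest: markov_antimono)
qed

text \<open>\<open>mono01\<close> admits both directions because \<open>markov n\<close> reverses
  monotonicity. Its image has oscillation at most one half, so removing a constant and doubling
  returns to \<open>mono01\<close> and the step can be iterated.\<close>

lemma markov_rescale:
  assumes u: "mono01 u" and n: "n \<ge> 1"
  obtains c w where "mono01 w" "\<And>x. markov n u x = c + w x / 2"
proof -
  have u01: "0 \<le> u 0" "u 0 \<le> 1" "0 \<le> u 1" "u 1 \<le> 1" using u by (auto simp: mono01_def)
  show ?thesis
  proof (cases "mono_on {0..1} u")
    case True
    have a: "antimono_on {0..1} (markov n u)" using True by (rule markov_antimono)
    have "markov n u 0 - markov n u 1 \<le> (u 1 - u 0) / 2" using True n by (rule markov_contraction)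
    also have "\<dots> \<le> 1 / 2" using u01 by simp
    finally have b: "markov n u 0 - markov n u 1 \<le> 1 / 2" .
    have "mono01 (\<lambda>x. 2 * (markov n u x - markov n u 1))"
      unfolding mono01_def
    proof (intro conjI ballI disjI2)
      fix x :: real assume x: "x \<in> {0..1}"
      show "0 \<le> 2 * (markov n u x - markov n u 1)" using x monotone_onD[OF a, of x 1] by simp
      show "2 * (markov n u x - markov n u 1) \<le> 1" using x b monotone_onD[OF a, of 0 x] by simp
    qed (use a in \<open>auto simp: monotone_on_def\<close>)
    then show ?thesis by (rule that[of _ "markov n u 1"]) (simp add: field_simps)
  next
    case False
    let ?v = "\<lambda>x. - u x"
    have v: "mono_on {0..1} ?v" using u False by (auto simp: mono01_def monotone_on_def)
    have a: "antimono_on {0..1} (markov n ?v)" using v by (rule markov_antimono)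
    have "markov n ?v 0 - markov n ?v 1 \<le> (?v 1 - ?v 0) / 2" using v n by (rule markov_contraction)
    also have "\<dots> \<le> 1 / 2" using u01 by simp
    finally have b: "markov n ?v 0 - markov n ?v 1 \<le> 1 / 2" .
    have "mono01 (\<lambda>x. 2 * (markov n u x - markov n u 0))"
      unfolding mono01_def
    proof (intro conjI ballI disjI1)
      fix x :: real assume x: "x \<in> {0..1}"
      show "0 \<le> 2 * (markov n u x - markov n u 0)" using x monotone_onD[OF a, of 0 x] by (simp add: markov_minus)
      show "2 * (markov n u x - markov n u 0) \<le> 1" using x b monotone_onD[OF a, of x 1] by (simp add: markov_minus)
    qed (use a in \<open>auto simp: monotone_on_def markov_minus\<close>)
    then show ?thesis by (rule that[of _ "markov n u 0"]) (simp add: field_simps)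
  qed
qed

context conformal_mean begin

lemma bdd01_transfer_h [bdd01_intros]: "bdd01 f \<Longrightarrow> bdd01 (transfer s {1..n} f)"
  by (intro bdd01_intros) auto

text \<open>With an exponent of at least 1 the transfer operator would lower the Gauss density by at
  least \<open>1 / (n + 2)\<close> everywhere, contrary to invariance.\<close>

lemma h_less_1: "h < 1"
proof (rule ccontr)
  assume "\<not> h < 1"
  let ?r = "\<lambda>x::real. 1 / (1 + x)"
  have b: "bdd01 ?r" by (intro bdd01_intros) simp
  have "\<Lambda> (transfer h {1..n} ?r) \<le> \<Lambda> (\<lambda>x. ?r x - 1 / (real n + 2))"
  proof (rule mean_mono)
    fix x :: real assume x: "x \<in> {0..1}"
    have "transfer h {1..n} ?r x \<le> transfer 1 {1..n} ?r x"
      using x \<open>\<not> h < 1\<close> by (intro transfer_exponent_antimono) auto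
    also have "\<dots> = ?r x - 1 / (x + real n + 1)" using x by (intro transfer_one_inverse_density) auto
    also have "\<dots> \<le> ?r x - 1 / (real n + 2)" using x by (auto intro!: frac_le)
    finally show "transfer h {1..n} ?r x \<le> ?r x - 1 / (real n + 2)" .
  qed (use b in \<open>intro bdd01_intros; simp\<close>)+
  also have "\<dots> = \<Lambda> ?r - 1 / (real n + 2)"
    using b by (subst mean_diff) (auto intro: bdd01_intros simp: mean_const)
  finally show False using mean_transfer[OF b] by simp
qed

text \<open>The loss of mass caused by omitting the digits above \<open>n\<close> balances the gain from lowering the
  exponent.\<close>

lemma mean_excess:
  "\<Lambda> (\<lambda>x. transfer h {1..n} (\<lambda>y. 1 / (1 + y)) x - transfer 1 {1..n} (\<lambda>y. 1 / (1 + y)) x)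
    = \<Lambda> (\<lambda>x. 1 / (x + real n + 1))"
proof -
  let ?r = "\<lambda>x::real. 1 / (1 + x)"
  have b: "bdd01 ?r" by (intro bdd01_intros) simp
  have "\<Lambda> (transfer 1 {1..n} ?r) = \<Lambda> (\<lambda>x. ?r x - 1 / (x + real n + 1))"
    using b by (intro mean_cong bdd01_intros) (auto simp: transfer_one_inverse_density)
  also have "\<dots> = \<Lambda> ?r - \<Lambda> (\<lambda>x. 1 / (x + real n + 1))"
    by (intro mean_diff; intro bdd01_intros; simp)
  finally show ?thesis
    using b mean_transfer[OF b] by (subst mean_diff) (auto intro!: bdd01_intros)
qed

lemma mean_tail_bounds:
  "1 / (real n + 2) \<le> \<Lambda> (\<lambda>x. 1 / (x + real n + 1))" "\<Lambda> (\<lambda>x. 1 / (x + real n + 1)) \<le> 1 / (real n + 1)"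
  by (intro mean_ge_const mean_le_const bdd01_intros; auto intro!: frac_le)+

text \<open>Only the branch \<open>k = 2\<close> is kept: it gains at least
  \<open>(1 - h) * ln 2 / 6\<close>, against a total loss of at most \<open>1 / (n + 1)\<close>, and
  \<open>ln 2 >= 2/3\<close> gives the 9. This crude bound already makes
  \<open>n powr (1 - h)\<close> tend to 1.\<close>

lemma one_minus_h_le: "1 - h \<le> 9 / (real n + 1)"
proof -
  let ?r = "\<lambda>x::real. 1 / (1 + x)"
  have b: "bdd01 ?r" by (intro bdd01_intros) simp
  have "(1 - h) * ln 2 / 6 \<le> \<Lambda> (\<lambda>x. transfer h {1..n} ?r x - transfer 1 {1..n} ?r x)"
  proof (rule mean_ge_const)
    fix x :: real assume x: "x \<in> {0..1}"
    let ?t = "\<lambda>s k. (x + real k) powr (2 - 2 * s) / ((x + real k) * (x + real k + 1))"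
    have pos: "0 \<le> ?t h k - ?t 1 k" if "k \<in> {1..n}" for k
    proof -
      have "1 \<le> (x + real k) powr (2 - 2 * h)" using x that h_less_1 by (intro ge_one_powr_ge_zero) auto
      then have "?t 1 k \<le> ?t h k" using x that by (intro divide_right_mono) auto
      then show ?thesis by simp
    qed
    have "1 + (2 - 2 * h) * ln 2 \<le> 2 powr (2 - 2 * h)"
      using exp_ge_add_one_self[of "(2 - 2 * h) * ln 2"] by (simp add: powr_def)
    also have "\<dots> \<le> (x + 2) powr (2 - 2 * h)" using x h_less_1 by (intro powr_mono2) auto
    finally have ge: "1 + (2 - 2 * h) * ln 2 \<le> (x + 2) powr (2 - 2 * h)" .
    then have "(2 - 2 * h) * ln 2 / 12 \<le> ((x + 2) powr (2 - 2 * h) - 1) / ((x + 2) * (x + 2 + 1))"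
    proof (intro frac_le)
      have "(x + 2) * (x + 2 + 1) \<le> 3 * 4" using x by (intro mult_mono) auto
      then show "(x + 2) * (x + 2 + 1) \<le> 12" by simp
      have "0 \<le> (2 - 2 * h) * ln (2::real)" using h_less_1 by simp
      then show "0 \<le> (x + 2) powr (2 - 2 * h) - 1"
        using ge by linarith
    qed (use x in auto)
    also have "\<dots> = ?t h 2 - ?t 1 2" using x by (simp add: diff_divide_distrib)
    also have "\<dots> \<le> (\<Sum>k=1..n. ?t h k - ?t 1 k)"
      using pos n2 by (intro member_le_sum) auto
    also have "\<dots> = transfer h {1..n} ?r x - transfer 1 {1..n} ?r x"
      using x by (subst (1 2) transfer_inverse_density) (auto simp: sum_subtractf)
    finally have "(2 - 2 * h) * ln 2 / 12 \<le> transfer h {1..n} ?r x - transfer 1 {1..n} ?r x" .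
    moreover have "2 - 2 * h = 2 * (1 - h)" by simp
    then have "(1 - h) * ln 2 / 6 = (2 - 2 * h) * ln 2 / 12" by (simp only:)
    ultimately show "(1 - h) * ln 2 / 6 \<le> transfer h {1..n} ?r x - transfer 1 {1..n} ?r x" by (simp only:)
  qed (use b in \<open>auto intro!: bdd01_intros\<close>)
  also have "\<dots> \<le> 1 / (real n + 1)" unfolding mean_excess by (rule mean_tail_bounds)
  finally have "(1 - h) * ln 2 / 6 \<le> 1 / (real n + 1)" .
  moreover have "(1 - h) * (2 / 3) / 6 \<le> (1 - h) * ln 2 / 6"
    using h_less_1 ln2_ge_two_thirds by (intro divide_right_mono mult_left_mono) auto
  ultimately show ?thesis by simp
qed

text \<open>The functional \<open>gap\<close> vanishes on constants and is almost invariant under the Markov operator,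
  which halves the oscillation of monotone functions; hence it is uniformly \<open>O(1/n)\<close> on them.\<close>

definition gap :: "(real \<Rightarrow> real) \<Rightarrow> real" where
  "gap u = \<Lambda> (\<lambda>x. 1 / (1 + x) * u x) * ln 2
     - \<Lambda> (\<lambda>x. 1 / (1 + x)) * integral {0..1} (\<lambda>x. 1 / (1 + x) * u x)"

lemma density_times_integrable:
  fixes u :: "real \<Rightarrow> real"
  shows "mono_on {0..1} u \<or> antimono_on {0..1} u \<Longrightarrow> (\<lambda>x. 1 / (1 + x) * u x) absolutely_integrable_on {0..1}"
  by (rule integrable_continuous_times_mono) (auto intro!: continuous_intros)

lemma density_times_integrable':
  fixes u :: "real \<Rightarrow> real"
  shows "mono_on {0..1} u \<or> antimono_on {0..1} u \<Longrightarrow> (\<lambda>x. 1 / (1 + x) * u x) integrable_on {0..1}"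
  using density_times_integrable absolutely_integrable_on_def by blast

lemma gap_affine:
  assumes w: "mono01 w"
  shows "gap (\<lambda>x. c + w x / 2) = gap w / 2"
proof -
  have bw: "bdd01 (\<lambda>x. 1 / (1 + x) * w x)" and br: "bdd01 (\<lambda>x. 1 / (1 + x))"
    using bdd01_mono01[OF w] by (intro bdd01_intros; simp)+
  have eq: "(\<lambda>x. 1 / (1 + x) * (c + w x / 2)) = (\<lambda>x. c * (1 / (1 + x)) + (1 / 2) * (1 / (1 + x) * w x))"
    by (simp add: fun_eq_iff distrib_left)
  have "\<Lambda> (\<lambda>x. 1 / (1 + x) * (c + w x / 2)) = \<Lambda> (\<lambda>x. c * (1 / (1 + x))) + \<Lambda> (\<lambda>x. (1 / 2) * (1 / (1 + x) * w x))"
    unfolding eq by (intro mean_add bdd01_mult[OF bdd01_const] bw br)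
  then have 1: "\<Lambda> (\<lambda>x. 1 / (1 + x) * (c + w x / 2)) = c * \<Lambda> (\<lambda>x. 1 / (1 + x)) + (1 / 2) * \<Lambda> (\<lambda>x. 1 / (1 + x) * w x)"
    unfolding mean_cmult[OF bw] mean_cmult[OF br] .
  have iw: "(\<lambda>x. 1 / (1 + x) * w x) integrable_on {0..1}"
    using w by (intro density_times_integrable') (auto simp: mono01_def)
  have ir: "(\<lambda>x::real. 1 / (1 + x)) integrable_on {0..1}"
    by (intro integrable_continuous_interval continuous_intros) auto
  have 2: "integral {0..1} (\<lambda>x. 1 / (1 + x) * (c + w x / 2)) = c * ln 2 + (1 / 2) * integral {0..1} (\<lambda>x. 1 / (1 + x) * w x)"
    unfolding eq Henstock_Kurzweil_Integration.integral_add[OF integrable_on_mult_right[OF ir] integrable_on_mult_right[OF iw]]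
      integral_mult_right integral_inverse_density ..
  show ?thesis unfolding gap_def 1 2 by (simp add: algebra_simps)
qed

text \<open>Both terms of \<open>gap\<close> change by at most \<open>1 / (n + 1)\<close>. For
  \<open>\<Lambda>\<close> the loss is due to the exponent 1 in place of \<open>h\<close>, for the
  integral to the missing interval \<open>{0..1 / (n + 1)}\<close>; in both cases the lump
  contributes with the opposite sign.\<close>

lemma gap_markov:
  assumes u: "mono01 u"
  shows "\<bar>gap u\<bar> \<le> \<bar>gap (markov n u)\<bar> + 2 / (real n + 1)"
proof -
  define f where "f x = 1 / (1 + x) * u x" for x
  have u01: "0 \<le> u x" "u x \<le> 1" if "x \<in> {0..1}" for x using u that by (auto simp: mono01_def)
  have bf: "bdd01 f" unfolding f_def using bdd01_mono01[OF u] by (intro bdd01_intros; simp)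
  have f0: "0 \<le> f x" "f x \<le> 1 / (1 + x)" if "x \<in> {0..1}" for x
    using u01[OF that] that by (auto simp: f_def divide_right_mono)
  have f1: "f x \<le> 1" if "x \<in> {0..1}" for x
    using f0(2)[OF that] that by (auto elim!: order_trans)
  let ?T = "\<lambda>x. 1 / (x + real n + 1)"
  have m: "\<Lambda> (\<lambda>x. 1 / (1 + x) * markov n u x) = \<Lambda> (transfer 1 {1..n} f) + u 0 * \<Lambda> ?T"
  proof -
    have "\<Lambda> (\<lambda>x. 1 / (1 + x) * markov n u x) = \<Lambda> (\<lambda>x. transfer 1 {1..n} f x + u 0 * ?T x)"
    proof (rule mean_cong)
      show "bdd01 (\<lambda>x. 1 / (1 + x) * markov n u x)"
        using markov_mono01[OF u, of n] by (intro bdd01_intros) (auto intro: bdd01_mono_on bdd01_antimono_on)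
      show "bdd01 (\<lambda>x. transfer 1 {1..n} f x + u 0 * ?T x)" using bf by (intro bdd01_intros; simp)
      fix x :: real assume "x \<in> {0..1}"
      then show "1 / (1 + x) * markov n u x = transfer 1 {1..n} f x + u 0 * ?T x"
        using inverse_density_markov[of x n u] by (simp add: f_def[abs_def])
    qed
    moreover have "\<Lambda> (\<lambda>x. transfer 1 {1..n} f x + u 0 * ?T x) = \<Lambda> (transfer 1 {1..n} f) + \<Lambda> (\<lambda>x. u 0 * ?T x)"
      using bf by (intro mean_add; intro bdd01_intros; simp)
    moreover have "\<Lambda> (\<lambda>x. u 0 * ?T x) = u 0 * \<Lambda> ?T" by (intro mean_cmult bdd01_intros)
    ultimately show ?thesis by simp
  qed
  have d0: "\<Lambda> (transfer 1 {1..n} f) \<le> \<Lambda> f"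
    unfolding mean_transfer[OF bf, symmetric]
    using bf h_less_1 f0 by (intro mean_mono bdd01_transfer_h transfer_exponent_antimono) auto
  \<comment> \<open>The gain from the lower exponent is monotone in the function, and
    \<open>f\<close> is dominated by the Gauss density, whose gain is known exactly from
    \<open>mean_excess\<close>.\<close>
  have "\<Lambda> (\<lambda>x. transfer h {1..n} f x - transfer 1 {1..n} f x) \<le> \<Lambda> ?T"
    unfolding mean_excess[symmetric]
  proof (intro mean_mono bdd01_intros bf)
    fix x :: real assume x: "x \<in> {0..1}"
    have "0 \<le> transfer h {1..n} (\<lambda>y. 1 / (1 + y) - f y) x - transfer 1 {1..n} (\<lambda>y. 1 / (1 + y) - f y) x"
      using transfer_exponent_antimono[OF x less_imp_le[OF h_less_1], of "\<lambda>y. 1 / (1 + y) - f y"] f0 by simp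
    moreover have "transfer s {1..n} (\<lambda>y. 1 / (1 + y) - f y) x
        = transfer s {1..n} (\<lambda>y. 1 / (1 + y)) x - transfer s {1..n} f x" for s
      by (simp add: transfer_def right_diff_distrib sum_subtractf)
    ultimately show "transfer h {1..n} f x - transfer 1 {1..n} f x
        \<le> transfer h {1..n} (\<lambda>y. 1 / (1 + y)) x - transfer 1 {1..n} (\<lambda>y. 1 / (1 + y)) x" by simp
  qed auto
  then have d1: "\<Lambda> f - \<Lambda> (transfer 1 {1..n} f) \<le> \<Lambda> ?T"
    using bf by (subst (asm) mean_diff) (auto intro!: bdd01_intros simp: mean_transfer)
  have T0: "0 \<le> \<Lambda> ?T" by (intro mean_nonneg bdd01_intros) auto
  have "0 \<le> u 0 * \<Lambda> ?T" "u 0 * \<Lambda> ?T \<le> 1 * \<Lambda> ?T"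
    using T0 u01[of 0] by (auto intro!: mult_left_le_one_le)
  then have E1: "\<bar>\<Lambda> (\<lambda>x. 1 / (1 + x) * markov n u x) - \<Lambda> f\<bar> \<le> 1 / (real n + 1)"
    using m d0 d1 mean_tail_bounds(2) by linarith
  have fi: "f absolutely_integrable_on {0..1}"
    unfolding f_def using u by (intro density_times_integrable) (auto simp: mono01_def)
  then have fi': "f integrable_on {0..1}" using absolutely_integrable_on_def by blast
  define c where "c = 1 / (real n + 1)"
  have c: "0 \<le> c" "c \<le> 1" by (auto simp: c_def)
  have Ti: "?T integrable_on {0..1}" by (intro integrable_continuous_interval continuous_intros) auto
  have i: "integral {0..1} (\<lambda>x. 1 / (1 + x) * markov n u x) = integral {c..1} f + u 0 * integral {0..1} ?T"
  proof -
    have "integral {0..1} (\<lambda>x. 1 / (1 + x) * markov n u x) = integral {0..1} (\<lambda>x. transfer 1 {1..n} f x + u 0 * ?T x)"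
    proof (rule integral_cong)
      fix x :: real assume "x \<in> {0..1}"
      then show "1 / (1 + x) * markov n u x = transfer 1 {1..n} f x + u 0 * ?T x"
        using inverse_density_markov[of x n u] by (simp add: f_def[abs_def])
    qed
    also have "\<dots> = integral {0..1} (transfer 1 {1..n} f) + integral {0..1} (\<lambda>x. u 0 * ?T x)"
      using integral_transfer_one(1)[OF fi] Ti
      by (intro Henstock_Kurzweil_Integration.integral_add integrable_on_mult_right)
    finally show ?thesis by (simp only: integral_mult_right integral_transfer_one(2)[OF fi] c_def)
  qed
  have s: "integral {0..c} f + integral {c..1} f = integral {0..1} f"
    using c fi' by (intro Henstock_Kurzweil_Integration.integral_combine)
  have fc: "f integrable_on {0..c}" using fi' c by (rule_tac integrable_subinterval_real) auto
  have "0 \<le> integral {0..c} f" using f0 c fc by (intro integral_nonneg) auto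
  moreover have "integral {0..c} f \<le> integral {0..c} (\<lambda>_. 1)" using f1 c fc by (intro integral_le) auto
  moreover have "integral {0..1} ?T \<le> integral {0..1::real} (\<lambda>_. c)"
    using Ti by (intro integral_le) (auto simp: c_def intro!: frac_le)
  moreover have "0 \<le> integral {0..1} ?T" using Ti by (intro integral_nonneg) auto
  ultimately have "0 \<le> integral {0..c} f" "integral {0..c} f \<le> c" "0 \<le> integral {0..1} ?T" "integral {0..1} ?T \<le> c"
    using c by simp_all
  moreover from this have "0 \<le> u 0 * integral {0..1} ?T" "u 0 * integral {0..1} ?T \<le> 1 * integral {0..1} ?T"
    using u01[of 0] by (auto intro!: mult_left_le_one_le)
  ultimately have E2: "\<bar>integral {0..1} (\<lambda>x. 1 / (1 + x) * markov n u x) - integral {0..1} f\<bar> \<le> c"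
    using i s by linarith
  have L: "0 \<le> \<Lambda> (\<lambda>x. 1 / (1 + x))" "\<Lambda> (\<lambda>x. 1 / (1 + x)) \<le> 1"
    by (intro mean_nonneg mean_le_const bdd01_intros; simp)+
  have l2: "0 \<le> ln (2::real)" "ln (2::real) \<le> 1" using ln_le_minus_one[of 2] by auto
  have "gap (markov n u) - gap u = (\<Lambda> (\<lambda>x. 1 / (1 + x) * markov n u x) - \<Lambda> f) * ln 2
     - \<Lambda> (\<lambda>x. 1 / (1 + x)) * (integral {0..1} (\<lambda>x. 1 / (1 + x) * markov n u x) - integral {0..1} f)"
    unfolding gap_def f_def by (simp add: algebra_simps)
  also have "\<bar>\<dots>\<bar> \<le> c * 1 + 1 * c"
  proof (rule order_trans[OF abs_triangle_ineq4 add_mono])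
    show "\<bar>(\<Lambda> (\<lambda>x. 1 / (1 + x) * markov n u x) - \<Lambda> f) * ln 2\<bar> \<le> c * 1"
      unfolding abs_mult using E1 l2 by (intro mult_mono) (auto simp: c_def)
    show "\<bar>\<Lambda> (\<lambda>x. 1 / (1 + x)) * (integral {0..1} (\<lambda>x. 1 / (1 + x) * markov n u x) - integral {0..1} f)\<bar> \<le> 1 * c"
      unfolding abs_mult using E2 L by (intro mult_mono) auto
  qed
  finally show ?thesis by (simp add: c_def)
qed

lemma gap_le:
  assumes u: "mono01 u"
  shows "\<bar>gap u\<bar> \<le> 4 / (real n + 1)"
proof -
  \<comment> \<open>The 4 is the fixed point of \<open>b = b / 2 + 2\<close>, the recursion given by
    \<open>gap_markov\<close> and the halving; the initial bound 1 is forgotten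
    geometrically.\<close>
  have *: "\<bar>gap u\<bar> \<le> (1 / 2) ^ m + 4 / (real n + 1)" if "mono01 u" for m u
    using that
  proof (induction m arbitrary: u)
    case 0
    have d: "0 \<le> 1 / (1 + x) * u x" "1 / (1 + x) * u x \<le> 1" if "x \<in> {0..1}" for x
      using 0 that by (auto simp: mono01_def field_simps intro: order_trans[of _ 1])
    have b: "bdd01 (\<lambda>x. 1 / (1 + x) * u x)" "bdd01 (\<lambda>x. 1 / (1 + x))" using bdd01_mono01[OF 0] by (intro bdd01_intros; simp)+
    have i: "(\<lambda>x. 1 / (1 + x) * u x) integrable_on {0..1}" using 0 by (intro density_times_integrable') (auto simp: mono01_def)
    have 1: "0 \<le> \<Lambda> (\<lambda>x. 1 / (1 + x) * u x)" "\<Lambda> (\<lambda>x. 1 / (1 + x) * u x) \<le> 1"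
      using b d by (intro mean_nonneg mean_le_const; simp)+
    have 2: "0 \<le> \<Lambda> (\<lambda>x. 1 / (1 + x))" "\<Lambda> (\<lambda>x. 1 / (1 + x)) \<le> 1"
      using b by (intro mean_nonneg mean_le_const; simp)+
    have 3: "0 \<le> integral {0..1} (\<lambda>x. 1 / (1 + x) * u x)" using d i by (intro integral_nonneg) auto
    have "integral {0..1} (\<lambda>x. 1 / (1 + x) * u x) \<le> integral {0..1::real} (\<lambda>_. 1)" using d i by (intro integral_le) auto
    then have 4: "integral {0..1} (\<lambda>x. 1 / (1 + x) * u x) \<le> 1" by simp
    have l2: "0 \<le> ln (2::real)" "ln (2::real) \<le> 1" using ln_le_minus_one[of 2] by auto
    have "\<Lambda> (\<lambda>x. 1 / (1 + x) * u x) * ln 2 \<le> 1" "0 \<le> \<Lambda> (\<lambda>x. 1 / (1 + x) * u x) * ln 2"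
      using 1 l2 by (intro mult_le_one mult_nonneg_nonneg; simp)+
    moreover have "\<Lambda> (\<lambda>x. 1 / (1 + x)) * integral {0..1} (\<lambda>x. 1 / (1 + x) * u x) \<le> 1"
      "0 \<le> \<Lambda> (\<lambda>x. 1 / (1 + x)) * integral {0..1} (\<lambda>x. 1 / (1 + x) * u x)"
      using 2 3 4 by (intro mult_le_one mult_nonneg_nonneg; simp)+
    ultimately have "\<bar>gap u\<bar> \<le> 1" unfolding gap_def by linarith
    then show ?case by (simp add: add_increasing2)
  next
    case (Suc m)
    obtain c w where w: "mono01 w" "\<And>x. markov n u x = c + w x / 2"
      using markov_rescale[OF Suc.prems, of n] n2 by (metis le_trans one_le_numeral)
    have "markov n u = (\<lambda>x. c + w x / 2)" using w by auto
    then have "gap (markov n u) = gap w / 2" using gap_affine[OF w(1)] by simp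
    then have "\<bar>gap u\<bar> \<le> \<bar>gap w\<bar> / 2 + 2 / (real n + 1)" using gap_markov[OF Suc.prems] by simp
    also have "\<dots> \<le> ((1 / 2) ^ m + 4 / (real n + 1)) / 2 + 2 / (real n + 1)" using Suc.IH[OF w(1)] by simp
    also have "\<dots> = (1 / 2) ^ Suc m + 4 / (real n + 1)"
    proof -
      define d where "d = 2 / (real n + 1)"
      have "4 / (real n + 1) = 2 * d" by (simp add: d_def)
      then show ?thesis by (simp only: d_def[symmetric]) (simp add: field_simps)
    qed
    finally show ?case .
  qed
  have "(\<lambda>m. (1 / 2) ^ m + 4 / (real n + 1)) \<longlonglongrightarrow> 0 + 4 / (real n + 1)"
    by (intro tendsto_intros LIMSEQ_realpow_zero) auto
  then show ?thesis using *[OF u] by (intro LIMSEQ_le_const) auto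
qed

theorem mean_minus_integral:
  assumes f: "mono01 f"
  shows "\<bar>\<Lambda> f - integral {0..1} f\<bar> \<le> 24 / (real n + 1)"
proof -
  \<comment> \<open>Testing \<open>gap\<close> with \<open>(1 + x) * f x / 2\<close> cancels the
    density; for increasing \<open>f\<close> the test function increases, and the 2 keeps it in
    \<open>{0..1}\<close>.\<close>
  have inc: "\<bar>\<Lambda> f * ln 2 - \<Lambda> (\<lambda>x. 1 / (1 + x)) * integral {0..1} f\<bar> \<le> 8 / (real n + 1)"
    if f: "mono_on {0..1} f" "\<forall>x\<in>{0..1}. 0 \<le> f x \<and> f x \<le> 1" for f
  proof -
    have "mono01 (\<lambda>x. (1 + x) * f x / 2)"
      unfolding mono01_def
    proof (intro conjI disjI1 monotone_onI ballI)
      fix x y :: real assume "x \<in> {0..1}" "y \<in> {0..1}" "x \<le> y"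
      then show "(1 + x) * f x / 2 \<le> (1 + y) * f y / 2"
        using f by (intro divide_right_mono mult_mono) (auto simp: monotone_on_def)
    next
      fix x :: real assume x: "x \<in> {0..1}"
      then show "0 \<le> (1 + x) * f x / 2" using f by auto
      have "(1 + x) * f x \<le> 2 * 1" using f x by (intro mult_mono) auto
      then show "(1 + x) * f x / 2 \<le> 1" by simp
    qed
    then have g: "\<bar>gap (\<lambda>x. (1 + x) * f x / 2)\<bar> \<le> 4 / (real n + 1)" by (rule gap_le)
    have bf: "bdd01 f" using f(1) by (rule bdd01_mono_on)
    have e: "1 / (1 + x) * ((1 + x) * f x / 2) = (1 / 2) * f x" if "x \<in> {0..1}" for x
      using that by simp
    have "\<Lambda> (\<lambda>x. 1 / (1 + x) * ((1 + x) * f x / 2)) = \<Lambda> (\<lambda>x. (1 / 2) * f x)"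
      using bf e by (intro mean_cong) ((intro bdd01_intros; simp)+)?
    also have "\<dots> = \<Lambda> f / 2" using bf by (subst mean_cmult) auto
    finally have 1: "\<Lambda> (\<lambda>x. 1 / (1 + x) * ((1 + x) * f x / 2)) = \<Lambda> f / 2" .
    have 2: "integral {0..1} (\<lambda>x. 1 / (1 + x) * ((1 + x) * f x / 2)) = integral {0..1} f / 2"
      using integral_cong[of "{0..1}" _ "\<lambda>x. (1 / 2) * f x", OF e] by (simp only: integral_mult_right)
    show ?thesis using g unfolding gap_def 1 2 by (simp add: field_simps abs_le_iff)
  qed
  \<comment> \<open>With this, the mean of the density can be replaced by \<open>ln 2\<close>. The
    two errors add up to \<open>16 / (n + 1)\<close>, and division by \<open>ln 2 >= 2/3\<close>
    gives 24.\<close>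
  have one: "\<bar>ln 2 - \<Lambda> (\<lambda>x. 1 / (1 + x))\<bar> \<le> 8 / (real n + 1)"
    using inc[of "\<lambda>_. 1"] by (simp add: mean_const monotone_on_def)
  have main: "\<bar>\<Lambda> f - integral {0..1} f\<bar> \<le> 24 / (real n + 1)"
    if f: "mono_on {0..1} f" "\<forall>x\<in>{0..1}. 0 \<le> f x \<and> f x \<le> 1" for f
  proof -
    have fi: "f integrable_on {0..1}" using f(1) by (rule integrable_on_mono_on)
    define I where "I = integral {0..1} f"
    have "0 \<le> I" unfolding I_def using f fi by (intro integral_nonneg) auto
    moreover have "I \<le> integral {0..1::real} (\<lambda>_. 1)" unfolding I_def using f fi by (intro integral_le) auto
    ultimately have I: "0 \<le> I" "I \<le> 1" by simp_all
    have "\<bar>(ln 2 - \<Lambda> (\<lambda>x. 1 / (1 + x))) * I\<bar> \<le> 8 / (real n + 1) * 1"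
      unfolding abs_mult using one I by (intro mult_mono) auto
    then have "\<bar>\<Lambda> f - I\<bar> * ln 2 \<le> 16 / (real n + 1)"
      using inc[OF f] unfolding I_def[symmetric] by (auto simp: algebra_simps abs_if split: if_splits)
    moreover have "\<bar>\<Lambda> f - I\<bar> * (2 / 3) \<le> \<bar>\<Lambda> f - I\<bar> * ln 2"
      using ln2_ge_two_thirds by (intro mult_left_mono) auto
    ultimately show ?thesis unfolding I_def by simp
  qed
  show ?thesis
  proof (cases "mono_on {0..1} f")
    case False
    then have g: "mono_on {0..1} (\<lambda>x. 1 - f x)" "\<forall>x\<in>{0..1}. 0 \<le> 1 - f x \<and> 1 - f x \<le> 1"
      using f by (auto simp: mono01_def monotone_on_def)
    have "(\<lambda>x. 1 - (1 - f x)) integrable_on {0..1}"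
      by (rule Henstock_Kurzweil_Integration.integrable_diff[OF integrable_const_ivl integrable_on_mono_on[OF g(1)]])
    moreover have "(\<lambda>x. 1 - (1 - f x)) = f" by simp
    ultimately have fi: "f integrable_on {0..1}" by (simp only:)
    have "\<Lambda> (\<lambda>x. 1 - f x) = 1 - \<Lambda> f"
      using bdd01_mono01[OF f] by (subst mean_diff) (auto intro: bdd01_intros simp: mean_const)
    moreover have "integral {0..1} (\<lambda>x. 1 - f x) = 1 - integral {0..1} f"
      using fi by (subst Henstock_Kurzweil_Integration.integral_diff) auto
    ultimately show ?thesis using main[OF g] by linarith
  qed (use main f in \<open>auto simp: mono01_def\<close>)
qed

end

subsection \<open>Masses of intervals\<close>


lemma powr_bernoulli:
  fixes r h :: real
  assumes "r \<ge> 0" "0 < h" "h \<le> 1"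
  shows "r powr h \<le> 1 + h * (r - 1)"
proof (cases "r = 0")
  case False
  then have r: "r > 0" using assms by simp
  have der: "((\<lambda>z. z powr h) has_real_derivative h * z powr (h - 1)) (at z)" if "z > 0" for z
    using that by (auto intro!: derivative_eq_intros)
  consider "r < 1" | "r = 1" | "r > 1" by linarith
  then show ?thesis
  proof cases
    case 1
    obtain z where z: "r < z" "z < 1" "1 powr h - r powr h = (1 - r) * (h * z powr (h - 1))"
      using MVT2[of r 1 "\<lambda>z. z powr h" "\<lambda>z. h * z powr (h - 1)"] der r 1 by force
    have "1 \<le> z powr (h - 1)" using z r assms powr_mono2'[of "h - 1" z 1] by simp
    then have "h * 1 \<le> h * z powr (h - 1)" using assms by (intro mult_left_mono) auto
    then have "(1 - r) * h \<le> (1 - r) * (h * z powr (h - 1))" using 1 by (intro mult_left_mono) auto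
    then show ?thesis using z by (simp add: algebra_simps)
  next
    case 3
    obtain z where z: "1 < z" "z < r" "r powr h - 1 powr h = (r - 1) * (h * z powr (h - 1))"
      using MVT2[of 1 r "\<lambda>z. z powr h" "\<lambda>z. h * z powr (h - 1)"] der 3 by force
    have "z powr (h - 1) \<le> 1" using z assms powr_mono2'[of "h - 1" 1 z] by simp
    then have "h * z powr (h - 1) \<le> h * 1" using assms by (intro mult_left_mono) auto
    then have "(r - 1) * (h * z powr (h - 1)) \<le> (r - 1) * h" using 3 by (intro mult_left_mono) auto
    then show ?thesis using z by (simp add: algebra_simps)
  qed simp
qed (use assms in simp)

lemma powr_tangent:
  fixes x m h :: real
  assumes "x \<ge> 0" "m > 0" "0 < h" "h \<le> 1"
  shows "x powr h \<le> m powr h + h * m powr (h - 1) * (x - m)"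
proof -
  have "x powr h = m powr h * (x / m) powr h"
    using assms by (simp add: powr_divide)
  also have "\<dots> \<le> m powr h * (1 + h * (x / m - 1))"
    using assms by (intro mult_left_mono powr_bernoulli) auto
  also have "\<dots> = m powr h + h * (m powr h / m) * (x - m)"
    using assms by (simp add: field_simps)
  also have "m powr h / m = m powr (h - 1)" using assms by (simp add: powr_diff)
  finally show ?thesis .
qed

lemma powr_diff_le_diff_powr:
  fixes x y h :: real
  assumes "0 \<le> x" "x \<le> y" "0 < h" "h \<le> 1"
  shows "y powr h - x powr h \<le> (y - x) powr h"
proof (cases "y = 0")
  case False
  then have y: "y > 0" using assms by simp
  have *: "y powr h * (z / y) \<le> z powr h" if "0 \<le> z" "z \<le> y" for z
  proof -
    have "z / y \<le> (z / y) powr h"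
      using that y assms powr_mono'[of h 1 "z / y"] by (cases "z = 0") auto
    then have "y powr h * (z / y) \<le> y powr h * (z / y) powr h" by (intro mult_left_mono) auto
    also have "\<dots> = z powr h" using that y by (simp add: powr_divide)
    finally show ?thesis .
  qed
  have "y powr h = y powr h * (x / y) + y powr h * ((y - x) / y)"
    using y by (simp add: field_simps)
  also have "\<dots> \<le> x powr h + (y - x) powr h" using assms by (intro add_mono *) auto
  finally show ?thesis by simp
qed (use assms in auto)

text \<open>The linear terms of the two tangents at the midpoint cancel. For the critical exponent
  \<open>2 powr (1 - h)\<close> is \<open>1 + O(1/n)\<close>, so an interval may be split
  once.\<close>

lemma powr_add_powr_le:
  fixes x y h :: real
  assumes "0 \<le> x" "0 \<le> y" "0 < h" "h \<le> 1"
  shows "x powr h + y powr h \<le> 2 powr (1 - h) * (x + y) powr h"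
proof (cases "x + y = 0")
  case False
  define m where "m = (x + y) / 2"
  have m: "m > 0" using False assms by (simp add: m_def)
  have "x powr h + y powr h \<le> (m powr h + h * m powr (h - 1) * (x - m)) + (m powr h + h * m powr (h - 1) * (y - m))"
    using m assms by (intro add_mono powr_tangent) auto
  also have "\<dots> = 2 * m powr h + h * m powr (h - 1) * ((x - m) + (y - m))" by (simp add: algebra_simps)
  also have "(x - m) + (y - m) = 0" by (simp add: m_def)
  finally have "x powr h + y powr h \<le> 2 * m powr h" by simp
  also have "\<dots> = 2 powr (1 - h) * (x + y) powr h"
    using assms by (simp add: m_def powr_divide powr_diff)
  finally show ?thesis .
qed (use assms in \<open>auto simp: add_nonneg_eq_0_iff\<close>)

text \<open>Up to a factor that depends only on the word, the image of \<open>{a..b}\<close> under the inverse branch of a word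
  has length \<open>mob t b - mob t a\<close> and mass \<open>mass t a b\<close>, where \<open>t \<in> {0..1}\<close> is the ratio of the last two
  denominators of the convergents; all density estimates must therefore be uniform in \<open>t\<close>.\<close>

definition mob :: "real \<Rightarrow> real \<Rightarrow> real" where
  "mob t x = x / (1 + t * x)"

lemma mob_nonneg: "t \<ge> 0 \<Longrightarrow> x \<ge> 0 \<Longrightarrow> 0 \<le> mob t x"
  by (simp add: mob_def)

lemma mob_pos: "t \<ge> 0 \<Longrightarrow> x > 0 \<Longrightarrow> 0 < mob t x"
  by (simp add: mob_def add_pos_nonneg)

lemma mob_mono: "t \<ge> 0 \<Longrightarrow> 0 \<le> x \<Longrightarrow> x \<le> y \<Longrightarrow> mob t x \<le> mob t y"
proof -
  assume *: "t \<ge> 0" "0 \<le> x" "x \<le> y"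
  have "1 + t * x > 0" "1 + t * y > 0" using * by (auto intro: add_pos_nonneg)
  then show ?thesis using * by (simp add: mob_def divide_simps) (simp add: algebra_simps)
qed

lemma mob_inverse: "j > 0 \<Longrightarrow> t \<ge> 0 \<Longrightarrow> mob t (1 / j) = 1 / (j + t)"
  by (simp add: mob_def field_simps)

text \<open>The family \<open>mob t\<close> is closed under the branches: expanding cylinder
  \<open>j\<close> turns \<open>t\<close> into \<open>1 / (j + t)\<close> and multiplies lengths by
  exactly \<open>(j + t)^2\<close>, with reversed orientation. Nothing is lost, however often this
  is repeated.\<close>

lemma mob_branch:
  assumes "j \<ge> 1" "t \<ge> 0" "x > 0"
  shows "mob (1 / (j + t)) (1 / x - j) = (j + t) - (j + t)^2 * mob t x"
proof -
  have p: "1 + t * x > 0" "j + t > 0" using assms by (auto intro: add_pos_nonneg)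
  have "1 + 1 / (j + t) * (1 / x - j) = (1 + t * x) / (x * (j + t))"
  proof -
    have "x * (j + t) > 0" using p assms by simp
    moreover have "1 / (j + t) * (1 / x - j) = (1 - j * x) / (x * (j + t))"
      using p assms by (simp add: field_simps)
    moreover have "1 + t * x = x * (j + t) + (1 - j * x)" by (simp add: algebra_simps)
    ultimately show ?thesis using p assms by (simp only: add_divide_distrib) simp
  qed
  then have "mob (1 / (j + t)) (1 / x - j) = (1 / x - j) * (x * (j + t)) / (1 + t * x)"
    by (simp add: mob_def)
  also have "(1 / x - j) * (x * (j + t)) = (1 - j * x) * (j + t)"
    using assms by (simp add: algebra_simps)
  also have "(1 - j * x) * (j + t) / (1 + t * x) = (j + t) - (j + t)^2 * mob t x"
    using p by (simp add: mob_def field_simps power2_eq_square)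
  finally show ?thesis .
qed

text \<open>The Gauss map has slope -1 at \<open>x = 1\<close>, so ordinary length need not grow by
  a uniform factor. With respect to the density \<open>1 / (1 + x)^2\<close> the expansion is at
  least \<open>9/4\<close>, of which 2 is kept.\<close>

lemma mob_one_diff_expand:
  assumes k: "k \<ge> 1" and ab: "1 / (k + 1) \<le> a" "a < b" "b \<le> 1 / k"
  shows "mob 1 (1 / a - k) - mob 1 (1 / b - k) \<ge> 2 * (mob 1 b - mob 1 a)"
proof -
  have a0: "a > 0" using ab(1) k by (auto intro: less_le_trans[of 0 "1 / (k + 1)"])
  have e: "mob 1 (1 / x - k) = (1 - k * x) / (1 - (k - 1) * x)" if "x > 0" for x
  proof -
    have "1 / x - k = (1 - k * x) / x" "1 + 1 * (1 / x - k) = (1 - (k - 1) * x) / x"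
      using that by (simp_all add: field_simps)
    then show ?thesis using that unfolding mob_def by (simp only:) simp
  qed
  have bd: "0 < 1 - (k - 1) * x \<and> 1 - (k - 1) * x \<le> 2 / 3 * (1 + x)" if x: "a \<le> x" "x \<le> b" for x
  proof -
    have "k * x \<le> 1" using x ab(3) k mult_left_mono[of x "1 / k" k] by simp
    moreover have "1 \<le> k * x + x"
      using x ab(1) k mult_left_mono[of "1 / (k + 1)" x "k + 1"] by (simp add: distrib_right)
    moreover have "x > 0" using a0 x by simp
    moreover have "x \<le> k * x" using \<open>x > 0\<close> k by simp
    moreover have e1: "(k - 1) * x = k * x - x" by (simp add: left_diff_distrib)
    moreover have "0 < 1 - (u - x) \<and> 1 - (u - x) \<le> 2 / 3 * (1 + x)"
      if "u \<le> 1" "1 \<le> u + x" "0 < x" "x \<le> u" for u using that by (simp add: field_simps)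
    ultimately show ?thesis unfolding e1 by blast
  qed
  define A where "A = 1 - (k - 1) * a"
  define B where "B = 1 - (k - 1) * b"
  have A: "0 < A" "A \<le> 2 / 3 * (1 + a)" and B: "0 < B" "B \<le> 2 / 3 * (1 + b)"
    using bd[of a] bd[of b] ab by (auto simp: A_def B_def)
  have b0: "b > 0" using a0 ab by simp
  have "mob 1 (1 / a - k) - mob 1 (1 / b - k) = (1 - k * a) / A - (1 - k * b) / B"
    using a0 b0 by (simp add: e A_def B_def)
  also have "\<dots> = ((1 - k * a) * B - (1 - k * b) * A) / (A * B)" using A B by (simp add: field_simps)
  also have "(1 - k * a) * B - (1 - k * b) * A = b - a" by (simp add: A_def B_def algebra_simps)
  finally have l: "mob 1 (1 / a - k) - mob 1 (1 / b - k) = (b - a) / (A * B)" .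
  have r: "mob 1 b - mob 1 a = (b - a) / ((1 + a) * (1 + b))"
    using a0 b0 by (simp add: mob_def field_simps)
  have "A * B \<le> (2 / 3 * (1 + a)) * (2 / 3 * (1 + b))" using A B a0 by (intro mult_mono) auto
  also have "\<dots> \<le> (1 + a) * (1 + b) / 2" using a0 b0 by (simp add: field_simps)
  finally have "(b - a) / ((1 + a) * (1 + b) / 2) \<le> (b - a) / (A * B)"
    using A B a0 b0 ab by (intro divide_left_mono) (auto intro!: mult_pos_pos)
  then show ?thesis using l r by (simp add: mult.commute)
qed

lemma bdd01_weight [bdd01_intros]: "t \<ge> 0 \<Longrightarrow> bdd01 (\<lambda>x. (1 + t * x) powr a)"
  by (rule bdd01_continuous, intro continuous_intros) (auto simp: add_nonneg_eq_0_iff)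

context conformal_mean begin

definition mass :: "real \<Rightarrow> real \<Rightarrow> real \<Rightarrow> real" where
  "mass t a b = \<Lambda> (\<lambda>x. (1 + t * x) powr (- (2 * h)) * of_bool (a \<le> x \<and> x \<le> b))"

text \<open>The contribution of branch \<open>j\<close> to a mass, without its factor
  \<open>(j + t) powr (- (2 * h))\<close>; the remaining weight has the parameter
  \<open>1 / (j + t)\<close> of the expanded cylinder.\<close>

definition piece :: "real \<Rightarrow> nat \<Rightarrow> real \<Rightarrow> real \<Rightarrow> real" where
  "piece t j a b = \<Lambda> (\<lambda>y. (1 + 1 / (real j + t) * y) powr (- (2 * h))
      * of_bool (a \<le> gauss_branch j y \<and> gauss_branch j y \<le> b))"

lemma weight_le_1: "t \<ge> 0 \<Longrightarrow> x \<ge> 0 \<Longrightarrow> (1 + t * x) powr (- (2 * h)) \<le> 1"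
  using powr_mono2'[of "- (2 * h)" 1 "1 + t * x"] h_nonneg by simp

text \<open>The counterpart of \<open>mob_branch\<close> for masses: \<open>(y + j) * (1 + t *
  gauss_branch j y) = y + j + t = (j + t) * (1 + y / (j + t))\<close>.\<close>

lemma mass_decompose:
  assumes t: "t \<ge> 0"
  shows "mass t a b = (\<Sum>j=1..n. (real j + t) powr (- (2 * h)) * piece t j a b)"
proof -
  let ?f = "\<lambda>x. (1 + t * x) powr (- (2 * h)) * of_bool (a \<le> x \<and> x \<le> b)"
  let ?p = "\<lambda>j y. (1 + 1 / (real j + t) * y) powr (- (2 * h))
      * of_bool (a \<le> gauss_branch j y \<and> gauss_branch j y \<le> b)"
  have bf: "bdd01 ?f" using t by (intro bdd01_intros)
  have bp: "bdd01 (?p j)" for j using t by (intro bdd01_intros) auto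
  have "mass t a b = \<Lambda> (transfer h {1..n} ?f)" unfolding mass_def using mean_transfer[OF bf] by simp
  also have "\<dots> = \<Lambda> (\<lambda>y. \<Sum>j=1..n. (real j + t) powr (- (2 * h)) * ?p j y)"
  proof (rule mean_cong)
    show "bdd01 (transfer h {1..n} ?f)" using bf by (rule bdd01_transfer) auto
    show "bdd01 (\<lambda>y. \<Sum>j=1..n. (real j + t) powr (- (2 * h)) * ?p j y)"
      by (intro bdd01_sum bdd01_mult[OF bdd01_const] bp)
    fix y :: real assume y: "y \<in> {0..1}"
    show "transfer h {1..n} ?f y = (\<Sum>j=1..n. (real j + t) powr (- (2 * h)) * ?p j y)"
      unfolding transfer_def
    proof (rule sum.cong)
      fix j assume j: "j \<in> {1..n}"
      have "(y + real j) powr (- (2 * h)) * (1 + t * gauss_branch j y) powr (- (2 * h))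
          = ((y + real j) * (1 + t * gauss_branch j y)) powr (- (2 * h))"
        by (rule powr_mult[symmetric])
      also have "(y + real j) * (1 + t * gauss_branch j y) = (real j + t) * (1 + 1 / (real j + t) * y)"
        using y j t by (simp add: gauss_branch_def field_simps)
      also have "\<dots> powr (- (2 * h)) = (real j + t) powr (- (2 * h)) * (1 + 1 / (real j + t) * y) powr (- (2 * h))"
        by (rule powr_mult)
      finally show "(y + real j) powr (- (2 * h)) * ?f (gauss_branch j y) = (real j + t) powr (- (2 * h)) * ?p j y"
        by (simp add: mult.assoc[symmetric])
    qed simp
  qed
  also have "\<dots> = (\<Sum>j=1..n. (real j + t) powr (- (2 * h)) * piece t j a b)"
    unfolding piece_def using bp
    by (subst mean_sum) (simp_all only: mean_cmult bdd01_mult[OF bdd01_const])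
  finally show ?thesis .
qed

lemma mass_le_1: "t \<ge> 0 \<Longrightarrow> mass t a b \<le> 1"
  unfolding mass_def by (intro mean_le_const bdd01_intros) (auto simp: weight_le_1)

lemma piece_nonneg: "t \<ge> 0 \<Longrightarrow> 0 \<le> piece t j a b"
  unfolding piece_def by (cases "j \<ge> 1") (intro mean_nonneg bdd01_intros; auto)+

lemma piece_le_mass:
  assumes "t \<ge> 0" and "\<And>y. y \<in> {0..1} \<Longrightarrow> a \<le> gauss_branch j y \<Longrightarrow> gauss_branch j y \<le> b \<Longrightarrow> a' \<le> y \<and> y \<le> b'"
  shows "piece t j a b \<le> mass (1 / (real j + t)) a' b'"
  unfolding piece_def mass_def using assms
  by (intro mean_mono bdd01_intros) auto

lemma piece_empty:
  assumes "t \<ge> 0" and "\<And>y. y \<in> {0..1} \<Longrightarrow> a \<le> gauss_branch j y \<Longrightarrow> gauss_branch j y \<le> b \<Longrightarrow> False"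
  shows "piece t j a b = 0"
proof -
  have "piece t j a b = \<Lambda> (\<lambda>_. 0)"
    unfolding piece_def using assms by (intro mean_cong bdd01_intros) auto
  then show ?thesis by (simp add: mean_const)
qed

lemma gauss_branch_ge: "y \<in> {0..1} \<Longrightarrow> j \<ge> 1 \<Longrightarrow> 1 / (real j + 1) \<le> gauss_branch j y"
  by (auto simp: gauss_branch_def intro!: frac_le)

lemma gauss_branch_le: "y \<in> {0..1} \<Longrightarrow> j \<ge> 1 \<Longrightarrow> gauss_branch j y \<le> 1 / real j"
  by (auto simp: gauss_branch_def intro!: frac_le)

lemma mass_left_trunc:
  assumes t: "t \<ge> 0"
  shows "mass t a b = mass t (max a (1 / (real n + 1))) b"
proof -
  have "1 / (real n + 1) \<le> gauss_branch j y" if "y \<in> {0..1}" "j \<in> {1..n}" for j y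
  proof -
    have "1 / (real n + 1) \<le> 1 / (real j + 1)" using that(2) by (intro frac_le) auto
    also have "\<dots> \<le> gauss_branch j y" using that by (intro gauss_branch_ge) auto
    finally show ?thesis .
  qed
  then have "piece t j a b = piece t j (max a (1 / (real n + 1))) b" if "j \<in> {1..n}" for j
    unfolding piece_def using t that by (intro mean_cong bdd01_intros) auto
  then show ?thesis unfolding mass_decompose[OF t] by (intro sum.cong) auto
qed

lemma mass_left_zero:
  assumes t: "t \<ge> 0" and b: "b < 1 / (real n + 1)"
  shows "mass t a b = 0"
proof -
  have "mass t a b = mass t (max a (1 / (real n + 1))) b" using t by (rule mass_left_trunc)
  also have "\<dots> = \<Lambda> (\<lambda>_. 0)"
    unfolding mass_def using t b by (intro mean_cong bdd01_intros) auto
  finally show ?thesis by (simp add: mean_const)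
qed

lemma mass_point_0: "t \<ge> 0 \<Longrightarrow> mass t 0 0 = 0"
  by (rule mass_left_zero) auto

text \<open>1 is only the image of 0 under the first branch, and 0 has no mass. After expansion this
  makes the common endpoints of neighbouring cylinders negligible.\<close>

lemma mass_point_1:
  assumes t: "t \<ge> 0" shows "mass t 1 1 = 0"
proof -
  have "piece t j 1 1 = 0" if j: "j \<in> {1..n}" for j
  proof -
    have "piece t j 1 1 \<le> mass (1 / (real j + t)) 0 0"
      using t j by (intro piece_le_mass) (auto simp: gauss_branch_def field_simps)
    also have "\<dots> = 0" using t by (intro mass_point_0) auto
    finally show ?thesis using piece_nonneg[OF t, of j 1 1] by linarith
  qed
  then show ?thesis unfolding mass_decompose[OF t] by simp
qed

lemma mass_split:
  assumes t: "t \<ge> 0"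
  shows "mass t a b \<le> mass t a c + mass t c b"
proof -
  have "mass t a b \<le> \<Lambda> (\<lambda>x. (1 + t * x) powr (- (2 * h)) * of_bool (a \<le> x \<and> x \<le> c)
      + (1 + t * x) powr (- (2 * h)) * of_bool (c \<le> x \<and> x \<le> b))"
    unfolding mass_def using t by (intro mean_mono bdd01_intros) auto
  also have "\<dots> = mass t a c + mass t c b"
    unfolding mass_def using t by (intro mean_add bdd01_intros)
  finally show ?thesis .
qed

text \<open>The weighted indicator is a difference of two decreasing functions, each costing
  \<open>24 / (n + 1)\<close>. The weight is \<open>(1 + t * x) powr (2 - 2 * h)\<close>, at most
  \<open>4 powr (1 - h)\<close>, times the derivative of \<open>mob t\<close>.\<close>

lemma mass_le_mob:
  assumes t: "0 \<le> t" "t \<le> 1" and ab: "0 \<le> a" "a \<le> b" "b \<le> 1"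
  shows "mass t a b \<le> 4 powr (1 - h) * (mob t b - mob t a) + 48 / (real n + 1)"
proof -
  define w where "w x = (1 + t * x) powr (- (2 * h))" for x
  define f1 where "f1 x = w x * of_bool (x \<le> b)" for x
  define f2 where "f2 x = w x * of_bool (x < a)" for x
  have w01: "0 \<le> w x" "w x \<le> 1" if "x \<in> {0..1}" for x
    using weight_le_1[of t x] t that by (auto simp: w_def)
  have wanti: "w y \<le> w x" if "0 \<le> x" "x \<le> y" for x y
    unfolding w_def using that t h_nonneg by (intro powr_mono2') (auto intro!: add_pos_nonneg mult_left_mono)
  have bw: "bdd01 w" unfolding w_def using t by (intro bdd01_intros)
  have b12: "bdd01 f1" "bdd01 f2" unfolding f1_def f2_def by (intro bdd01_mult bdd01_of_bool bw)+
  have m1: "mono01 f1" "mono01 f2"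
    unfolding mono01_def f1_def f2_def using w01 wanti by (auto simp: monotone_on_def)
  have "antimono_on {0..1} f1" "antimono_on {0..1} f2"
    unfolding f1_def f2_def using w01 wanti by (auto simp: monotone_on_def)
  then have abs_int: "(\<lambda>x. 1 * f1 x) absolutely_integrable_on {0..1}" "(\<lambda>x. 1 * f2 x) absolutely_integrable_on {0..1}"
    by (intro integrable_continuous_times_mono continuous_intros; simp)+
  then have i12: "f1 integrable_on {0..1}" "f2 integrable_on {0..1}"
    by (simp_all add: absolutely_integrable_on_def)
  have "mass t a b = \<Lambda> (\<lambda>x. f1 x - f2 x)"
    unfolding mass_def using t ab bdd01_diff[OF b12]
    by (intro mean_cong) (auto intro!: bdd01_intros simp: f1_def f2_def w_def)
  also have "\<dots> = \<Lambda> f1 - \<Lambda> f2" using b12 by (rule mean_diff)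
  also have "\<dots> \<le> integral {0..1} f1 - integral {0..1} f2 + 48 / (real n + 1)"
  proof -
    have "24 / (real n + 1) + 24 / (real n + 1) = 48 / (real n + 1)" by (simp flip: add_divide_distrib)
    then show ?thesis using mean_minus_integral[OF m1(1)] mean_minus_integral[OF m1(2)] by linarith
  qed
  also have "integral {0..1} f1 - integral {0..1} f2 = integral {0..1} (\<lambda>x. f1 x - f2 x)"
    using i12 by (rule Henstock_Kurzweil_Integration.integral_diff[symmetric])
  also have "\<dots> \<le> 4 powr (1 - h) * (mob t b - mob t a)"
  proof -
    let ?g = "\<lambda>x. 1 / (1 + t * x)^2"
    have "(?g has_integral mob t b - mob t a) {a..b}"
    proof (rule fundamental_theorem_of_calculus)
      fix x assume "x \<in> {a..b}"
      then have "1 + t * x > 0" using t ab by (auto intro!: add_pos_nonneg mult_nonneg_nonneg)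
      then have "(mob t has_real_derivative ?g x) (at x within {a..b})"
        unfolding mob_def by (auto intro!: derivative_eq_intros simp: power2_eq_square field_simps)
      then show "(mob t has_vector_derivative ?g x) (at x within {a..b})"
        by (simp add: has_real_derivative_iff_has_vector_derivative)
    qed (use ab in simp)
    then have "((\<lambda>x. if x \<in> {a..b} then ?g x else 0) has_integral mob t b - mob t a) {0..1}"
      using ab by (subst has_integral_restrict) auto
    then have hi: "((\<lambda>x. 4 powr (1 - h) * (if x \<in> {a..b} then ?g x else 0)) has_integral
        4 powr (1 - h) * (mob t b - mob t a)) {0..1}"
      by (rule has_integral_mult_right)
    show ?thesis
    proof (rule has_integral_le[OF integrable_integral hi])
      show "(\<lambda>x. f1 x - f2 x) integrable_on {0..1}"
        using i12 by (rule Henstock_Kurzweil_Integration.integrable_diff)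
      fix x :: real assume x: "x \<in> {0..1}"
      have p: "1 + t * x > 0" using t x by (auto intro!: add_pos_nonneg)
      have "w x = (1 + t * x) powr (2 - 2 * h) * (1 + t * x) powr (- 2)"
        unfolding w_def by (simp flip: powr_add)
      also have "\<dots> \<le> 2 powr (2 - 2 * h) * (1 + t * x) powr (- 2)"
        using t x h_less_1 mult_mono[of t 1 x 1] by (intro mult_right_mono powr_mono2) auto
      also have "2 powr (2 - 2 * h) = (4::real) powr (1 - h)"
        using powr_powr[of 2 2 "1 - h"] by (simp add: algebra_simps)
      also have "(1 + t * x) powr (- 2) = ?g x"
        using p by (simp add: powr_minus powr_numeral divide_simps)
      finally have "w x \<le> 4 powr (1 - h) * ?g x" .
      then show "f1 x - f2 x \<le> 4 powr (1 - h) * (if x \<in> {a..b} then ?g x else 0)"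
        using x ab by (auto simp: f1_def f2_def)
    qed
  qed
  finally show ?thesis by simp
qed

end


section \<open>Mass against the power of length\<close>

locale conformal_mean_pos = conformal_mean +
  assumes h_pos: "0 < h"
begin

text \<open>Origin of the factors: \<open>4 powr (1 - h)\<close> from \<open>mass_le_mob\<close>,
  \<open>(n + 1) powr (1 - h)\<close> from the largest branch weight, \<open>576 = 12 * 48\<close>
  from the additive errors of the branches, \<open>1 / h\<close> from the tangent to
  \<open>x powr h\<close>. Only the second is not \<open>1 + O(1/n)\<close>.\<close>

definition ratio :: real where
  "ratio = 4 powr (1 - h) * (real n + 1) powr (1 - h) * (1 + 576 / (real n + 1)) / h"

lemma ratio_ge_1: "1 \<le> ratio"
proof -
  have 1: "1 \<le> 4 powr (1 - h)" "1 \<le> (real n + 1) powr (1 - h)" "1 \<le> 1 + 576 / (real n + 1)"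
    using h_less_1 by (auto intro!: ge_one_powr_ge_zero)
  have "1 * 1 * 1 \<le> 4 powr (1 - h) * (real n + 1) powr (1 - h) * (1 + 576 / (real n + 1))"
    using 1 by (intro mult_mono) auto
  then have "1 / 1 \<le> ratio" unfolding ratio_def using h_pos h_less_1 by (intro frac_le) auto
  then show ?thesis by simp
qed

lemma powr_weight: "0 < c \<Longrightarrow> c powr (- (2 * h)) * c^2 = c powr (2 * (1 - h))"
proof -
  assume c: "0 < c"
  have "c^2 = c powr 2" using c by (simp add: powr_numeral)
  then show ?thesis by (simp flip: powr_add add: algebra_simps)
qed

text \<open>Up to \<open>1 / j\<close> the values of \<open>mob t\<close> are at most
  \<open>1 / (j + t)\<close>, so \<open>x powr h\<close> has slope at least
  \<open>h * (j + t) powr (1 - h)\<close> there. The right-hand side is made to telescope over the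
  cylinders.\<close>

lemma mob_powr_tangent:
  assumes t: "t \<ge> 0" and j: "j \<ge> 1" and xy: "0 < x" "x \<le> y" "y \<le> 1 / j"
  shows "(j + t) powr (1 - h) * (mob t y - mob t x) \<le> (mob t y powr h - mob t x powr h) / h"
proof -
  have y: "0 < mob t y" and x: "0 \<le> mob t x" "mob t x \<le> mob t y"
    using t xy by (auto intro!: mob_pos mob_nonneg mob_mono)
  have "mob t y \<le> mob t (1 / j)" using t xy by (intro mob_mono) auto
  also have "\<dots> = 1 / (j + t)" using t j by (intro mob_inverse) auto
  finally have "(1 / (j + t)) powr (h - 1) \<le> mob t y powr (h - 1)"
    using y h_less_1 by (intro powr_mono2') auto
  moreover have "(1 / (j + t)) powr (h - 1) = (j + t) powr (1 - h)"
    using j t powr_minus[of "j + t" "h - 1"] by (simp add: powr_divide divide_inverse inverse_powr)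
  ultimately have "(j + t) powr (1 - h) * (mob t y - mob t x) \<le> mob t y powr (h - 1) * (mob t y - mob t x)"
    using x by (intro mult_right_mono) auto
  also have "\<dots> \<le> (mob t y powr h - mob t x powr h) / h"
    using powr_tangent[OF x(1) y h_pos less_imp_le[OF h_less_1]] h_pos by (simp add: field_simps)
  finally show ?thesis .
qed

text \<open>Every cylinder that meets the interval is expanded to unit size and compared with
  Lebesgue measure. The main terms telescope to the power of the total length. The additive errors,
  also those of the cylinders that are cut, are charged to the cylinders contained in the interval,
  of which \<open>k\<close> is one.\<close>

lemma mass_full_cylinder:
  assumes t: "0 \<le> t" "t \<le> 1" and ab: "1 / (real n + 1) \<le> a" "a < b" "b \<le> 1"
    and k: "k \<in> {1..n}" "a \<le> 1 / (real k + 1)" "1 / real k \<le> b"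
  shows "mass t a b \<le> ratio * (mob t b - mob t a) powr h"
proof -
  \<comment> \<open>\<open>1 / j\<close> clamped to \<open>{a..b}\<close>: \<open>D j\<close> is the
    \<open>mob t\<close> length of the part of the interval in cylinder \<open>j\<close>, and 0 if
    there is none. \<open>S\<close> collects the cylinders that are met, \<open>F\<close> those that
    are contained.\<close>
  define c where "c j = max a (min b (1 / real j))" for j :: nat
  define D where "D j = mob t (c j) - mob t (c (Suc j))" for j
  define S where "S = {j \<in> {1..n}. 1 / (real j + 1) \<le> b \<and> a \<le> 1 / real j}"
  define F where "F = {j \<in> {1..n}. a \<le> 1 / (real j + 1) \<and> 1 / real j \<le> b}"
  \<comment> \<open>From \<open>- 2 * h = (1 - h) + (- 1 - h)\<close>: one factor
    \<open>(j + t) powr (1 - h)\<close> is bounded by \<open>(n + 1) powr (1 - h)\<close> and taken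
    out; \<open>\<phi> j\<close> is what remains of the weight of an error.\<close>
  define \<phi> where "\<phi> j = (real j + t) powr (- 1 - h)" for j
  define E where "E = 48 / (real n + 1)"
  define C where "C = 4 powr (1 - h) * (real n + 1) powr (1 - h)"
  have a0: "a > 0" using ab(1) by (auto intro: less_le_trans[of 0 "1 / (real n + 1)"])
  have E0: "E \<ge> 0" by (simp add: E_def)
  have four: "1 \<le> (4::real) powr (1 - h)" using h_less_1 by (auto intro!: ge_one_powr_ge_zero)
  have cpos: "0 < c j" for j using a0 by (auto simp: c_def)
  have cSuc: "c (Suc j) \<le> c j" if "j \<ge> 1" for j
  proof -
    have "1 / real (Suc j) \<le> 1 / real j" using that by (intro frac_le) auto
    then show ?thesis by (auto simp: c_def)
  qed
  have D0: "D j \<ge> 0" if "j \<ge> 1" for j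
    unfolding D_def using mob_mono[OF t(1) _ cSuc[OF that]] cpos[of "Suc j"] by simp
  have piece: "piece t j a b \<le> 4 powr (1 - h) * ((real j + t)^2 * D j + (if j \<in> S then E else 0))"
    if j: "j \<in> {1..n}" for j
  proof (cases "j \<in> S")
    case False
    have "piece t j a b = 0"
    proof (rule piece_empty[OF t(1)])
      fix y :: real assume y: "y \<in> {0..1}" "a \<le> gauss_branch j y" "gauss_branch j y \<le> b"
      then show False using False j gauss_branch_ge[of y j] gauss_branch_le[of y j] by (auto simp: S_def)
    qed
    then show ?thesis using False D0[of j] j by simp
  next
    case True
    have cj: "c j \<le> 1 / real j" using True by (auto simp: c_def S_def)
    have cSj: "1 / (real j + 1) \<le> c (Suc j)" using True by (auto simp: c_def S_def add.commute)
    have le: "c (Suc j) \<le> c j" using j by (intro cSuc) auto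
    have j0: "real j \<ge> 1" using j by auto
    have "piece t j a b \<le> mass (1 / (real j + t)) (1 / c j - real j) (1 / c (Suc j) - real j)"
    proof (rule piece_le_mass[OF t(1)])
      fix y :: real assume y: "y \<in> {0..1}" "a \<le> gauss_branch j y" "gauss_branch j y \<le> b"
      have g: "gauss_branch j y \<le> c j" "c (Suc j) \<le> gauss_branch j y"
        using y j gauss_branch_le[of y j] gauss_branch_ge[of y j] by (auto simp: c_def add.commute)
      have "gauss_branch j y > 0" using y j0 by (simp add: gauss_branch_def)
      have "1 / c j \<le> 1 / gauss_branch j y" "1 / gauss_branch j y \<le> 1 / c (Suc j)"
        using g cpos \<open>gauss_branch j y > 0\<close> by (auto intro!: frac_le)
      then show "1 / c j - real j \<le> y \<and> y \<le> 1 / c (Suc j) - real j"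
        by (simp add: gauss_branch_def)
    qed
    also have "\<dots> \<le> 4 powr (1 - h) * (mob (1 / (real j + t)) (1 / c (Suc j) - real j) - mob (1 / (real j + t)) (1 / c j - real j)) + E"
      unfolding E_def
    proof (rule mass_le_mob)
      have "real j \<le> 1 / c j" using cj cpos[of j] j0 by (simp add: field_simps)
      then show "0 \<le> 1 / c j - real j" by simp
      have "1 / c (Suc j) \<le> real j + 1" using cSj cpos[of "Suc j"] j0 by (simp add: field_simps)
      then show "1 / c (Suc j) - real j \<le> 1" by simp
      have "1 / c j \<le> 1 / c (Suc j)" using le cpos[of "Suc j"] by (intro frac_le) auto
      then show "1 / c j - real j \<le> 1 / c (Suc j) - real j" by simp
    qed (use t j0 in \<open>auto simp: field_simps\<close>)
    also have "mob (1 / (real j + t)) (1 / c (Suc j) - real j) - mob (1 / (real j + t)) (1 / c j - real j) = (real j + t)^2 * D j"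
      using j0 t cpos by (subst (1 2) mob_branch) (auto simp: D_def algebra_simps)
    also have "4 powr (1 - h) * ((real j + t)^2 * D j) + E \<le> 4 powr (1 - h) * ((real j + t)^2 * D j + E)"
      using four E0 mult_right_mono[OF four E0] by (simp add: distrib_left)
    finally show ?thesis using True by simp
  qed
  have term_le: "(real j + t) powr (- (2 * h)) * piece t j a b
      \<le> C * ((real j + t) powr (1 - h) * D j + (if j \<in> S then E * \<phi> j else 0))" if j: "j \<in> {1..n}" for j
  proof -
    define q where "q = real j + t"
    have q: "q > 0" "q \<le> real n + 1" using j t by (auto simp: q_def)
    have qq: "q powr (- (2 * h)) * q^2 = q powr (1 - h) * q powr (1 - h)"
      unfolding powr_weight[OF q(1)] by (simp flip: powr_add)
    have qh: "q powr (- (2 * h)) = q powr (1 - h) * \<phi> j"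
      unfolding \<phi>_def q_def[symmetric] by (simp flip: powr_add)
    have "q powr (- (2 * h)) * piece t j a b \<le> q powr (- (2 * h)) * (4 powr (1 - h) * (q^2 * D j + (if j \<in> S then E else 0)))"
      using piece[OF j] by (intro mult_left_mono) (auto simp: q_def)
    also have "\<dots> = 4 powr (1 - h) * ((q powr (- (2 * h)) * q^2) * D j + (if j \<in> S then E * q powr (- (2 * h)) else 0))"
      by (simp add: algebra_simps)
    also have "\<dots> = 4 powr (1 - h) * (q powr (1 - h) * q powr (1 - h) * D j + (if j \<in> S then E * (q powr (1 - h) * \<phi> j) else 0))"
      unfolding qq by (subst qh) (rule refl)
    also have "\<dots> = 4 powr (1 - h) * q powr (1 - h) * (q powr (1 - h) * D j + (if j \<in> S then E * \<phi> j else 0))"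
      by (simp add: algebra_simps)
    also have "\<dots> \<le> C * (q powr (1 - h) * D j + (if j \<in> S then E * \<phi> j else 0))"
      unfolding C_def using q h_less_1 D0[of j] j E0
      by (intro mult_right_mono mult_left_mono powr_mono2) (auto simp: \<phi>_def)
    finally show ?thesis unfolding q_def .
  qed
  define T where "T = (\<Sum>j=1..n. (real j + t) powr (1 - h) * D j)"
  have "mass t a b \<le> (\<Sum>j=1..n. C * ((real j + t) powr (1 - h) * D j + (if j \<in> S then E * \<phi> j else 0)))"
    unfolding mass_decompose[OF t(1)] using term_le by (intro sum_mono) auto
  also have "\<dots> = C * (T + (\<Sum>j=1..n. if j \<in> S then E * \<phi> j else 0))"
    unfolding T_def by (simp only: sum_distrib_left[symmetric] sum.distrib)
  also have "(\<Sum>j=1..n. if j \<in> S then E * \<phi> j else 0) = E * (\<Sum>j\<in>S. \<phi> j)"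
  proof -
    have "{1..n} \<inter> S = S" by (auto simp: S_def)
    then show ?thesis by (simp add: sum.inter_restrict[symmetric] sum_distrib_left)
  qed
  finally have m1: "mass t a b \<le> C * (T + E * (\<Sum>j\<in>S. \<phi> j))" .

  have \<phi>0: "\<phi> j \<ge> 0" for j by (simp add: \<phi>_def)
  have finS: "finite S" "finite F" by (auto simp: S_def F_def)
  have kF: "k \<in> F" using k by (auto simp: F_def)
  \<comment> \<open>6 = 4 + 1 + 1: indices below \<open>k\<close> are shifted up into
    \<open>F\<close>, where \<open>\<phi> j\<close> is at most \<open>4 * \<phi> (Suc j)\<close>;
    then \<open>k\<close> itself; indices above \<open>k\<close> are shifted down into
    \<open>F\<close>.\<close>
  have sumF: "(\<Sum>j\<in>S. \<phi> j) \<le> 6 * (\<Sum>j\<in>F. \<phi> j)"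
  proof -
    let ?L = "{j\<in>S. j < k}" let ?U = "{j\<in>S. k < j}"
    have "S \<subseteq> ?L \<union> {k} \<union> ?U" by auto
    then have "(\<Sum>j\<in>S. \<phi> j) \<le> (\<Sum>j\<in>?L \<union> {k} \<union> ?U. \<phi> j)"
      using finS \<phi>0 by (intro sum_mono2) auto
    also have "\<dots> \<le> (\<Sum>j\<in>?L. \<phi> j) + \<phi> k + (\<Sum>j\<in>?U. \<phi> j)"
      using finS by (subst sum.union_disjoint; (subst sum.union_disjoint)?) auto
    finally have a1: "(\<Sum>j\<in>S. \<phi> j) \<le> (\<Sum>j\<in>?L. \<phi> j) + \<phi> k + (\<Sum>j\<in>?U. \<phi> j)" .
    have a2: "(\<Sum>j\<in>?L. \<phi> j) \<le> 4 * (\<Sum>j\<in>F. \<phi> j)"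
    proof -
      have "(\<Sum>j\<in>?L. \<phi> j) \<le> (\<Sum>j\<in>?L. 4 * \<phi> (Suc j))"
      proof (rule sum_mono)
        fix j assume "j \<in> ?L"
        then have j1: "real j \<ge> 1" by (auto simp: S_def)
        have "(2 * (real j + t)) powr (- 1 - h) \<le> \<phi> (Suc j)"
          unfolding \<phi>_def using j1 t h_pos by (intro powr_mono2') auto
        moreover have "(2 * (real j + t)) powr (- 1 - h) = 2 powr (- 1 - h) * \<phi> j"
          unfolding \<phi>_def by (rule powr_mult)
        moreover have "(2::real) powr (- 2) \<le> 2 powr (- 1 - h)" using h_less_1 by (intro powr_mono) auto
        then have "2 powr (- 2) * \<phi> j \<le> 2 powr (- 1 - h) * \<phi> j" using \<phi>0 by (intro mult_right_mono) auto
        moreover have "(2::real) powr (- 2) = 1 / 4" by (simp add: powr_minus)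
        ultimately show "\<phi> j \<le> 4 * \<phi> (Suc j)" by simp
      qed
      also have "\<dots> = 4 * (\<Sum>j\<in>Suc ` ?L. \<phi> j)" by (simp add: sum.reindex sum_distrib_left)
      also have "\<dots> \<le> 4 * (\<Sum>j\<in>F. \<phi> j)"
      proof (intro mult_left_mono sum_mono2)
        show "Suc ` ?L \<subseteq> F"
        proof
          fix i assume "i \<in> Suc ` ?L"
          then obtain j where j: "i = Suc j" "j \<in> S" "j < k" by auto
          have "a \<le> 1 / (real k + 1)" using k by simp
          also have "\<dots> \<le> 1 / (real i + 1)" using j by (intro frac_le) auto
          finally show "i \<in> F" using j k by (auto simp: F_def S_def add.commute)
        qed
      qed (use finS \<phi>0 in auto)
      finally show ?thesis .
    qed
    have a3: "(\<Sum>j\<in>?U. \<phi> j) \<le> (\<Sum>j\<in>F. \<phi> j)"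
    proof -
      define V where "V = {i. Suc i \<in> S \<and> k \<le> i}"
      have "?U = Suc ` V"
      proof (intro equalityI subsetI)
        fix j assume "j \<in> ?U"
        then have "j = Suc (j - 1)" "j - 1 \<in> V" by (auto simp: V_def)
        then show "j \<in> Suc ` V" by blast
      qed (auto simp: V_def)
      then have "(\<Sum>j\<in>?U. \<phi> j) = (\<Sum>i\<in>V. \<phi> (Suc i))" by (simp add: sum.reindex)
      also have "\<dots> \<le> (\<Sum>i\<in>V. \<phi> i)"
      proof (rule sum_mono)
        fix i assume "i \<in> V"
        then have "real i \<ge> 1" using k by (auto simp: V_def)
        then show "\<phi> (Suc i) \<le> \<phi> i" unfolding \<phi>_def using t h_pos by (intro powr_mono2') auto
      qed
      also have "\<dots> \<le> (\<Sum>i\<in>F. \<phi> i)"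
      proof (rule sum_mono2)
        show "V \<subseteq> F"
        proof
          fix i assume i: "i \<in> V"
          have "1 / real i \<le> 1 / real k" using i k by (intro frac_le) (auto simp: V_def)
          also have "\<dots> \<le> b" using k by simp
          finally have "1 / real i \<le> b" .
          moreover have "a \<le> 1 / (real i + 1)" "Suc i \<le> n" using i by (auto simp: V_def S_def add.commute)
          ultimately show "i \<in> F" using i k unfolding F_def V_def by auto
        qed
      qed (use finS \<phi>0 in auto)
      finally show ?thesis .
    qed
    have "\<phi> k \<le> (\<Sum>j\<in>F. \<phi> j)" using kF finS \<phi>0 by (intro member_le_sum) auto
    then show ?thesis using a1 a2 a3 by linarith
  qed
  \<comment> \<open>A contained cylinder has \<open>D j = 1 / (q * (q + 1))\<close>, at least
    \<open>1 / (2 * q^2)\<close>, which converts error weights into main terms. Altogether the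
    errors are at most \<open>12 * E\<close> times the main sum \<open>T\<close>.\<close>
  have "(\<Sum>j\<in>F. \<phi> j) \<le> (\<Sum>j\<in>F. 2 * ((real j + t) powr (1 - h) * D j))"
  proof (rule sum_mono)
    fix j assume j: "j \<in> F"
    define q where "q = real j + t"
    have q: "q \<ge> 1" using j t by (auto simp: F_def q_def)
    have "c j = 1 / real j" "c (Suc j) = 1 / (real j + 1)"
    proof -
      have "1 / (real j + 1) \<le> 1 / real j" using j by (intro frac_le) (auto simp: F_def)
      then show "c j = 1 / real j" "c (Suc j) = 1 / (real j + 1)"
        using j by (auto simp: F_def c_def add.commute)
    qed
    then have "D j = 1 / q - 1 / (q + 1)"
      unfolding D_def q_def using j t mob_inverse[of "real j" t] mob_inverse[of "real j + 1" t]
      by (simp add: F_def add_ac)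
    also have "\<dots> = 1 / (q * (q + 1))" using q by (simp add: field_simps)
    finally have Dj: "D j = 1 / (q * (q + 1))" .
    have "\<phi> j = q powr (1 - h) * q powr (- 2)" unfolding \<phi>_def q_def[symmetric] by (simp flip: powr_add)
    also have "q powr (- 2) = 1 / (q * q)" using q by (simp add: powr_minus powr_numeral power2_eq_square divide_simps)
    also have "q powr (1 - h) * (1 / (q * q)) \<le> q powr (1 - h) * (2 * D j)"
    proof (rule mult_left_mono)
      have "1 / (q * q) = 2 / (q * (q + q))" using q by (simp add: field_simps)
      also have "\<dots> \<le> 2 / (q * (q + 1))" using q by (intro divide_left_mono mult_left_mono) auto
      finally show "1 / (q * q) \<le> 2 * D j" unfolding Dj by simp
    qed simp
    finally have "\<phi> j \<le> q powr (1 - h) * (2 * D j)" .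
    then show "\<phi> j \<le> 2 * ((real j + t) powr (1 - h) * D j)" by (simp add: q_def)
  qed
  also have "\<dots> = 2 * (\<Sum>j\<in>F. (real j + t) powr (1 - h) * D j)" by (simp only: sum_distrib_left)
  finally have f1: "(\<Sum>j\<in>F. \<phi> j) \<le> 2 * (\<Sum>j\<in>F. (real j + t) powr (1 - h) * D j)" .
  have "(\<Sum>j\<in>F. (real j + t) powr (1 - h) * D j) \<le> T"
    unfolding T_def using D0 by (intro sum_mono2) (auto simp: F_def)
  then have "(\<Sum>j\<in>S. \<phi> j) \<le> 12 * T" using sumF f1 by linarith
  then have "E * (\<Sum>j\<in>S. \<phi> j) \<le> E * (12 * T)" using E0 by (rule mult_left_mono)
  also have "\<dots> = 576 / (real n + 1) * T" by (simp add: E_def)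
  finally have "C * (T + E * (\<Sum>j\<in>S. \<phi> j)) \<le> C * (T + 576 / (real n + 1) * T)"
    unfolding C_def by (intro mult_left_mono add_left_mono) auto
  also have "\<dots> = C * (1 + 576 / (real n + 1)) * T" by (simp add: algebra_simps)
  also have "\<dots> \<le> C * (1 + 576 / (real n + 1)) * ((mob t b - mob t a) powr h / h)"
  proof (rule mult_left_mono)
    have "T \<le> (\<Sum>j=1..n. mob t (c j) powr h / h - mob t (c (Suc j)) powr h / h)"
      unfolding T_def
    proof (rule sum_mono)
      fix j assume j: "j \<in> {1..n}"
      show "(real j + t) powr (1 - h) * D j \<le> mob t (c j) powr h / h - mob t (c (Suc j)) powr h / h"
      proof (cases "a \<le> 1 / real j")
        case True
        have "(real j + t) powr (1 - h) * D j \<le> (mob t (c j) powr h - mob t (c (Suc j)) powr h) / h"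
          unfolding D_def
        proof (rule mob_powr_tangent)
          show "c j \<le> 1 / real j" using True by (simp add: c_def)
        qed (use t j cpos cSuc[of j] in auto)
        then show ?thesis by (simp add: diff_divide_distrib)
      next
        case False
        have "1 / real (Suc j) \<le> 1 / real j" using j by (intro frac_le) auto
        then have "c j = a" "c (Suc j) = a" using False by (auto simp: c_def)
        then show ?thesis by (simp add: D_def)
      qed
    qed
    also have "\<dots> = - (\<Sum>j=1..n. mob t (c (Suc j)) powr h / h - mob t (c j) powr h / h)"
      by (simp add: sum_negf[symmetric])
    also have "\<dots> = mob t (c 1) powr h / h - mob t (c (Suc n)) powr h / h"
      using n2 by (subst sum_Suc_diff) auto
    also have "c 1 = b" using ab by (auto simp: c_def)
    also have "c (Suc n) = a" using ab by (auto simp: c_def add.commute)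
    also have "mob t b powr h / h - mob t a powr h / h \<le> (mob t b - mob t a) powr h / h"
      using powr_diff_le_diff_powr[of "mob t a" "mob t b" h] mob_mono[of t a b] mob_nonneg[of t a] t ab a0 h_pos h_less_1
      by (simp add: divide_right_mono flip: diff_divide_distrib)
    finally show "T \<le> (mob t b - mob t a) powr h / h" .
  qed (auto simp: C_def)
  also have "\<dots> = ratio * (mob t b - mob t a) powr h" by (simp add: ratio_def C_def)
  finally show ?thesis using m1 by simp
qed

lemma mass_full_cylinder':
  assumes t: "0 \<le> t" "t \<le> 1" and ab: "0 \<le> a" "a < b" "b \<le> 1"
    and k: "k \<in> {1..n}" "a \<le> 1 / (real k + 1)" "1 / real k \<le> b"
  shows "mass t a b \<le> ratio * (mob t b - mob t a) powr h"
proof -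
  define a' where "a' = max a (1 / (real n + 1))"
  have kn: "1 / (real n + 1) \<le> 1 / (real k + 1)" "1 / (real k + 1) < 1 / real k"
    using k by (auto intro!: frac_le frac_less2)
  have "mass t a b = mass t a' b" unfolding a'_def using t by (intro mass_left_trunc) auto
  also have "\<dots> \<le> ratio * (mob t b - mob t a') powr h"
    using t ab k kn by (intro mass_full_cylinder[where k = k]) (auto simp: a'_def)
  also have "\<dots> \<le> ratio * (mob t b - mob t a) powr h"
  proof (intro mult_left_mono powr_mono2)
    show "0 \<le> mob t b - mob t a'" using mob_mono[of t a' b] t ab kn k by (auto simp: a'_def)
    show "mob t b - mob t a' \<le> mob t b - mob t a" using mob_mono[of t a a'] t ab by (auto simp: a'_def)
  qed (use h_pos ratio_ge_1 in auto)
  finally show ?thesis .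
qed

text \<open>The case beyond the previous bounds is an end inside the last cylinder, where no full
  cylinder is contained. There the mass is at most \<open>(n + t) powr (- (2 * h))\<close>, the
  length at least \<open>1 / (n + 1 + t)\<close>, and \<open>(n + t)^2 >= n + 1 + t\<close>.\<close>

lemma mass_from_0:
  assumes t: "0 \<le> t" "t \<le> 1" and s: "0 < s" "s \<le> 1"
  shows "mass t 0 s \<le> ratio * mob t s powr h"
proof -
  have [simp]: "mob t 0 = 0" by (simp add: mob_def)
  consider "s < 1 / (real n + 1)" | "1 / real n \<le> s" | "1 / (real n + 1) \<le> s" "s < 1 / real n" by linarith
  then show ?thesis
  proof cases
    case 1
    then show ?thesis using mass_left_zero[of t s 0] t ratio_ge_1 by simp
  next
    case 2
    then show ?thesis using mass_full_cylinder'[of t 0 s n] t s n2 by simp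
  next
    case 3
    have "piece t j 0 s = 0" if "j \<in> {1..n}" "j \<noteq> n" for j
    proof (rule piece_empty[OF t(1)])
      fix y :: real assume y: "y \<in> {0..1}" "gauss_branch j y \<le> s"
      have "1 / real n \<le> 1 / (real j + 1)" using that by (intro frac_le) auto
      then show False using gauss_branch_ge[OF y(1), of j] y(2) that 3 by auto
    qed
    then have "mass t 0 s = (\<Sum>j\<in>{1..n}. if j = n then (real n + t) powr (- (2 * h)) * piece t n 0 s else 0)"
      unfolding mass_decompose[OF t(1)] by (intro sum.cong) auto
    also have "\<dots> = (real n + t) powr (- (2 * h)) * piece t n 0 s" using n2 by simp
    also have "\<dots> \<le> (real n + t) powr (- (2 * h)) * 1"
    proof (rule mult_left_mono)
      have "piece t n 0 s \<le> mass (1 / (real n + t)) 0 1" using t by (intro piece_le_mass) auto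
      also have "\<dots> \<le> 1" using t by (intro mass_le_1) auto
      finally show "piece t n 0 s \<le> 1" .
    qed simp
    finally have "mass t 0 s \<le> (real n + t) powr (- (2 * h))" by simp
    also have "\<dots> = ((real n + t)^2) powr (- h)"
      using t n2 by (simp add: powr_powr flip: powr_numeral)
    also have "\<dots> \<le> (real n + 1 + t) powr (- h)"
    proof (rule powr_mono2')
      have "2 * (real n + t) \<le> (real n + t) * (real n + t)" using n2 t by (intro mult_right_mono) auto
      then show "real n + 1 + t \<le> (real n + t)^2" using n2 t by (simp add: power2_eq_square)
    qed (use h_pos t in auto)
    also have "\<dots> = (1 / (real n + 1 + t)) powr h"
      using t by (simp add: powr_minus powr_divide divide_inverse inverse_powr)
    also have "\<dots> \<le> mob t s powr h"
    proof (rule powr_mono2)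
      have "1 / (real n + 1 + t) = mob t (1 / (real n + 1))" using t by (subst mob_inverse) auto
      also have "\<dots> \<le> mob t s" using t 3 by (intro mob_mono) auto
      finally show "1 / (real n + 1 + t) \<le> mob t s" .
    qed (use h_pos t in auto)
    also have "\<dots> \<le> ratio * mob t s powr h" using ratio_ge_1 by (simp add: mult_le_cancel_right1)
    finally show ?thesis .
  qed
qed

text \<open>Expansion multiplies the length by \<open>(k + t)^2\<close> and the mass by at least
  \<open>(k + t) powr (2 * h)\<close>, so a bound with the power \<open>h\<close> is pulled back
  with the same constant. The other cylinders meet the interval at most in endpoints, which have no
  mass.\<close>

lemma mass_zoom:
  assumes t: "0 \<le> t" and k: "k \<in> {1..n}" and ab: "1 / (real k + 1) \<le> a" "a \<le> b" "b \<le> 1 / real k"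
    and C: "mass (1 / (real k + t)) (1 / b - real k) (1 / a - real k)
      \<le> C * (mob (1 / (real k + t)) (1 / a - real k) - mob (1 / (real k + t)) (1 / b - real k)) powr h"
  shows "mass t a b \<le> C * (mob t b - mob t a) powr h"
proof -
  have a0: "a > 0" using ab(1) by (auto intro: less_le_trans[of 0 "1 / (real k + 1)"])
  have b0: "b > 0" using a0 ab by simp
  have "piece t j a b = 0" if j: "j \<in> {1..n}" "j \<noteq> k" for j
  proof (cases "j < k")
    case True
    have "piece t j a b \<le> mass (1 / (real j + t)) 1 1"
    proof (rule piece_le_mass[OF t])
      fix y :: real assume y: "y \<in> {0..1}" "gauss_branch j y \<le> b"
      have "1 / (y + real j) \<le> 1 / real k" using y ab by (simp add: gauss_branch_def)
      then have "real k \<le> y + real j" using y j k by (simp add: field_simps)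
      moreover have "real j + 1 \<le> real k" using True by linarith
      ultimately show "1 \<le> y \<and> y \<le> 1" using y by auto
    qed
    then show ?thesis using mass_point_1[of "1 / (real j + t)"] piece_nonneg[OF t, of j a b] t by simp
  next
    case False
    have "piece t j a b \<le> mass (1 / (real j + t)) 0 0"
    proof (rule piece_le_mass[OF t])
      fix y :: real assume y: "y \<in> {0..1}" "a \<le> gauss_branch j y"
      have "1 / (real k + 1) \<le> 1 / (y + real j)" using y ab by (simp add: gauss_branch_def)
      then have "y + real j \<le> real k + 1" using y j k by (simp add: field_simps)
      moreover have "real k + 1 \<le> real j" using False j by linarith
      ultimately show "0 \<le> y \<and> y \<le> 0" using y by auto
    qed
    then show ?thesis using mass_point_0[of "1 / (real j + t)"] piece_nonneg[OF t, of j a b] t by simp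
  qed
  then have "mass t a b = (\<Sum>j\<in>{1..n}. if j = k then (real k + t) powr (- (2 * h)) * piece t k a b else 0)"
    unfolding mass_decompose[OF t] by (intro sum.cong) auto
  also have "\<dots> = (real k + t) powr (- (2 * h)) * piece t k a b" using k by simp
  finally have m: "mass t a b = (real k + t) powr (- (2 * h)) * piece t k a b" .
  have "piece t k a b \<le> mass (1 / (real k + t)) (1 / b - real k) (1 / a - real k)"
  proof (rule piece_le_mass[OF t])
    fix y :: real assume y: "y \<in> {0..1}" "a \<le> gauss_branch k y" "gauss_branch k y \<le> b"
    then have "1 / b \<le> 1 / gauss_branch k y" "1 / gauss_branch k y \<le> 1 / a"
      using a0 by (auto intro!: frac_le)
    then show "1 / b - real k \<le> y \<and> y \<le> 1 / a - real k" by (simp add: gauss_branch_def)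
  qed
  also note C
  also have "mob (1 / (real k + t)) (1 / a - real k) - mob (1 / (real k + t)) (1 / b - real k)
      = (real k + t)^2 * (mob t b - mob t a)"
    using k t a0 b0 by (subst (1 2) mob_branch) (auto simp: algebra_simps)
  finally have "mass t a b \<le> (real k + t) powr (- (2 * h)) * (C * ((real k + t)^2 * (mob t b - mob t a)) powr h)"
    unfolding m by (rule mult_left_mono) simp
  also have "\<dots> = C * (mob t b - mob t a) powr h"
  proof -
    have q: "real k + t > 0" using k t by auto
    have "((real k + t)^2) powr h = (real k + t) powr (2 * h)"
      using q by (simp add: powr_powr flip: powr_numeral)
    then show ?thesis using q by (simp add: powr_mult powr_minus)
  qed
  finally show ?thesis .
qed

lemma mass_to_1:
  assumes t: "0 \<le> t" "t \<le> 1" and a: "0 \<le> a" "a < 1"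
  shows "mass t a 1 \<le> ratio * (mob t 1 - mob t a) powr h"
proof (cases "a \<le> 1 / 2")
  case True
  then show ?thesis using mass_full_cylinder'[of t a 1 1] t a n2 by simp
next
  case False
  have [simp]: "mob s 0 = 0" for s by (simp add: mob_def)
  have a': "0 < 1 / a - 1" "1 / a - 1 \<le> 1"
    using False a frac_less2[of 1 1 a 1] frac_le[of 1 1 "1 / 2" a] by auto
  have t': "0 \<le> 1 / (1 + t)" "1 / (1 + t) \<le> 1" using t by auto
  show ?thesis
  proof (rule mass_zoom[where k = 1])
    show "mass (1 / (real 1 + t)) (1 / 1 - real 1) (1 / a - real 1)
      \<le> ratio * (mob (1 / (real 1 + t)) (1 / a - real 1) - mob (1 / (real 1 + t)) (1 / 1 - real 1)) powr h"
      using mass_from_0[OF t' a'] by simp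
  qed (use t a False n2 in auto)
qed

text \<open>The blow-up may stop at an interval that crosses \<open>1 / k\<close> without containing
  a cylinder. After one expansion each half sits at an end of \<open>{0..1}\<close>; adding the two
  powers costs \<open>2 powr (1 - h)\<close>.\<close>

lemma mass_straddling:
  assumes t: "0 \<le> t" "t \<le> 1" and k: "2 \<le> k" "k \<le> n"
    and ab: "1 / (real k + 1) \<le> a" "a < 1 / real k" "1 / real k < b" "b \<le> 1 / (real k - 1)"
  shows "mass t a b \<le> 2 powr (1 - h) * ratio * (mob t b - mob t a) powr h"
proof -
  have [simp]: "mob s 0 = 0" for s by (simp add: mob_def)
  let ?c = "1 / real k"
  have a0: "a > 0" using ab(1) by (auto intro: less_le_trans[of 0 "1 / (real k + 1)"])
  have b0: "b > 0" using a0 ab by simp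
  have rk: "real (k - 1) = real k - 1" using k by (simp add: of_nat_diff)
  have ia: "1 / a - real k \<le> 1" "0 < 1 / a - real k"
    using frac_le[of 1 1 "1 / (real k + 1)" a] frac_less2[of 1 1 a "1 / real k"] ab a0 k by auto
  have ib: "0 \<le> 1 / b - real (k - 1)" "1 / b - real (k - 1) < 1"
    using frac_le[of 1 1 b "1 / (real k - 1)"] frac_less2[of 1 1 "1 / real k" b] ab b0 k unfolding rk by auto
  have c0: "1 / ?c - real k = 0" "1 / ?c - real (k - 1) = 1" using k by (simp_all add: rk)
  have tk: "0 \<le> 1 / (real k + t)" "1 / (real k + t) \<le> 1" using t k by auto
  have tk': "0 \<le> 1 / (real (k - 1) + t)" "1 / (real (k - 1) + t) \<le> 1" using t k unfolding rk by auto
  have kn: "k \<in> {1..n}" "k - 1 \<in> {1..n}" using k by auto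
  have 1: "mass t a ?c \<le> ratio * (mob t ?c - mob t a) powr h"
  proof (rule mass_zoom[OF t(1) kn(1) ab(1) less_imp_le[OF ab(2)] order_refl])
    show "mass (1 / (real k + t)) (1 / ?c - real k) (1 / a - real k)
      \<le> ratio * (mob (1 / (real k + t)) (1 / a - real k) - mob (1 / (real k + t)) (1 / ?c - real k)) powr h"
      unfolding c0 using mass_from_0[OF tk ia(2,1)] by simp
  qed
  have 2: "mass t ?c b \<le> ratio * (mob t b - mob t ?c) powr h"
  proof (rule mass_zoom[OF t(1) kn(2)])
    show "mass (1 / (real (k - 1) + t)) (1 / b - real (k - 1)) (1 / ?c - real (k - 1))
      \<le> ratio * (mob (1 / (real (k - 1) + t)) (1 / ?c - real (k - 1)) - mob (1 / (real (k - 1) + t)) (1 / b - real (k - 1))) powr h"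
      unfolding c0 by (rule mass_to_1[OF tk' ib])
  qed (use ab in \<open>simp_all add: rk\<close>)
  have "mass t a b \<le> mass t a ?c + mass t ?c b" using t by (intro mass_split)
  also have "\<dots> \<le> ratio * ((mob t ?c - mob t a) powr h + (mob t b - mob t ?c) powr h)"
    using 1 2 by (simp add: distrib_left)
  also have "\<dots> \<le> ratio * (2 powr (1 - h) * ((mob t ?c - mob t a) + (mob t b - mob t ?c)) powr h)"
    using mob_mono[of t a ?c] mob_mono[of t ?c b] t ab a0 h_pos h_less_1 ratio_ge_1
    by (intro mult_left_mono powr_add_powr_le) auto
  finally show ?thesis by (simp add: mult_ac)
qed

text \<open>A left end below \<open>1 / (n + 1)\<close> lies in no cylinder, so it cannot be blown
  up. Truncation moves it to \<open>1 / (n + 1)\<close>; then the interval has no mass, contains the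
  last cylinder, or lies in it and expands to one that ends at 1.\<close>

lemma mass_low:
  assumes t: "0 \<le> t" "t \<le> 1" and ab: "0 \<le> a" "a \<le> 1 / (real n + 1)" "a < b" "b \<le> 1"
  shows "mass t a b \<le> ratio * (mob t b - mob t a) powr h"
proof -
  let ?c = "1 / (real n + 1)"
  have nn: "n \<in> {1..n}" using n2 by simp
  have cn: "?c \<le> 1 / real n" using n2 by (intro frac_le) auto
  have m: "mass t a b = mass t ?c b"
    using mass_left_trunc[OF t(1), of a b] ab by (simp add: max_def)
  consider "b < ?c" | "b = ?c" | "1 / real n \<le> b" | "?c < b" "b < 1 / real n" by linarith
  then show ?thesis
  proof cases
    case 1
    then show ?thesis using mass_left_zero[OF t(1)] ratio_ge_1 by simp
  next
    case 2
    have "mass t b b \<le> 0 * (mob t b - mob t b) powr h"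
    proof (rule mass_zoom[OF t(1) nn])
      have "mass (1 / (real n + t)) 1 1 = 0" using t by (intro mass_point_1) auto
      moreover have "1 / b - real n = 1" using 2 by simp
      ultimately show "mass (1 / (real n + t)) (1 / b - real n) (1 / b - real n)
        \<le> 0 * (mob (1 / (real n + t)) (1 / b - real n) - mob (1 / (real n + t)) (1 / b - real n)) powr h" by simp
    qed (use 2 cn in simp_all)
    then have "mass t a b \<le> 0" using m 2 by simp
    also have "0 \<le> ratio * (mob t b - mob t a) powr h" using ratio_ge_1 by simp
    finally show ?thesis .
  next
    case 3
    then show ?thesis using mass_full_cylinder'[of t a b n] t ab n2 by simp
  next
    case 4
    have b0: "b > 0" using 4 by (auto intro: less_trans[of 0 ?c])
    have tn: "0 \<le> 1 / (real n + t)" "1 / (real n + t) \<le> 1" using t n2 by auto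
    have b': "0 \<le> 1 / b - real n" "1 / b - real n < 1"
      using frac_le[of 1 1 b "1 / real n"] frac_less2[of 1 1 ?c b] 4 b0 n2 by auto
    have c1: "1 / ?c - real n = 1" by simp
    have "mass t ?c b \<le> ratio * (mob t b - mob t ?c) powr h"
    proof (rule mass_zoom[OF t(1) nn order_refl])
      show "mass (1 / (real n + t)) (1 / b - real n) (1 / ?c - real n)
        \<le> ratio * (mob (1 / (real n + t)) (1 / ?c - real n) - mob (1 / (real n + t)) (1 / b - real n)) powr h"
        unfolding c1 by (rule mass_to_1[OF tn b'])
    qed (use 4 in simp_all)
    also have "\<dots> \<le> ratio * (mob t b - mob t a) powr h"
      using mob_mono[of t ?c b] mob_mono[of t a ?c] t 4 ab h_pos ratio_ge_1
      by (intro mult_left_mono powr_mono2) auto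
    finally show ?thesis using m by simp
  qed
qed

text \<open>An interval inside a single cylinder is blown up by the Gauss map, which preserves the ratio of
  mass and length and at least doubles the \<open>mob 1\<close>-length, until it is no longer contained in a
  cylinder.\<close>

lemma mass_le_ratio:
  assumes "0 \<le> t" "t \<le> 1" "0 \<le> a" "a < b" "b \<le> 1"
  shows "mass t a b \<le> 2 powr (1 - h) * ratio * (mob t b - mob t a) powr h"
proof -
  define C where "C = 2 powr (1 - h) * ratio"
  have "1 \<le> (2::real) powr (1 - h)" using h_less_1 by (intro ge_one_powr_ge_zero) auto
  then have C: "C \<ge> 0" "ratio \<le> C"
    using ratio_ge_1 by (auto simp: C_def mult_le_cancel_right1)
  have main: "mass t a b \<le> C * (mob t b - mob t a) powr h"
    if "(1 / 2) ^ N < mob 1 b - mob 1 a" "0 \<le> t" "t \<le> 1" "0 \<le> a" "a < b" "b \<le> 1" for N t a b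
    using that
  proof (induction N arbitrary: t a b)
    case 0
    \<comment> \<open>All of \<open>{0..1}\<close> has \<open>mob 1\<close> length
      \<open>1/2\<close>, so the hypothesis cannot hold for \<open>N = 0\<close>; each expansion
      lowers \<open>N\<close> by one.\<close>
    have "mob 1 1 = 1 / 2" by (simp add: mob_def)
    then show ?case using 0 mob_mono[of 1 b 1] mob_nonneg[of 1 a] by simp
  next
    case (Suc N)
    show ?case
    proof (cases "a \<le> 1 / (real n + 1)")
      case True
      have "mass t a b \<le> ratio * (mob t b - mob t a) powr h"
        using Suc.prems True by (intro mass_low) auto
      also have "\<dots> \<le> C * (mob t b - mob t a) powr h" using C by (intro mult_right_mono) auto
      finally show ?thesis .
    next
      case False
      have a0: "a > 0" using False by (auto intro: less_trans[of 0 "1 / (real n + 1)"])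
      have b0: "b > 0" using a0 Suc.prems by simp
      \<comment> \<open>The digit with \<open>1 / (k + 1) <= a < 1 / k\<close>; the ceiling assigns
        a boundary point to the cylinder of which it is the left end.\<close>
      define k where "k = nat (\<lceil>1 / a\<rceil> - 1)"
      have a1: "1 < 1 / a" using Suc.prems a0 by (simp add: field_simps)
      have "\<lceil>1 / a\<rceil> \<ge> 2" using a1 by linarith
      then have "int k = \<lceil>1 / a\<rceil> - 1" unfolding k_def by linarith
      then have "real_of_int (int k) = of_int (\<lceil>1 / a\<rceil> - 1)" by (simp only:)
      then have rk: "real k = of_int \<lceil>1 / a\<rceil> - 1" by simp
      have k: "real k < 1 / a" "1 / a \<le> real k + 1" "1 \<le> k"
        using \<open>\<lceil>1 / a\<rceil> \<ge> 2\<close> unfolding rk k_def by linarith+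
      have "1 / a < real n + 1" using False a0 by (simp add: field_simps)
      then have kn: "k \<le> n" using k by linarith
      have ak: "1 / (real k + 1) \<le> a" "a < 1 / real k"
        using frac_le[of 1 1 "1 / a" "real k + 1"] frac_less2[of 1 1 "real k" "1 / a"] k a0 by auto
      consider "b \<le> 1 / real k" | "1 / real k < b" "b < 1 / (real k - 1)" "k \<ge> 2" | "1 / (real k - 1) \<le> b" "k \<ge> 2"
      proof (cases "k = 1")
        case True
        then show ?thesis using that(1) Suc.prems by simp
      next
        case False
        then show ?thesis using that k(3) by linarith
      qed
      then show ?thesis
      proof cases
        case 1
        have e: "2 * (mob 1 b - mob 1 a) \<le> mob 1 (1 / a - real k) - mob 1 (1 / b - real k)"
          using k(3) by (intro mob_one_diff_expand ak(1) Suc.prems(5) 1) simp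
        have kb: "0 \<le> 1 / b - real k" using frac_le[of 1 1 b "1 / real k"] 1 b0 by simp
        have "mass (1 / (real k + t)) (1 / b - real k) (1 / a - real k)
          \<le> C * (mob (1 / (real k + t)) (1 / a - real k) - mob (1 / (real k + t)) (1 / b - real k)) powr h"
        proof (rule Suc.IH)
          show "(1 / 2) ^ N < mob 1 (1 / a - real k) - mob 1 (1 / b - real k)"
            using Suc.prems(1) e by simp
          show "1 / b - real k < 1 / a - real k" using a0 Suc.prems by (simp add: frac_less2)
          show "1 / (real k + t) \<le> 1" using Suc.prems k by simp
          show "0 \<le> 1 / (real k + t)" using Suc.prems(2) by simp
          show "1 / a - real k \<le> 1" using k(2) by simp
        qed (rule kb)
        moreover have "k \<in> {1..n}" using k kn by simp
        ultimately show ?thesis by (rule mass_zoom[OF Suc.prems(2) _ ak(1) less_imp_le[OF Suc.prems(5)] 1, rotated])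
      next
        case 2
        then show ?thesis unfolding C_def
          by (intro mass_straddling[OF Suc.prems(2,3) 2(3) kn ak] less_imp_le)
      next
        case 3
        have rk: "real (k - 1) = real k - 1" using 3 by (simp add: of_nat_diff)
        have "mass t a b \<le> ratio * (mob t b - mob t a) powr h"
        proof (rule mass_full_cylinder'[OF Suc.prems(2,3,4,5,6)])
          show "k - 1 \<in> {1..n}" using 3 kn by auto
          show "a \<le> 1 / (real (k - 1) + 1)" using ak unfolding rk by simp
          show "1 / real (k - 1) \<le> b" using 3 unfolding rk by simp
        qed
        also have "\<dots> \<le> C * (mob t b - mob t a) powr h" using C by (intro mult_right_mono) auto
        finally show ?thesis .
      qed
    qed
  qed
  have "mob 1 a < mob 1 b" using assms by (simp add: mob_def field_simps)
  then obtain N where "(1 / 2) ^ N < mob 1 b - mob 1 a"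
    using real_arch_pow_inv[of "mob 1 b - mob 1 a" "1 / 2"] by auto
  then show ?thesis using main assms unfolding C_def by blast
qed

end

subsection \<open>Hausdorff measure from below\<close>


lemma hausdorff_premeasure_finite_cover:
  fixes A :: "'a::metric_space set"
  assumes I: "finite I" and cov: "A \<subseteq> (\<Union>i\<in>I. U i)" and bd: "\<And>i. i \<in> I \<Longrightarrow> bounded (U i)"
    and d: "\<And>i. i \<in> I \<Longrightarrow> diameter (U i) \<le> d i" "\<And>i. i \<in> I \<Longrightarrow> d i \<le> \<delta>" and \<delta>: "0 \<le> \<delta>" and h: "0 < h"
  shows "hausdorff_premeasure h \<delta> A \<le> ennreal (\<Sum>i\<in>I. d i powr h)"
proof -
  obtain f where f: "bij_betw f {..<card I} I"
    using ex_bij_betw_nat_finite[OF I] by (auto simp: atLeast0LessThan)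
  define V where "V i = (if i < card I then U (f i) else {})" for i
  have fI: "f i \<in> I" if "i < card I" for i using f that by (auto simp: bij_betw_def)
  have "A \<subseteq> (\<Union>i. V i)"
  proof
    fix x assume "x \<in> A"
    then obtain j where j: "j \<in> I" "x \<in> U j" using cov by auto
    have "j \<in> f ` {..<card I}" using f j(1) by (simp add: bij_betw_def)
    then obtain i where "i < card I" "f i = j" by auto
    then show "x \<in> (\<Union>i. V i)" using j by (auto simp: V_def intro!: exI[of _ i])
  qed
  moreover have "bounded (V i) \<and> diameter (V i) \<le> \<delta>" for i
    using bd[OF fI[of i]] d[OF fI[of i]] \<delta> by (auto simp: V_def)
  ultimately have "hausdorff_premeasure h \<delta> A \<le> (\<Sum>i. diam_pow h (V i))"
    unfolding hausdorff_premeasure_def by (intro INF_lower) auto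
  also have "\<dots> = (\<Sum>i<card I. diam_pow h (V i))"
    by (intro suminf_finite) (auto simp: V_def diam_pow_def)
  also have "\<dots> \<le> (\<Sum>i<card I. ennreal (d (f i) powr h))"
  proof (rule sum_mono)
    fix i assume "i \<in> {..<card I}"
    then have i: "f i \<in> I" "V i = U (f i)" using fI by (auto simp: V_def)
    have "diameter (U (f i)) powr h \<le> d (f i) powr h"
      using d(1)[OF i(1)] h diameter_ge_0[OF bd[OF i(1)]] by (intro powr_mono2) auto
    then show "diam_pow h (V i) \<le> ennreal (d (f i) powr h)"
      using h by (simp add: i diam_pow_def ennreal_leI)
  qed
  also have "\<dots> = (\<Sum>i\<in>I. ennreal (d i powr h))" by (rule sum.reindex_bij_betw[OF f])
  also have "\<dots> = ennreal (\<Sum>i\<in>I. d i powr h)" by (rule sum_ennreal) simp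
  finally show ?thesis .
qed

lemma hausdorff_premeasure_smaller_exponent:
  assumes "s \<le> h" "0 \<le> s" "0 \<le> \<delta>" "\<delta> \<le> 1"
  shows "hausdorff_premeasure h \<delta> A \<le> hausdorff_premeasure s \<delta> A"
  unfolding hausdorff_premeasure_def
proof (rule INF_mono)
  fix U :: "nat \<Rightarrow> 'a set"
  assume U: "U \<in> {U. A \<subseteq> (\<Union>i. U i) \<and> (\<forall>i. bounded (U i) \<and> diameter (U i) \<le> \<delta>)}"
  have "diam_pow h (U i) \<le> diam_pow s (U i)" for i
  proof -
    have b: "0 \<le> diameter (U i)" "diameter (U i) \<le> 1" using U assms diameter_ge_0[of "U i"] by (auto intro: order_trans)
    have "diameter (U i) powr h \<le> diameter (U i) powr s" "diameter (U i) powr h \<le> 1"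
      using b assms powr_mono'[of s h "diameter (U i)"] powr_mono'[of 0 h "diameter (U i)"] by (cases "diameter (U i) = 0"; simp)+
    then show ?thesis using assms by (auto simp: diam_pow_def intro!: ennreal_leI simp: ennreal_le_1)
  qed
  then show "\<exists>V\<in>{U. A \<subseteq> (\<Union>i. U i) \<and> (\<forall>i. bounded (U i) \<and> diameter (U i) \<le> \<delta>)}.
      (\<Sum>i. diam_pow h (V i)) \<le> (\<Sum>i. diam_pow s (U i))"
    using U by (intro bexI[of _ U] suminf_le) auto
qed

lemma hausdorff_premeasure_larger_exponent:
  assumes "0 < h" "h < s" "0 < \<delta>"
  shows "hausdorff_premeasure s \<delta> A \<le> ennreal (\<delta> powr (s - h)) * hausdorff_premeasure h \<delta> A"
proof -
  have "hausdorff_premeasure s \<delta> A \<le> ennreal (\<delta> powr (s - h)) * (\<Sum>i. diam_pow h (U i))"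
    if U: "A \<subseteq> (\<Union>i. U i) \<and> (\<forall>i. bounded (U i) \<and> diameter (U i) \<le> \<delta>)" for U :: "nat \<Rightarrow> 'a set"
  proof -
    have "hausdorff_premeasure s \<delta> A \<le> (\<Sum>i. diam_pow s (U i))"
      unfolding hausdorff_premeasure_def using U by (intro INF_lower) auto
    also have "\<dots> \<le> (\<Sum>i. ennreal (\<delta> powr (s - h)) * diam_pow h (U i))"
    proof (rule suminf_le)
      fix i
      have b: "0 \<le> diameter (U i)" "diameter (U i) \<le> \<delta>" using U diameter_ge_0[of "U i"] by auto
      have "diameter (U i) powr s = diameter (U i) powr (s - h) * diameter (U i) powr h"
        by (simp flip: powr_add)
      also have "\<dots> \<le> \<delta> powr (s - h) * diameter (U i) powr h"
        using b assms by (intro mult_right_mono powr_mono2) auto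
      finally show "diam_pow s (U i) \<le> ennreal (\<delta> powr (s - h)) * diam_pow h (U i)"
        using assms by (auto simp: diam_pow_def ennreal_leI simp flip: ennreal_mult)
    qed auto
    also have "\<dots> = ennreal (\<delta> powr (s - h)) * (\<Sum>i. diam_pow h (U i))" by (rule ennreal_suminf_cmult)
    finally show ?thesis .
  qed
  note le = this
  \<comment> \<open>Multiplication by the inverse constant \<open>d\<close> moves the factor away
    from the infimum.\<close>
  define c where "c = ennreal (\<delta> powr (s - h))"
  define d where "d = ennreal (\<delta> powr (h - s))"
  have "\<delta> powr (h - s) * \<delta> powr (s - h) = 1" using assms by (simp flip: powr_add)
  then have dc: "d * c = 1" by (simp add: c_def d_def flip: ennreal_mult)
  have "d * hausdorff_premeasure s \<delta> A \<le> hausdorff_premeasure h \<delta> A"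
    unfolding hausdorff_premeasure_def[of h]
  proof (rule INF_greatest)
    fix U :: "nat \<Rightarrow> 'a set"
    assume "U \<in> {U. A \<subseteq> (\<Union>i. U i) \<and> (\<forall>i. bounded (U i) \<and> diameter (U i) \<le> \<delta>)}"
    then have "hausdorff_premeasure s \<delta> A \<le> c * (\<Sum>i. diam_pow h (U i))"
      unfolding c_def by (intro le) auto
    then have "d * hausdorff_premeasure s \<delta> A \<le> d * (c * (\<Sum>i. diam_pow h (U i)))"
      by (rule mult_left_mono) simp
    then show "d * hausdorff_premeasure s \<delta> A \<le> (\<Sum>i. diam_pow h (U i))"
      by (simp only: mult.assoc[symmetric] dc mult_1)
  qed
  then have "c * (d * hausdorff_premeasure s \<delta> A) \<le> c * hausdorff_premeasure h \<delta> A"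
    by (rule mult_left_mono) simp
  moreover have "c * (d * hausdorff_premeasure s \<delta> A) = hausdorff_premeasure s \<delta> A"
  proof -
    have "c * d = 1" using dc by (subst mult.commute)
    then show ?thesis by (simp only: mult.assoc[symmetric]) simp
  qed
  ultimately show ?thesis by (simp add: c_def)
qed

lemma hausdorff_dim_eqI:
  assumes h: "0 < h" and pos: "0 < hausdorff_measure h A" and fin: "hausdorff_measure h A < top"
  shows "hausdorff_dim A = ennreal h"
proof (rule antisym)
  have zero: "hausdorff_measure s A = 0" if s: "h < s" for s
  proof -
    have "hausdorff_premeasure s \<delta> A \<le> 0" if \<delta>: "\<delta> > 0" for \<delta>
    proof -
      obtain M where M: "hausdorff_measure h A = ennreal M" "M \<ge> 0"
        using fin by (cases "hausdorff_measure h A") auto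
      show ?thesis
      proof (rule ennreal_le_epsilon)
        fix e :: real assume e: "e > 0"
        \<comment> \<open>The premeasure of exponent \<open>s\<close> at scale \<open>r\<close> is
          at most \<open>r powr (s - h) * M\<close>; this scale makes it at most
          \<open>e\<close>.\<close>
        define r where "r = min \<delta> ((e / (M + 1)) powr (1 / (s - h)))"
        have r: "0 < r" "r \<le> \<delta>" using \<delta> e M by (auto simp: r_def)
        have "r powr (s - h) \<le> ((e / (M + 1)) powr (1 / (s - h))) powr (s - h)"
          using r s by (intro powr_mono2) (auto simp: r_def)
        also have "\<dots> = e / (M + 1)" using s e M by (simp add: powr_powr)
        finally have "r powr (s - h) * M \<le> e / (M + 1) * M" using M by (intro mult_right_mono)
        also have "\<dots> \<le> e"
        proof -
          have "e * M \<le> e * (M + 1)" using e by simp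
          then show ?thesis using M by (simp add: pos_divide_le_eq)
        qed
        finally have rM: "r powr (s - h) * M \<le> e" .
        have "hausdorff_premeasure s \<delta> A \<le> hausdorff_premeasure s r A"
          using r(2) by (rule hausdorff_premeasure_antimono)
        also have "\<dots> \<le> ennreal (r powr (s - h)) * hausdorff_premeasure h r A"
          using h s r by (intro hausdorff_premeasure_larger_exponent)
        also have "\<dots> \<le> ennreal (r powr (s - h)) * ennreal M"
          unfolding M(1)[symmetric] hausdorff_measure_eq_SUP using r by (intro mult_left_mono SUP_upper) auto
        also have "\<dots> \<le> ennreal e" using M rM by (simp flip: ennreal_mult add: ennreal_leI)
        finally show "hausdorff_premeasure s \<delta> A \<le> 0 + ennreal e" by simp
      qed
    qed
    then show ?thesis unfolding hausdorff_measure_eq_SUP by (intro antisym SUP_least) auto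
  qed
  have "hausdorff_dim A \<le> ennreal h + ennreal e" if "e > 0" for e
  proof -
    have "hausdorff_dim A \<le> ennreal (h + e)"
      unfolding hausdorff_dim_def using zero[of "h + e"] h that
      by (intro Inf_lower CollectI exI[of _ "h + e"]) (simp del: ennreal_plus)
    then show ?thesis using h that by (simp add: ennreal_plus)
  qed
  then show "hausdorff_dim A \<le> ennreal h" by (rule ennreal_le_epsilon)
  show "ennreal h \<le> hausdorff_dim A"
    unfolding hausdorff_dim_def
  proof (rule Inf_greatest)
    fix x assume "x \<in> {ennreal s |s. 0 \<le> s \<and> hausdorff_measure s A = 0}"
    then obtain s where s: "x = ennreal s" "0 \<le> s" "hausdorff_measure s A = 0" by auto
    have "h \<le> s"
    proof (rule ccontr)
      assume "\<not> h \<le> s"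
      have "hausdorff_premeasure h \<delta> A \<le> 0" if "\<delta> > 0" for \<delta>
      proof -
        have "hausdorff_premeasure h \<delta> A \<le> hausdorff_premeasure h (min \<delta> 1) A"
          by (rule hausdorff_premeasure_antimono) simp
        also have "\<dots> \<le> hausdorff_premeasure s (min \<delta> 1) A"
          using \<open>\<not> h \<le> s\<close> s that by (intro hausdorff_premeasure_smaller_exponent) auto
        also have "\<dots> \<le> hausdorff_measure s A"
          unfolding hausdorff_measure_eq_SUP using that by (intro SUP_upper) auto
        finally show ?thesis using s by simp
      qed
      then have "hausdorff_measure h A \<le> 0"
        unfolding hausdorff_measure_eq_SUP by (intro SUP_least) auto
      then show False using pos by simp
    qed
    then show "ennreal h \<le> x" using s by (simp add: ennreal_leI)
  qed
qed

section \<open>Compact approximations of the limit set\<close>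

definition level_set :: "nat \<Rightarrow> nat \<Rightarrow> real set" where
  "level_set n k = (\<Union>\<omega>\<in>{\<omega>. length \<omega> = k \<and> set \<omega> \<subseteq> {1..n}}. gauss_word \<omega> ` {0..1})"

lemma gauss_limit_set_eq: "gauss_limit_set n = (\<Inter>k\<in>{1..}. level_set n k)"
  by (simp add: gauss_limit_set_def level_set_def)

lemma gauss_word_Nil [simp]: "gauss_word [] = id"
  by (simp add: gauss_word_def)

lemma gauss_word_Cons [simp]: "gauss_word (k # \<omega>) = gauss_branch k \<circ> gauss_word \<omega>"
  by (simp add: gauss_word_def)

lemma gauss_word_append: "gauss_word (\<omega> @ \<tau>) = gauss_word \<omega> \<circ> gauss_word \<tau>"
  by (induction \<omega>) (auto simp: comp_assoc)

lemma gauss_word_in: "set \<omega> \<subseteq> {1..n} \<Longrightarrow> x \<in> {0..1} \<Longrightarrow> gauss_word \<omega> x \<in> {0..1}"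
proof (induction \<omega>)
  case (Cons k \<omega>)
  then have "gauss_word \<omega> x \<in> {0..1}" "k \<ge> 1" by auto
  then show ?case using gauss_branch_in by simp
qed auto

lemma level_set_0 [simp]: "level_set n 0 = {0..1}"
  by (auto simp: level_set_def)

lemma level_set_Suc: "level_set n (Suc k) = (\<Union>j\<in>{1..n}. gauss_branch j ` level_set n k)"
proof (intro equalityI subsetI)
  fix x assume "x \<in> level_set n (Suc k)"
  then obtain \<omega> y where w: "length \<omega> = Suc k" "set \<omega> \<subseteq> {1..n}" "y \<in> {0..1}" "x = gauss_word \<omega> y"
    by (auto simp: level_set_def)
  then obtain j \<tau> where "\<omega> = j # \<tau>" by (cases \<omega>) auto
  then show "x \<in> (\<Union>j\<in>{1..n}. gauss_branch j ` level_set n k)"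
    using w by (auto simp: level_set_def intro!: bexI[of _ j] imageI exI[of _ \<tau>])
next
  fix x assume "x \<in> (\<Union>j\<in>{1..n}. gauss_branch j ` level_set n k)"
  then obtain j \<tau> y where "j \<in> {1..n}" "length \<tau> = k" "set \<tau> \<subseteq> {1..n}" "y \<in> {0..1}" "x = gauss_branch j (gauss_word \<tau> y)"
    by (auto simp: level_set_def)
  then show "x \<in> level_set n (Suc k)"
    unfolding level_set_def by (intro UN_I[of "j # \<tau>"]) auto
qed

lemma level_set_subset: "level_set n k \<subseteq> {0..1}"
  unfolding level_set_def using gauss_word_in[of _ n] by blast

lemma level_set_antimono: "level_set n (Suc k) \<subseteq> level_set n k"
proof (induction k)
  case 0
  show ?case using level_set_subset[of n "Suc 0"] by simp
next
  case (Suc k)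
  then show ?case unfolding level_set_Suc[of n "Suc k"] level_set_Suc[of n k] by blast
qed

lemma compact_level_set: "compact (level_set n k)"
proof (induction k)
  case (Suc k)
  have "compact (gauss_branch j ` level_set n k)" if "j \<in> {1..n}" for j
  proof (rule compact_continuous_image[OF _ Suc])
    have "\<And>x. x \<in> level_set n k \<Longrightarrow> x + real j \<noteq> 0" using that level_set_subset[of n k] by fastforce
    then show "continuous_on (level_set n k) (gauss_branch j)"
      unfolding gauss_branch_def by (intro continuous_intros) auto
  qed
  then show ?case unfolding level_set_Suc by (intro compact_UN) auto
qed simp

text \<open>A nested-compactness argument that stands in for countable additivity: an open cover of
  the limit set already covers a finite level, off which \<open>\<Lambda>\<close> vanishes.\<close>

lemma level_set_subset_open:
  assumes V: "open V" "gauss_limit_set n \<subseteq> V"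
  obtains k where "level_set n k \<subseteq> V"
proof -
  have "\<exists>k. level_set n k \<subseteq> V"
  proof (rule ccontr)
    assume no: "\<not> ?thesis"
    have dec: "level_set n k \<subseteq> level_set n m" if "m \<le> k" for m k
      using that level_set_antimono by (rule lift_Suc_antimono_le[rotated])
    have "(\<Inter>k. level_set n (Suc k) - V) \<noteq> {}"
    proof (rule compact_nest)
      fix k show "compact (level_set n (Suc k) - V)"
        using compact_level_set V(1) by (rule compact_diff)
      show "level_set n (Suc k) - V \<noteq> {}" using no by auto
    next
      fix m k :: nat assume "m \<le> k"
      then show "level_set n (Suc k) - V \<subseteq> level_set n (Suc m) - V" using dec[of "Suc m" "Suc k"] by auto
    qed
    then obtain x where x: "\<And>k. x \<in> level_set n (Suc k)" "x \<notin> V" by auto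
    have "x \<in> gauss_limit_set n"
      unfolding gauss_limit_set_eq
    proof (rule INT_I)
      fix k :: nat assume "k \<in> {1..}"
      then show "x \<in> level_set n k" using x(1)[of "k - 1"] by simp
    qed
    then show False using x V by auto
  qed
  then show thesis using that by blast
qed

lemma real_set_between_Inf_Sup:
  fixes U :: "real set"
  assumes "bounded U" "U \<noteq> {}"
  shows "U \<subseteq> {Inf U..Sup U}" "Sup U - Inf U \<le> diameter U" "Inf U \<le> Sup U"
proof -
  have b: "bdd_above U" "bdd_below U" using assms by (auto intro: bounded_imp_bdd_above bounded_imp_bdd_below)
  show s: "U \<subseteq> {Inf U..Sup U}" using b by (auto intro: cInf_lower cSup_upper)
  then show "Inf U \<le> Sup U" using assms(2) by fastforce
  have "Sup U \<le> y + diameter U" if y: "y \<in> U" for y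
  proof (rule cSup_least[OF assms(2)])
    fix x assume "x \<in> U"
    then have "dist x y \<le> diameter U" using y assms by (intro diameter_bounded_bound)
    then show "x \<le> y + diameter U" by (simp add: dist_real_def)
  qed
  then have "Sup U - diameter U \<le> y" if "y \<in> U" for y using that by (simp add: algebra_simps)
  then have "Sup U - diameter U \<le> Inf U" using assms(2) by (intro cInf_greatest)
  then show "Sup U - Inf U \<le> diameter U" by simp
qed

context conformal_mean_pos begin

text \<open>If a branch image of \<open>x\<close> misses level \<open>k + 1\<close>, then
  \<open>x\<close> misses level \<open>k\<close>. So the transfer operator bounds one indicator by
  \<open>n\<close> times the other, and the factor is harmless since the mean is 0.\<close>

lemma mean_off_level_set: "\<Lambda> (\<lambda>x. of_bool (x \<notin> level_set n k)) = 0"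
proof (induction k)
  case 0
  have "\<Lambda> (\<lambda>x. of_bool (x \<notin> level_set n 0)) = \<Lambda> (\<lambda>_. 0)"
    by (intro mean_cong bdd01_intros) auto
  then show ?case by (simp add: mean_const)
next
  case (Suc k)
  let ?f = "\<lambda>k x. of_bool (x \<notin> level_set n k) :: real"
  have b: "bdd01 (?f k)" for k by (intro bdd01_intros)
  have "\<Lambda> (?f (Suc k)) = \<Lambda> (transfer h {1..n} (?f (Suc k)))" using mean_transfer[OF b] by simp
  also have "\<dots> \<le> \<Lambda> (\<lambda>x. real n * ?f k x)"
  proof (rule mean_mono)
    fix x :: real assume x: "x \<in> {0..1}"
    have "transfer h {1..n} (?f (Suc k)) x \<le> (\<Sum>j=1..n. ?f k x)"
      unfolding transfer_def
    proof (rule sum_mono)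
      fix j assume j: "j \<in> {1..n}"
      have "(x + real j) powr (- (2 * h)) \<le> 1" using x j h_nonneg powr_mono2'[of "- (2 * h)" 1 "x + real j"] by simp
      moreover have "?f (Suc k) (gauss_branch j x) \<le> ?f k x" using j by (auto simp: level_set_Suc)
      ultimately show "(x + real j) powr (- (2 * h)) * ?f (Suc k) (gauss_branch j x) \<le> ?f k x"
        using mult_mono[of "(x + real j) powr (- (2 * h))" 1 "?f (Suc k) (gauss_branch j x)" "?f k x"] by simp
    qed
    then show "transfer h {1..n} (?f (Suc k)) x \<le> real n * ?f k x" by simp
  next
    show "bdd01 (transfer h {1..n} (?f (Suc k)))" by (rule bdd01_transfer[OF b]) auto
    show "bdd01 (\<lambda>x. real n * ?f k x)" by (intro bdd01_intros)
  qed
  also have "\<dots> = 0" using Suc mean_cmult[OF b] by simp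
  finally show ?case using mean_nonneg[OF b[of "Suc k"]] by simp
qed

definition Cmass :: real where "Cmass = 2 powr (1 - h) * ratio"

lemma Cmass_pos: "0 < Cmass"
  using ratio_ge_1 by (simp add: Cmass_def)

lemma mean_interval_le:
  assumes "l < u"
  shows "\<Lambda> (\<lambda>x. of_bool (x \<in> {l<..<u})) \<le> Cmass * (u - l) powr h"
proof (cases "max 0 l < min 1 u")
  case True
  have "\<Lambda> (\<lambda>x. of_bool (x \<in> {l<..<u})) \<le> mass 0 (max 0 l) (min 1 u)"
    unfolding mass_def by (intro mean_mono bdd01_intros) auto
  also have "\<dots> \<le> Cmass * (mob 0 (min 1 u) - mob 0 (max 0 l)) powr h"
    unfolding Cmass_def using True by (intro mass_le_ratio) auto
  also have "\<dots> \<le> Cmass * (u - l) powr h"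
    using True Cmass_pos h_pos by (intro mult_left_mono powr_mono2) (auto simp: mob_def)
  finally show ?thesis .
next
  case False
  have "\<Lambda> (\<lambda>x. of_bool (x \<in> {l<..<u})) = \<Lambda> (\<lambda>_. 0)"
    using False assms by (intro mean_cong bdd01_intros) (auto simp: max_def min_def split: if_splits)
  then show ?thesis using Cmass_pos by (simp add: mean_const)
qed

text \<open>The mass distribution principle for a finitely additive mean: the covering sets are
  enlarged to open intervals, finitely many of which cover a level set by compactness.\<close>

lemma hausdorff_premeasure_ge: "ennreal (1 / Cmass) \<le> hausdorff_premeasure h \<delta> (gauss_limit_set n)"
  unfolding hausdorff_premeasure_def
proof (rule INF_greatest)
  fix U :: "nat \<Rightarrow> real set"
  assume "U \<in> {U. gauss_limit_set n \<subseteq> (\<Union>i. U i) \<and> (\<forall>i. bounded (U i) \<and> diameter (U i) \<le> \<delta>)}"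
  then have U: "gauss_limit_set n \<subseteq> (\<Union>i. U i)" "\<And>i. bounded (U i)" by auto
  show "ennreal (1 / Cmass) \<le> (\<Sum>i. diam_pow h (U i))"
  proof (rule ennreal_le_epsilon)
    fix e :: real assume e: "e > 0"
    \<comment> \<open>By subadditivity of the power, enlarging set \<open>i\<close> by
      \<open>\<eta> i\<close> on both sides adds at most \<open>e / 2 ^ (i + 1)\<close> to its
      \<open>h\<close>-th power.\<close>
    define \<eta> where "\<eta> i = (e * (1 / 2) ^ Suc i) powr (1 / h) / 2" for i
    have \<eta>0: "\<eta> i > 0" for i using e by (simp add: \<eta>_def)
    have \<eta>h: "(2 * \<eta> i) powr h = e * (1 / 2) ^ Suc i" for i
      using e h_pos by (simp add: \<eta>_def powr_powr del: power_Suc)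
    define V where "V i = (if U i = {} then {} else {Inf (U i) - \<eta> i<..<Sup (U i) + \<eta> i})" for i
    have UV: "U i \<subseteq> V i" for i
      using real_set_between_Inf_Sup(1)[OF U(2), of i] \<eta>0[of i] by (fastforce simp: V_def)
    have Vo: "open (V i)" for i by (simp add: V_def)
    obtain k where k: "level_set n k \<subseteq> (\<Union>i. V i)"
      using level_set_subset_open[of "\<Union>i. V i" n] Vo U(1) UV by (metis SUP_mono UNIV_I open_UN subset_trans)
    obtain I where I: "finite I" "level_set n k \<subseteq> (\<Union>i\<in>I. V i)"
      using compactE_image[OF compact_level_set, of UNIV V n k] Vo k by auto
    have Vm: "\<Lambda> (\<lambda>x. of_bool (x \<in> V i)) \<le> Cmass * (enn2real (diam_pow h (U i)) + e * (1 / 2) ^ Suc i)" for i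
    proof (cases "U i = {}")
      case True
      then show ?thesis using Cmass_pos e by (simp add: V_def mean_const)
    next
      case False
      note b = real_set_between_Inf_Sup[OF U(2) False]
      have "\<Lambda> (\<lambda>x. of_bool (x \<in> V i)) \<le> Cmass * ((Sup (U i) + \<eta> i) - (Inf (U i) - \<eta> i)) powr h"
        using False b(3) \<eta>0[of i] by (simp only: V_def if_False) (intro mean_interval_le, simp)
      also have "\<dots> \<le> Cmass * (diameter (U i) powr h + (2 * \<eta> i) powr h)"
      proof (rule mult_left_mono)
        have d: "0 \<le> diameter (U i)" using U(2) by (rule diameter_ge_0)
        have "((Sup (U i) + \<eta> i) - (Inf (U i) - \<eta> i)) powr h \<le> (diameter (U i) + 2 * \<eta> i) powr h"
          using b \<eta>0[of i] h_pos by (intro powr_mono2) auto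
        also have "\<dots> \<le> diameter (U i) powr h + (2 * \<eta> i) powr h"
          using powr_diff_le_diff_powr[of "2 * \<eta> i" "diameter (U i) + 2 * \<eta> i" h] d \<eta>0[of i] h_pos h_less_1 by simp
        finally show "((Sup (U i) + \<eta> i) - (Inf (U i) - \<eta> i)) powr h \<le> diameter (U i) powr h + (2 * \<eta> i) powr h" .
      qed (use Cmass_pos in simp)
      finally show ?thesis using False h_pos unfolding \<eta>h by (simp add: diam_pow_def)
    qed
    have fin: "diam_pow h (U i) = ennreal (enn2real (diam_pow h (U i)))" for i
      using h_pos by (simp add: diam_pow_def)
    have bV: "bdd01 (\<lambda>x. of_bool (x \<in> V i))" for i by (intro bdd01_intros)
    have "1 = \<Lambda> (\<lambda>_. 1)" by (simp add: mean_one)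
    also have "\<dots> \<le> \<Lambda> (\<lambda>x. of_bool (x \<notin> level_set n k) + (\<Sum>i\<in>I. of_bool (x \<in> V i)))"
    proof (rule mean_mono)
      fix x :: real
      show "1 \<le> of_bool (x \<notin> level_set n k) + (\<Sum>i\<in>I. of_bool (x \<in> V i) :: real)"
      proof (cases "x \<in> level_set n k")
        case True
        then obtain i where i: "i \<in> I" "x \<in> V i" using I by auto
        have "of_bool (x \<in> V i) \<le> (\<Sum>i\<in>I. of_bool (x \<in> V i) :: real)"
          using i I by (intro member_le_sum) auto
        then show ?thesis using True i by simp
      next
        case False
        have "0 \<le> (\<Sum>i\<in>I. of_bool (x \<in> V i) :: real)" by (intro sum_nonneg) auto
        then show ?thesis using False by simp
      qed
    qed (intro bdd01_intros)+
    also have "\<dots> = \<Lambda> (\<lambda>x. of_bool (x \<notin> level_set n k)) + (\<Sum>i\<in>I. \<Lambda> (\<lambda>x. of_bool (x \<in> V i)))"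
      using bV by (subst mean_add; (intro bdd01_intros)?) (subst mean_sum; auto)
    also have "\<dots> \<le> 0 + (\<Sum>i\<in>I. Cmass * (enn2real (diam_pow h (U i)) + e * (1 / 2) ^ Suc i))"
      using Vm mean_off_level_set by (intro add_mono sum_mono) auto
    also have "\<dots> = Cmass * ((\<Sum>i\<in>I. enn2real (diam_pow h (U i))) + e * (\<Sum>i\<in>I. (1 / 2) ^ Suc i))"
      by (simp only: sum_distrib_left[symmetric] sum.distrib add_0)
    also have "\<dots> \<le> Cmass * ((\<Sum>i\<in>I. enn2real (diam_pow h (U i))) + e * 1)"
    proof (intro mult_left_mono add_left_mono)
      have "(\<Sum>i\<in>I. (1 / 2) ^ Suc i) \<le> (\<Sum>i. (1 / 2 :: real) ^ Suc i)"
        using I by (intro sum_le_suminf) (auto simp: summable_Suc_iff intro!: summable_geometric)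
      also have "\<dots> = 1" using power_half_series by (simp add: sums_iff)
      finally show "(\<Sum>i\<in>I. (1 / 2 :: real) ^ Suc i) \<le> 1" .
    qed (use e Cmass_pos in auto)
    finally have "1 / Cmass \<le> (\<Sum>i\<in>I. enn2real (diam_pow h (U i))) + e"
      using Cmass_pos by (simp add: field_simps)
    then have "ennreal (1 / Cmass) \<le> ennreal ((\<Sum>i\<in>I. enn2real (diam_pow h (U i))) + e)" by (rule ennreal_leI)
    also have "\<dots> = ennreal (\<Sum>i\<in>I. enn2real (diam_pow h (U i))) + ennreal e"
      using e by (intro ennreal_plus sum_nonneg) auto
    also have "ennreal (\<Sum>i\<in>I. enn2real (diam_pow h (U i))) = (\<Sum>i\<in>I. diam_pow h (U i))"
      by (subst sum_ennreal[symmetric]) (auto simp flip: fin)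
    also have "(\<Sum>i\<in>I. diam_pow h (U i)) + ennreal e \<le> (\<Sum>i. diam_pow h (U i)) + ennreal e"
      using I by (intro add_right_mono sum_le_suminf) auto
    finally show "ennreal (1 / Cmass) \<le> (\<Sum>i. diam_pow h (U i)) + ennreal e" .
  qed
qed

end

subsection \<open>Hausdorff measure from above\<close>


fun word_weight :: "nat list \<Rightarrow> real \<Rightarrow> real" where
  "word_weight [] x = 1"
| "word_weight (k # \<omega>) x = word_weight \<omega> x / (gauss_word \<omega> x + real k)"

text \<open>The square of \<open>word_weight \<omega> x\<close> is the modulus of the derivative of \<open>gauss_word \<omega>\<close> at \<open>x\<close>.\<close>

lemma word_weight_pos: "set \<omega> \<subseteq> {1..n} \<Longrightarrow> x \<in> {0..1} \<Longrightarrow> 0 < word_weight \<omega> x"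
proof (induction \<omega>)
  case (Cons k \<omega>)
  then have "0 \<le> gauss_word \<omega> x" "1 \<le> k" using gauss_word_in[of \<omega> n x] by auto
  then show ?case using Cons by simp
qed auto

lemma gauss_word_dist:
  assumes "set \<omega> \<subseteq> {1..n}" "x \<in> {0..1}" "y \<in> {0..1}"
  shows "\<bar>gauss_word \<omega> x - gauss_word \<omega> y\<bar> = \<bar>x - y\<bar> * (word_weight \<omega> x * word_weight \<omega> y)"
  using assms
proof (induction \<omega>)
  case (Cons k \<omega>)
  let ?u = "gauss_word \<omega> x" and ?v = "gauss_word \<omega> y"
  have uv: "0 < ?u + real k" "0 < ?v + real k"
    using Cons.prems gauss_word_in[of \<omega> n x] gauss_word_in[of \<omega> n y] by auto
  have "gauss_branch k ?u - gauss_branch k ?v = (?v - ?u) / ((?u + real k) * (?v + real k))"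
    using uv by (simp add: gauss_branch_def field_simps)
  then have "\<bar>gauss_branch k ?u - gauss_branch k ?v\<bar> = \<bar>?u - ?v\<bar> / ((?u + real k) * (?v + real k))"
    using uv by (simp add: abs_mult abs_minus_commute)
  also have "\<bar>?u - ?v\<bar> = \<bar>x - y\<bar> * (word_weight \<omega> x * word_weight \<omega> y)" using Cons by simp
  finally show ?case by simp
qed simp

lemma word_weight_snoc:
  "word_weight (\<omega> @ [k]) x = word_weight \<omega> (gauss_branch k x) / (x + real k)"
  by (induction \<omega>) (simp_all add: gauss_word_append)

lemma word_weight_moebius:
  assumes "set \<omega> \<subseteq> {1..n}"
  obtains p p' q q' where "0 \<le> p" "0 \<le> p'" "0 < q" "0 \<le> q'"
    "\<And>x. x \<in> {0..1} \<Longrightarrow> gauss_word \<omega> x = (p + p' * x) / (q + q' * x)"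
    "\<And>x. x \<in> {0..1} \<Longrightarrow> word_weight \<omega> x = 1 / (q + q' * x)"
proof -
  have "\<exists>p p' q q'. 0 \<le> p \<and> 0 \<le> p' \<and> 0 < q \<and> 0 \<le> q' \<and>
    (\<forall>x\<in>{0..1}. gauss_word \<omega> x = (p + p' * x) / (q + q' * x) \<and> word_weight \<omega> x = 1 / (q + q' * x))"
    using assms
  proof (induction \<omega>)
    case Nil
    show ?case by (intro exI[of _ 0] exI[of _ 1]) auto
  next
    case (Cons k \<omega>)
    then obtain p p' q q' where *: "0 \<le> p" "0 \<le> p'" "0 < q" "0 \<le> q'"
      "\<And>x. x \<in> {0..1} \<Longrightarrow> gauss_word \<omega> x = (p + p' * x) / (q + q' * x)"
      "\<And>x. x \<in> {0..1} \<Longrightarrow> word_weight \<omega> x = 1 / (q + q' * x)" by auto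
    have k: "real k \<ge> 1" using Cons.prems by auto
    have "gauss_word (k # \<omega>) x = (q + q' * x) / ((p + real k * q) + (p' + real k * q') * x)
        \<and> word_weight (k # \<omega>) x = 1 / ((p + real k * q) + (p' + real k * q') * x)" if x: "x \<in> {0..1}" for x
    proof -
      have d: "0 < q + q' * x" using * x by (auto intro!: add_pos_nonneg)
      have "gauss_word \<omega> x + real k = ((p + real k * q) + (p' + real k * q') * x) / (q + q' * x)"
        using d unfolding *(5)[OF x] by (simp add: field_simps)
      then show ?thesis using d *(6)[OF x] by (simp add: gauss_branch_def)
    qed
    moreover have "0 < p + real k * q" "0 \<le> p' + real k * q'" using * k by (auto intro!: add_nonneg_pos)
    ultimately show ?case using * by (metis less_imp_le)
  qed
  then show thesis using that by blast
qed

lemma word_weight_antimono: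
  assumes "set \<omega> \<subseteq> {1..n}" "x \<in> {0..1}"
  shows "word_weight \<omega> x \<le> word_weight \<omega> 0"
proof -
  obtain p p' q q' where "0 < q" "0 \<le> q'" "\<And>x. x \<in> {0..1} \<Longrightarrow> word_weight \<omega> x = 1 / (q + q' * x)"
    using word_weight_moebius[OF assms(1)] by metis
  then show ?thesis using assms by (auto intro!: frac_le)
qed

text \<open>A digit followed by another one has denominator at least \<open>1 + 1 / (n + 1)\<close>.
  The last digit, at \<open>x = 0\<close>, may have denominator 1, hence the exponent
  \<open>length \<omega> - 1\<close>.\<close>

lemma word_weight_decay:
  assumes "set \<omega> \<subseteq> {1..n}"
  shows "word_weight \<omega> 0 \<le> ((real n + 1) / (real n + 2)) ^ (length \<omega> - 1)"
  using assms
proof (induction \<omega>)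
  case (Cons k \<omega>)
  have k: "k \<in> {1..n}" using Cons by auto
  have pos: "0 < word_weight \<omega> 0" using Cons.prems by (intro word_weight_pos[of _ n]) auto
  show ?case
  proof (cases \<omega>)
    case (Cons j \<tau>)
    have t: "gauss_word \<tau> 0 \<in> {0..1}" using \<open>set (k # \<omega>) \<subseteq> {1..n}\<close> Cons by (intro gauss_word_in[of _ n]) auto
    have j: "j \<in> {1..n}" using \<open>set (k # \<omega>) \<subseteq> {1..n}\<close> Cons by auto
    have "1 / (real n + 1) \<le> 1 / (gauss_word \<tau> 0 + real j)"
      using t j by (intro frac_le) auto
    also have "\<dots> = gauss_word \<omega> 0" using Cons by (simp add: gauss_branch_def)
    finally have "1 + 1 / (real n + 1) \<le> gauss_word \<omega> 0 + real k" using k by auto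
    moreover have "1 + 1 / (real n + 1) = (real n + 2) / (real n + 1)" by (simp add: field_simps)
    ultimately have "word_weight \<omega> 0 / (gauss_word \<omega> 0 + real k) \<le> word_weight \<omega> 0 / ((real n + 2) / (real n + 1))"
    proof (intro divide_left_mono)
      have "0 \<le> gauss_word \<omega> 0" using \<open>set (k # \<omega>) \<subseteq> {1..n}\<close> gauss_word_in[of \<omega> n 0] by simp
      then show "0 < (gauss_word \<omega> 0 + real k) * ((real n + 2) / (real n + 1))"
        using k by (intro mult_pos_pos) auto
    qed (use pos in simp_all)
    also have "\<dots> = (real n + 1) / (real n + 2) * word_weight \<omega> 0" by simp
    also have "\<dots> \<le> (real n + 1) / (real n + 2) * ((real n + 1) / (real n + 2)) ^ (length \<omega> - 1)"
      using Cons.prems Cons.IH \<open>set (k # \<omega>) \<subseteq> {1..n}\<close> by (intro mult_left_mono) auto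
    also have "\<dots> = ((real n + 1) / (real n + 2)) ^ (length (k # \<omega>) - 1)"
      using Cons by simp
    finally show ?thesis by simp
  qed (use k in simp)
qed simp

section \<open>Extension of words and sums of weights\<close>

definition extend :: "nat set \<Rightarrow> nat list set \<Rightarrow> nat list set" where
  "extend K T = (\<lambda>(\<omega>, k). \<omega> @ [k]) ` (T \<times> K)"

lemma extendE:
  assumes "\<omega> \<in> extend K T"
  obtains \<tau> k where "\<omega> = \<tau> @ [k]" "\<tau> \<in> T" "k \<in> K"
  using assms by (auto simp: extend_def)

lemma UN_extend: "(\<Union>\<omega>\<in>extend K T. f \<omega>) = (\<Union>\<omega>\<in>T. \<Union>k\<in>K. f (\<omega> @ [k]))"
  by (auto simp: extend_def)

lemma finite_extend: "finite K \<Longrightarrow> finite T \<Longrightarrow> finite (extend K T)"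
  by (simp add: extend_def)

lemma finite_extend_iter: "finite K \<Longrightarrow> finite T \<Longrightarrow> finite ((extend K ^^ m) T)"
  by (induction m) (auto intro: finite_extend)

lemma extend_iter_words:
  assumes "\<And>\<omega>. \<omega> \<in> T \<Longrightarrow> length \<omega> = l \<and> set \<omega> \<subseteq> D" "K \<subseteq> D" "\<omega> \<in> (extend K ^^ m) T"
  shows "length \<omega> = l + m \<and> set \<omega> \<subseteq> D"
  using assms(3)
proof (induction m arbitrary: \<omega>)
  case (Suc m)
  then obtain \<tau> k where "\<omega> = \<tau> @ [k]" "\<tau> \<in> (extend K ^^ m) T" "k \<in> K"
    unfolding funpow.simps comp_apply by (elim extendE)
  then show ?case using Suc.IH[of \<tau>] assms(2) by auto
qed (use assms in auto)

text \<open>A digit appended at the end is the innermost branch, so it acts on the weights as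
  functions of \<open>x\<close>, exactly as the transfer operator does.\<close>

lemma weight_sum_extend:
  assumes T: "\<And>\<omega>. \<omega> \<in> T \<Longrightarrow> set \<omega> \<subseteq> {1..n}" and K: "K \<subseteq> {1..}" and x: "x \<in> {0..1}"
  shows "(\<Sum>\<omega>\<in>extend K T. word_weight \<omega> x powr (2 * s))
    = transfer s K (\<lambda>x. \<Sum>\<omega>\<in>T. word_weight \<omega> x powr (2 * s)) x"
proof -
  have inj: "inj_on (\<lambda>(\<omega>, k). \<omega> @ [k]) (T \<times> K)" by (auto simp: inj_on_def)
  have "(\<Sum>\<omega>\<in>extend K T. word_weight \<omega> x powr (2 * s))
      = (\<Sum>(\<omega>, k)\<in>T \<times> K. word_weight (\<omega> @ [k]) x powr (2 * s))"
    unfolding extend_def by (subst sum.reindex[OF inj]) (auto intro!: sum.cong)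
  also have "\<dots> = (\<Sum>(\<omega>, k)\<in>T \<times> K. (x + real k) powr (- (2 * s)) * word_weight \<omega> (gauss_branch k x) powr (2 * s))"
  proof (rule sum.cong[OF refl], clarify)
    fix \<omega> k assume "\<omega> \<in> T" "k \<in> K"
    show "word_weight (\<omega> @ [k]) x powr (2 * s) = (x + real k) powr (- (2 * s)) * word_weight \<omega> (gauss_branch k x) powr (2 * s)"
      unfolding word_weight_snoc powr_divide powr_minus by (simp add: divide_inverse mult.commute)
  qed
  also have "\<dots> = (\<Sum>\<omega>\<in>T. \<Sum>k\<in>K. (x + real k) powr (- (2 * s)) * word_weight \<omega> (gauss_branch k x) powr (2 * s))"
    by (simp add: sum.cartesian_product)
  also have "\<dots> = transfer s K (\<lambda>x. \<Sum>\<omega>\<in>T. word_weight \<omega> x powr (2 * s)) x"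
    unfolding transfer_def sum_distrib_left by (rule sum.swap)
  finally show ?thesis .
qed

lemma weight_sum_extend_iter:
  assumes T: "\<And>\<omega>. \<omega> \<in> T \<Longrightarrow> length \<omega> = l \<and> set \<omega> \<subseteq> {1..n}" and K: "K \<subseteq> {1..n}" and x: "x \<in> {0..1}"
  shows "(\<Sum>\<omega>\<in>(extend K ^^ m) T. word_weight \<omega> x powr (2 * s))
    = (transfer s K ^^ m) (\<lambda>x. \<Sum>\<omega>\<in>T. word_weight \<omega> x powr (2 * s)) x"
  using x
proof (induction m arbitrary: x)
  case (Suc m)
  have K1: "K \<subseteq> {1..}" using K by auto
  have "(\<Sum>\<omega>\<in>(extend K ^^ Suc m) T. word_weight \<omega> x powr (2 * s))
      = transfer s K (\<lambda>x. \<Sum>\<omega>\<in>(extend K ^^ m) T. word_weight \<omega> x powr (2 * s)) x"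
    unfolding funpow.simps comp_apply
    using extend_iter_words[OF T K] by (intro weight_sum_extend[of _ n] K1 Suc.prems) auto
  also have "\<dots> = transfer s K ((transfer s K ^^ m) (\<lambda>x. \<Sum>\<omega>\<in>T. word_weight \<omega> x powr (2 * s))) x"
    by (rule transfer_cong[OF Suc.IH K1 Suc.prems])
  finally show ?case by simp
qed simp

lemma level_set_extend:
  "(\<Union>\<omega>\<in>T. gauss_word \<omega> ` level_set n (Suc r)) = (\<Union>\<omega>\<in>extend {1..n} T. gauss_word \<omega> ` level_set n r)"
proof -
  have "gauss_word \<omega> ` gauss_branch j ` S = gauss_word (\<omega> @ [j]) ` S" for \<omega> j S
    by (simp add: gauss_word_append image_comp)
  then show ?thesis unfolding level_set_Suc image_UN UN_extend by simp
qed

lemma level_set_words: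
  "level_set n (m + r) = (\<Union>\<omega>\<in>(extend {1..n} ^^ m) {[]}. gauss_word \<omega> ` level_set n r)"
proof (induction m arbitrary: r)
  case (Suc m)
  have "level_set n (Suc m + r) = (\<Union>\<omega>\<in>(extend {1..n} ^^ m) {[]}. gauss_word \<omega> ` level_set n (Suc r))"
    using Suc[of "Suc r"] by simp
  then show ?case unfolding level_set_extend by simp
qed simp

text \<open>Each word is split at its first digit that is at least \<open>l\<close>.\<close>

lemma level_set_stopping_cover:
  assumes l: "l \<ge> 1"
  shows "(\<Union>\<omega>\<in>T. gauss_word \<omega> ` level_set n (m + r)) \<subseteq>
    (\<Union>j<m. \<Union>\<omega>\<in>(extend {1..<l} ^^ j) T. gauss_word \<omega> ` {1 / (real n + 1)..1 / real l})
    \<union> (\<Union>\<omega>\<in>(extend {1..<l} ^^ m) T. gauss_word \<omega> ` level_set n r)"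
proof (induction m arbitrary: r)
  case (Suc m)
  let ?S = "\<lambda>m. \<Union>j<m. \<Union>\<omega>\<in>(extend {1..<l} ^^ j) T. gauss_word \<omega> ` {1 / (real n + 1)..1 / real l}"
  have "(\<Union>\<omega>\<in>T. gauss_word \<omega> ` level_set n (Suc m + r)) \<subseteq> ?S m
    \<union> (\<Union>\<omega>\<in>(extend {1..<l} ^^ m) T. gauss_word \<omega> ` level_set n (Suc r))"
    using Suc[of "Suc r"] by (simp only: add_Suc add_Suc_right)
  also have "\<dots> \<subseteq> ?S (Suc m) \<union> (\<Union>\<omega>\<in>(extend {1..<l} ^^ Suc m) T. gauss_word \<omega> ` level_set n r)"
  proof (rule Un_least)
    show "?S m \<subseteq> ?S (Suc m) \<union> (\<Union>\<omega>\<in>(extend {1..<l} ^^ Suc m) T. gauss_word \<omega> ` level_set n r)"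
    proof -
      have "?S m \<subseteq> ?S (Suc m)" by (intro UN_mono) auto
      then show ?thesis by (rule le_supI1)
    qed
    show "(\<Union>\<omega>\<in>(extend {1..<l} ^^ m) T. gauss_word \<omega> ` level_set n (Suc r))
      \<subseteq> ?S (Suc m) \<union> (\<Union>\<omega>\<in>(extend {1..<l} ^^ Suc m) T. gauss_word \<omega> ` level_set n r)"
    proof
      fix x assume "x \<in> (\<Union>\<omega>\<in>(extend {1..<l} ^^ m) T. gauss_word \<omega> ` level_set n (Suc r))"
      then obtain \<omega> k z where *: "\<omega> \<in> (extend {1..<l} ^^ m) T" "k \<in> {1..n}" "z \<in> level_set n r"
        "x = gauss_word \<omega> (gauss_branch k z)" unfolding level_set_Suc by blast
      show "x \<in> ?S (Suc m) \<union> (\<Union>\<omega>\<in>(extend {1..<l} ^^ Suc m) T. gauss_word \<omega> ` level_set n r)"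
      proof (cases "k < l")
        case True
        then have "\<omega> @ [k] \<in> extend {1..<l} ((extend {1..<l} ^^ m) T)"
          unfolding extend_def[of _ "(extend {1..<l} ^^ m) T"] using *(1,2) by (intro image_eqI[of _ _ "(\<omega>, k)"]) auto
        then have "\<omega> @ [k] \<in> (extend {1..<l} ^^ Suc m) T" by simp
        moreover have "x = gauss_word (\<omega> @ [k]) z" using * by (simp add: gauss_word_append)
        ultimately show ?thesis using *(3) by (intro UnI2 UN_I[of "\<omega> @ [k]"] image_eqI[of _ _ z])
      next
        case False
        have z: "z \<in> {0..1}" using * level_set_subset by blast
        have "gauss_branch k z \<in> {1 / (real n + 1)..1 / real l}"
          using z *(2) False l by (auto simp: gauss_branch_def intro!: frac_le)
        then have "x \<in> gauss_word \<omega> ` {1 / (real n + 1)..1 / real l}" using *(4) by blast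
        then show ?thesis using *(1) by (intro UnI1 UN_I[of m] UN_I[of \<omega>]) simp_all
      qed
    qed
  qed
  finally show ?case .
qed simp

context conformal_mean_pos begin

lemma transfer_split:
  assumes "1 \<le> l" "l \<le> n"
  shows "transfer s {1..n} f x = transfer s {1..<l} f x + transfer s {l..n} f x"
proof -
  have "{1..n} = {1..<l} \<union> {l..n}" "{1..<l} \<inter> {l..n} = {}" using assms by auto
  then show ?thesis unfolding transfer_def by (subst \<open>{1..n} = _\<close>, subst sum.union_disjoint) auto
qed

text \<open>After a prefix that makes all sets small, words are continued by digits below
  \<open>l\<close> until a digit in \<open>{l..n}\<close> appears; there the image of
  \<open>{1 / (n + 1)..1 / l}\<close> takes over. Conservation of mass bounds the weights: stopping
  at step \<open>j\<close> takes away mass at least \<open>a j 0 * \<beta> / D\<close>, and the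
  total is 1.\<close>

lemma hausdorff_premeasure_le:
  assumes l: "1 \<le> l" "l \<le> n" and \<delta>: "0 < \<delta>"
  defines "\<beta> \<equiv> \<Sum>k=l..n. (real k + 1) powr (- (2 * h))"
    and "len \<equiv> 1 / real l - 1 / (real n + 1)"
  shows "hausdorff_premeasure h \<delta> (gauss_limit_set n) \<le> ennreal (len powr h * ((1 + 1 / real l) powr (2 * h) / \<beta>))"
proof -
  define D where "D = (1 + 1 / real l) powr (2 * h)"
  have l0: "real l \<ge> 1" using l by simp
  have D: "1 \<le> D" unfolding D_def using l0 h_pos by (intro ge_one_powr_ge_zero) auto
  have \<beta>: "\<beta> > 0" unfolding \<beta>_def using l by (intro sum_pos) auto
  have len: "0 \<le> len" "len \<le> 1"
  proof -
    have "1 / (real n + 1) \<le> 1 / real l" "1 / real l \<le> 1" "0 \<le> 1 / (real n + 1)"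
      using l0 l by (auto intro!: frac_le)
    then show "0 \<le> len" "len \<le> 1" unfolding len_def by linarith+
  qed
  define \<theta> where "\<theta> = (real n + 1) / (real n + 2)"
  have \<theta>: "0 < \<theta>" "\<theta> < 1" by (auto simp: \<theta>_def field_simps)
  \<comment> \<open>Prefixes of length \<open>Suc N0\<close> bring all diameters below
    \<open>\<delta>\<close>; the extra digit is the one that does not contribute to the
    decay.\<close>
  obtain N0 where N0: "\<theta> ^ N0 < min \<delta> 1" using real_arch_pow_inv[of "min \<delta> 1" \<theta>] \<theta> \<delta> by auto
  define T0 where "T0 = (extend {1..n} ^^ Suc N0) {[]}"
  define T where "T j = (extend {1..<l} ^^ j) T0" for j
  \<comment> \<open>The sum of \<open>word_weight \<omega> x powr (2 * h)\<close> over
    \<open>T j\<close> as a function of \<open>x\<close>, in a form that shows membership in the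
    cone.\<close>
  define a where "a j = (transfer h {1..<l} ^^ j) ((transfer h {1..n} ^^ Suc N0) (\<lambda>_. 1))" for j
  have K: "{1..<l} \<subseteq> {1..n}" "{1..<l} \<subseteq> {1..}" "{1..n} \<subseteq> {1..}" "{l..n} \<subseteq> {1..}" using l by auto
  have T0: "length \<omega> = 0 + Suc N0 \<and> set \<omega> \<subseteq> {1..n}" if "\<omega> \<in> T0" for \<omega>
    using that unfolding T0_def by (rule extend_iter_words[where K = "{1..n}", rotated 2]) auto
  have T: "length \<omega> = Suc N0 + j \<and> set \<omega> \<subseteq> {1..n}" if "\<omega> \<in> T j" for \<omega> j
    using that T0 K(1) unfolding T_def by (intro extend_iter_words[where T = T0 and K = "{1..<l}"]) auto
  have finT: "finite (T j)" for j unfolding T_def T0_def by (intro finite_extend_iter) auto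
  have wsum: "(\<Sum>\<omega>\<in>T j. word_weight \<omega> 0 powr (2 * h)) = a j 0" for j
  proof -
    have "(\<Sum>\<omega>\<in>T j. word_weight \<omega> 0 powr (2 * h))
      = (transfer h {1..<l} ^^ j) (\<lambda>x. \<Sum>\<omega>\<in>T0. word_weight \<omega> x powr (2 * h)) 0"
      unfolding T_def using T0 K(1) by (intro weight_sum_extend_iter[where l = "Suc N0" and n = n]) auto
    also have "\<dots> = a j 0"
      unfolding a_def
    proof (rule antisym)
      have e: "(\<Sum>\<omega>\<in>T0. word_weight \<omega> x powr (2 * h)) = (transfer h {1..n} ^^ Suc N0) (\<lambda>_. 1) x" if "x \<in> {0..1}" for x
        unfolding T0_def using weight_sum_extend_iter[where T = "{[]}" and l = 0 and n = n and K = "{1..n}" and x = x and m = "Suc N0" and s = h] that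
        by (simp del: funpow.simps)
      show "(transfer h {1..<l} ^^ j) (\<lambda>x. \<Sum>\<omega>\<in>T0. word_weight \<omega> x powr (2 * h)) 0
        \<le> (transfer h {1..<l} ^^ j) ((transfer h {1..n} ^^ Suc N0) (\<lambda>_. 1)) 0"
        by (rule transfer_iter_mono[OF _ K(2)]) (simp_all only: e, simp)
      show "(transfer h {1..<l} ^^ j) ((transfer h {1..n} ^^ Suc N0) (\<lambda>_. 1)) 0
        \<le> (transfer h {1..<l} ^^ j) (\<lambda>x. \<Sum>\<omega>\<in>T0. word_weight \<omega> x powr (2 * h)) 0"
        by (rule transfer_iter_mono[OF _ K(2)]) (simp_all only: e, simp)
    qed
    finally show ?thesis .
  qed
  have cone: "a j \<in> distortion_cone h" for j
    unfolding a_def using h_nonneg K by (intro transfer_iter_distortion_cone distortion_cone_const) auto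
  have ba: "bdd01 (a j)" for j unfolding a_def using K by (intro bdd01_intros)
  have a0: "0 \<le> a j 0" for j by (rule distortion_cone_bounds(1)[OF cone _ h_nonneg]) simp
  have step: "\<Lambda> (a j) = \<Lambda> (a (Suc j)) + \<Lambda> (transfer h {l..n} (a j))" for j
  proof -
    have aS: "a (Suc j) = transfer h {1..<l} (a j)" by (simp add: a_def)
    have "transfer h {1..n} (a j) = (\<lambda>x. a (Suc j) x + transfer h {l..n} (a j) x)"
      unfolding aS by (rule ext) (rule transfer_split[OF l])
    then have "\<Lambda> (a j) = \<Lambda> (\<lambda>x. a (Suc j) x + transfer h {l..n} (a j) x)"
      using mean_transfer[OF ba, of j] by (simp only:)
    also have "\<dots> = \<Lambda> (a (Suc j)) + \<Lambda> (transfer h {l..n} (a j))"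
      by (rule mean_add[OF ba bdd01_transfer[OF ba K(4)]])
    finally show ?thesis .
  qed
  \<comment> \<open>Digits from \<open>l\<close> on send \<open>x\<close> into
    \<open>{0..1 / l}\<close>, where the cone condition costs only \<open>D\<close>; this is the
    advantage of a covering interval near 0.\<close>
  have lower: "a j 0 / D * \<beta> \<le> \<Lambda> (transfer h {l..n} (a j))" for j
  proof (rule mean_ge_const[OF bdd01_transfer[OF ba K(4)]])
    fix x :: real assume x: "x \<in> {0..1}"
    have "a j 0 / D * \<beta> = (\<Sum>k=l..n. (real k + 1) powr (- (2 * h)) * (a j 0 / D))"
      unfolding \<beta>_def by (subst mult.commute) (rule sum_distrib_right)
    also have "\<dots> \<le> transfer h {l..n} (a j) x"
      unfolding transfer_def
    proof (rule sum_mono, rule mult_mono)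
      fix k assume k: "k \<in> {l..n}"
      show "(real k + 1) powr (- (2 * h)) \<le> (x + real k) powr (- (2 * h))"
        using x k l h_nonneg by (intro powr_mono2') auto
      have g: "gauss_branch k x \<in> {0..1}" using x k l by (intro gauss_branch_in) auto
      have "gauss_branch k x \<le> 1 / real l" using x k l by (auto simp: gauss_branch_def intro!: frac_le)
      then have "(1 + gauss_branch k x) powr (2 * h) \<le> D"
        unfolding D_def using g h_nonneg by (intro powr_mono2) auto
      then have "(1 + gauss_branch k x) powr (2 * h) * a j (gauss_branch k x) \<le> D * a j (gauss_branch k x)"
        using distortion_cone_bounds(1)[OF cone g h_nonneg] by (rule mult_right_mono)
      then have "a j 0 \<le> D * a j (gauss_branch k x)"
        using distortion_cone_bounds(3)[OF cone g h_nonneg] by (rule order_trans[rotated])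
      then show "a j 0 / D \<le> a j (gauss_branch k x)" using D by (simp add: field_simps)
    qed (use a0 D in auto)
    finally show "a j 0 / D * \<beta> \<le> transfer h {l..n} (a j) x" .
  qed
  have total: "(\<Sum>j<N. \<Lambda> (transfer h {l..n} (a j))) + \<Lambda> (a N) = 1" for N
  proof (induction N)
    case 0
    have "\<Lambda> ((transfer h {1..n} ^^ m) (\<lambda>_. 1)) = 1" for m
      by (induction m) (simp_all add: mean_one mean_transfer bdd01_transfer_iter bdd01_const K)
    then have "\<Lambda> (a 0) = 1" unfolding a_def by (simp only: funpow_0)
    then show ?case by simp
  next
    case (Suc N)
    have "(\<Sum>j<Suc N. \<Lambda> (transfer h {l..n} (a j))) = (\<Sum>j<N. \<Lambda> (transfer h {l..n} (a j))) + \<Lambda> (transfer h {l..n} (a N))"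
      by (rule sum.lessThan_Suc)
    then show ?case using Suc step[of N] by linarith
  qed
  have sum_le: "(\<Sum>j<N. a j 0) \<le> D / \<beta>" for N
  proof -
    have "(\<Sum>j<N. a j 0) / D * \<beta> = (\<Sum>j<N. a j 0 / D * \<beta>)"
      by (simp add: sum_divide_distrib sum_distrib_right)
    also have "\<dots> \<le> (\<Sum>j<N. \<Lambda> (transfer h {l..n} (a j)))" using lower by (intro sum_mono) auto
    also have "\<dots> \<le> 1" using total[of N] mean_nonneg[OF ba] distortion_cone_bounds(1)[OF cone _ h_nonneg] by (smt (verit))
    finally show ?thesis using D \<beta> by (simp add: field_simps)
  qed
  \<comment> \<open>Hence \<open>a N 0\<close> tends to 0: the words not yet stopped after
    \<open>N\<close> steps, covered by images of all of \<open>{0..1}\<close>, become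
    negligible.\<close>
  have "summable (\<lambda>j. a j 0)"
    using a0 sum_le by (intro summableI_nonneg_bounded) auto
  then have lim: "(\<lambda>j. a j 0) \<longlonglongrightarrow> 0" by (rule summable_LIMSEQ_zero)
  show ?thesis
  proof (rule ennreal_le_epsilon)
    fix e :: real assume "e > 0"
    then obtain N where N: "a N 0 < e"
      using order_tendstoD(2)[OF lim] by (auto simp: eventually_sequentially)
    define I where "I = (SIGMA j:{..N}. T j)"
    define F where "F j = (if j < N then {1 / (real n + 1)..1 / real l} else {0..1})" for j
    define c where "c j = (if j < N then len else 1)" for j
    have c01: "0 \<le> c j" "c j \<le> 1" for j using len by (auto simp: c_def)
    have F01: "F j \<subseteq> {0..1}" for j
      using l0 by (auto simp: F_def intro: order_trans[of 0 "1 / (real n + 1)"] order_trans[of _ "1 / real l"])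
    have Fc: "\<bar>x - y\<bar> \<le> c j" if "x \<in> F j" "y \<in> F j" for x y j
      using that by (auto simp: F_def c_def len_def split: if_splits)
    have I: "finite I" unfolding I_def using finT by (intro finite_SigmaI) auto
    have wpos: "0 < word_weight \<omega> x" if "\<omega> \<in> T j" "x \<in> {0..1}" for \<omega> j x
      using T[OF that(1)] that(2) by (intro word_weight_pos[of _ n]) auto
    have dist: "dist (gauss_word \<omega> x) (gauss_word \<omega> y) \<le> c j * (word_weight \<omega> 0)^2"
      if w: "\<omega> \<in> T j" and xy: "x \<in> F j" "y \<in> F j" for \<omega> j x y
    proof -
      have x01: "x \<in> {0..1}" "y \<in> {0..1}" using xy F01[of j] by blast+
      have s: "set \<omega> \<subseteq> {1..n}" using T[OF w] by simp
      have "dist (gauss_word \<omega> x) (gauss_word \<omega> y) = \<bar>x - y\<bar> * (word_weight \<omega> x * word_weight \<omega> y)"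
        unfolding dist_real_def by (rule gauss_word_dist[OF s x01])
      also have "\<dots> \<le> c j * (word_weight \<omega> 0 * word_weight \<omega> 0)"
      proof (intro mult_mono Fc xy word_weight_antimono[OF s] x01)
        show "0 \<le> word_weight \<omega> y" "0 \<le> word_weight \<omega> x * word_weight \<omega> y" "0 \<le> word_weight \<omega> 0"
          using wpos[OF w x01(1)] wpos[OF w x01(2)] wpos[OF w, of 0] by auto
      qed (rule c01)
      finally show ?thesis by (simp add: power2_eq_square)
    qed
    have small: "c j * (word_weight \<omega> 0)^2 \<le> \<delta>" if w: "\<omega> \<in> T j" for \<omega> j
    proof -
      have "word_weight \<omega> 0 \<le> \<theta> ^ (length \<omega> - 1)"
        unfolding \<theta>_def using T[OF w] by (intro word_weight_decay) auto
      also have "\<dots> \<le> \<theta> ^ N0" using \<theta> T[OF w] by (intro power_decreasing) auto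
      finally have ww: "word_weight \<omega> 0 \<le> min \<delta> 1" using N0 by simp
      have "c j * (word_weight \<omega> 0)^2 \<le> 1 * (word_weight \<omega> 0 * 1)"
        unfolding power2_eq_square using c01 wpos[OF w, of 0] ww by (intro mult_mono) auto
      then show ?thesis using ww by simp
    qed
    have "gauss_limit_set n \<subseteq> level_set n (Suc N0 + (N + 0))"
      unfolding gauss_limit_set_eq by (rule INT_lower) simp
    also have "\<dots> = (\<Union>\<omega>\<in>T0. gauss_word \<omega> ` level_set n (N + 0))" unfolding T0_def by (rule level_set_words)
    also have "\<dots> \<subseteq> (\<Union>j<N. \<Union>\<omega>\<in>T j. gauss_word \<omega> ` {1 / (real n + 1)..1 / real l})
        \<union> (\<Union>\<omega>\<in>T N. gauss_word \<omega> ` level_set n 0)"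
      unfolding T_def by (rule level_set_stopping_cover[OF l(1)])
    also have "\<dots> \<subseteq> (\<Union>i\<in>I. gauss_word (snd i) ` F (fst i))"
    proof (rule Un_least)
      show "(\<Union>j<N. \<Union>\<omega>\<in>T j. gauss_word \<omega> ` {1 / (real n + 1)..1 / real l}) \<subseteq> (\<Union>i\<in>I. gauss_word (snd i) ` F (fst i))"
      proof (intro UN_least)
        fix j \<omega> assume "j \<in> {..<N}" "\<omega> \<in> T j"
        then have "(j, \<omega>) \<in> I" "F j = {1 / (real n + 1)..1 / real l}" by (auto simp: I_def F_def)
        then show "gauss_word \<omega> ` {1 / (real n + 1)..1 / real l} \<subseteq> (\<Union>i\<in>I. gauss_word (snd i) ` F (fst i))"
          using UN_upper[of "(j, \<omega>)" I "\<lambda>i. gauss_word (snd i) ` F (fst i)"] by simp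
      qed
      show "(\<Union>\<omega>\<in>T N. gauss_word \<omega> ` level_set n 0) \<subseteq> (\<Union>i\<in>I. gauss_word (snd i) ` F (fst i))"
      proof (intro UN_least)
        fix \<omega> assume "\<omega> \<in> T N"
        then have "(N, \<omega>) \<in> I" "F N = {0..1}" by (auto simp: I_def F_def)
        then show "gauss_word \<omega> ` level_set n 0 \<subseteq> (\<Union>i\<in>I. gauss_word (snd i) ` F (fst i))"
          using UN_upper[of "(N, \<omega>)" I "\<lambda>i. gauss_word (snd i) ` F (fst i)"] by simp
      qed
    qed
    finally have cov: "gauss_limit_set n \<subseteq> (\<Union>i\<in>I. gauss_word (snd i) ` F (fst i))" .
    have "hausdorff_premeasure h \<delta> (gauss_limit_set n)
      \<le> ennreal (\<Sum>i\<in>I. (c (fst i) * (word_weight (snd i) 0)^2) powr h)"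
    proof (rule hausdorff_premeasure_finite_cover[OF I cov])
      fix i assume i: "i \<in> I"
      then have w: "snd i \<in> T (fst i)" by (auto simp: I_def)
      show "diameter (gauss_word (snd i) ` F (fst i)) \<le> c (fst i) * (word_weight (snd i) 0)^2"
      proof (rule diameter_le)
        fix x y assume "x \<in> gauss_word (snd i) ` F (fst i)" "y \<in> gauss_word (snd i) ` F (fst i)"
        then obtain x' y' where "x' \<in> F (fst i)" "y' \<in> F (fst i)" "x = gauss_word (snd i) x'" "y = gauss_word (snd i) y'"
          by blast
        then show "norm (x - y) \<le> c (fst i) * (word_weight (snd i) 0)^2"
          using dist[OF w] by (simp add: dist_norm)
      qed (use c01 in simp)
      show "bounded (gauss_word (snd i) ` F (fst i))"
      proof (rule bounded_subset[OF bounded_closed_interval])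
        show "gauss_word (snd i) ` F (fst i) \<subseteq> {0..1}"
          using gauss_word_in[of "snd i" n] T[OF w] F01[of "fst i"] by (intro image_subsetI) blast
      qed
      show "c (fst i) * (word_weight (snd i) 0)^2 \<le> \<delta>" by (rule small[OF w])
    qed (use \<delta> h_pos in auto)
    also have "(\<Sum>i\<in>I. (c (fst i) * (word_weight (snd i) 0)^2) powr h) = (\<Sum>j\<le>N. c j powr h * a j 0)"
    proof -
      have "(\<Sum>i\<in>I. (c (fst i) * (word_weight (snd i) 0)^2) powr h)
        = (\<Sum>j\<le>N. \<Sum>\<omega>\<in>T j. (c j * (word_weight \<omega> 0)^2) powr h)"
        unfolding I_def using finT by (subst sum.Sigma) (auto intro!: sum.cong)
      also have "\<dots> = (\<Sum>j\<le>N. c j powr h * a j 0)"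
      proof (rule sum.cong[OF refl])
        fix j
        have "(c j * (word_weight \<omega> 0)^2) powr h = c j powr h * word_weight \<omega> 0 powr (2 * h)" if "\<omega> \<in> T j" for \<omega>
        proof -
          have "((word_weight \<omega> 0)^2) powr h = word_weight \<omega> 0 powr (2 * h)"
            using wpos[OF that, of 0] by (simp add: powr_powr flip: powr_numeral)
          then show ?thesis by (simp add: powr_mult)
        qed
        then have "(\<Sum>\<omega>\<in>T j. (c j * (word_weight \<omega> 0)^2) powr h) = (\<Sum>\<omega>\<in>T j. c j powr h * word_weight \<omega> 0 powr (2 * h))"
          by (intro sum.cong) auto
        then show "(\<Sum>\<omega>\<in>T j. (c j * (word_weight \<omega> 0)^2) powr h) = c j powr h * a j 0"
          by (simp add: wsum flip: sum_distrib_left)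
      qed
      finally show ?thesis .
    qed
    also have "(\<Sum>j\<le>N. c j powr h * a j 0) = len powr h * (\<Sum>j<N. a j 0) + a N 0"
    proof -
      have "{..N} = insert N {..<N}" by auto
      moreover have "(\<Sum>j<N. c j powr h * a j 0) = len powr h * (\<Sum>j<N. a j 0)"
        by (simp add: c_def sum_distrib_left)
      ultimately show ?thesis by (simp add: c_def)
    qed
    also have "\<dots> \<le> len powr h * (D / \<beta>) + e"
      using sum_le[of N] N by (intro add_mono mult_left_mono) auto
    finally have "hausdorff_premeasure h \<delta> (gauss_limit_set n) \<le> ennreal (len powr h * (D / \<beta>) + e)"
      by (simp add: ennreal_leI)
    also have "\<dots> = ennreal (len powr h * (D / \<beta>)) + ennreal e"
      using D \<beta> \<open>e > 0\<close> by (intro ennreal_plus) auto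
    finally show "hausdorff_premeasure h \<delta> (gauss_limit_set n)
      \<le> ennreal (len powr h * ((1 + 1 / real l) powr (2 * h) / \<beta>)) + ennreal e" by (simp add: D_def)
  qed
qed

text \<open>Positive and finite \<open>h\<close>-measure identifies \<open>h\<close> with the
  dimension, whichever conformal mean was chosen. Finiteness also justifies
  \<open>enn2real\<close>.\<close>

theorem gauss_dim_measure:
  assumes l: "1 \<le> l" "l \<le> n"
  shows "gauss_dim n = h" and "1 / Cmass \<le> gauss_measure n"
    and "gauss_measure n \<le> (1 / real l - 1 / (real n + 1)) powr h
      * ((1 + 1 / real l) powr (2 * h) / (\<Sum>k=l..n. (real k + 1) powr (- (2 * h))))"
proof -
  define B where "B = (1 / real l - 1 / (real n + 1)) powr h
      * ((1 + 1 / real l) powr (2 * h) / (\<Sum>k=l..n. (real k + 1) powr (- (2 * h))))"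
  have B0: "0 \<le> B" unfolding B_def by (intro mult_nonneg_nonneg divide_nonneg_nonneg sum_nonneg) auto
  have up: "hausdorff_measure h (gauss_limit_set n) \<le> ennreal B"
    unfolding hausdorff_measure_eq_SUP B_def using l by (intro SUP_least hausdorff_premeasure_le) auto
  have "hausdorff_premeasure h 1 (gauss_limit_set n) \<le> hausdorff_measure h (gauss_limit_set n)"
    unfolding hausdorff_measure_eq_SUP by (intro SUP_upper) auto
  then have lo: "ennreal (1 / Cmass) \<le> hausdorff_measure h (gauss_limit_set n)"
    using hausdorff_premeasure_ge by (rule order_trans[rotated])
  have C0: "0 < 1 / Cmass" using Cmass_pos by simp
  have "hausdorff_dim (gauss_limit_set n) = ennreal h"
  proof (rule hausdorff_dim_eqI[OF h_pos])
    have "0 < ennreal (1 / Cmass)" using C0 by simp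
    then show "0 < hausdorff_measure h (gauss_limit_set n)" using lo by (rule less_le_trans)
    show "hausdorff_measure h (gauss_limit_set n) < top" using up by (rule le_less_trans) simp
  qed
  then show d: "gauss_dim n = h" unfolding gauss_dim_def using h_nonneg by simp
  show "1 / Cmass \<le> gauss_measure n"
    unfolding gauss_measure_def d using enn2real_mono[OF lo] up C0
    by (simp add: le_less_trans[OF up])
  show "gauss_measure n \<le> (1 / real l - 1 / (real n + 1)) powr h
      * ((1 + 1 / real l) powr (2 * h) / (\<Sum>k=l..n. (real k + 1) powr (- (2 * h))))"
    unfolding gauss_measure_def d B_def[symmetric] using enn2real_mono[OF up] B0 by simp
qed

end

subsection \<open>Asymptotics\<close>


definition gauss_kernel :: "real \<Rightarrow> real" where
  "gauss_kernel u = ln u / (u * (u + 1))"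

definition kernel_integral :: "real \<Rightarrow> real" where
  "kernel_integral x = integral {1..x} gauss_kernel"

lemma continuous_gauss_kernel: "a > 0 \<Longrightarrow> continuous_on {a..b} gauss_kernel"
  unfolding gauss_kernel_def by (intro continuous_intros) auto

lemma kernel_integral_deriv:
  assumes "1 \<le> x" "x \<le> b"
  shows "(kernel_integral has_real_derivative gauss_kernel x) (at x within {1..b})"
  unfolding kernel_integral_def using assms continuous_gauss_kernel[of 1 b]
  by (intro integral_has_real_derivative) auto

definition gauss_kernel_deriv :: "real \<Rightarrow> real" where
  "gauss_kernel_deriv u = (1 / u * (u * (u + 1)) - ln u * (2 * u + 1)) / (u * (u + 1))^2"

lemma gauss_kernel_deriv:
  assumes "u \<ge> 1"
  shows "(gauss_kernel has_real_derivative gauss_kernel_deriv u) (at u)" "\<bar>gauss_kernel_deriv u\<bar> \<le> 2 / u^2"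
proof -
  have "u + u * u > 0" using assms by (intro add_pos_pos) auto
  then show "(gauss_kernel has_real_derivative gauss_kernel_deriv u) (at u)"
    unfolding gauss_kernel_def gauss_kernel_deriv_def using assms
    by (auto intro!: derivative_eq_intros simp: power2_eq_square algebra_simps)
  show "\<bar>gauss_kernel_deriv u\<bar> \<le> 2 / u^2"
  proof -
    have l: "0 \<le> ln u" "ln u \<le> u - 1" using assms ln_le_minus_one[of u] by auto
    have "1 / u * (u * (u + 1)) - ln u * (2 * u + 1) = (u + 1) - ln u * (2 * u + 1)" using assms by simp
    moreover have "ln u * (2 * u + 1) \<le> (u - 1) * (2 * u + 1)" "0 \<le> ln u * (2 * u + 1)"
      using l assms by (auto intro: mult_right_mono)
    moreover have "(u - 1) * (2 * u + 1) \<le> 2 * (u + 1)^2" "u + 1 \<le> 2 * (u + 1)^2"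
      using assms by (simp_all add: power2_eq_square algebra_simps)
    ultimately have "\<bar>1 / u * (u * (u + 1)) - ln u * (2 * u + 1)\<bar> \<le> 2 * (u + 1)^2"
      using assms by linarith
    then have "\<bar>gauss_kernel_deriv u\<bar> \<le> 2 * (u + 1)^2 / (u * (u + 1))^2"
      unfolding gauss_kernel_deriv_def abs_divide by (simp add: divide_right_mono)
    also have "\<dots> = 2 / u^2" using assms by (simp add: power_mult_distrib)
    finally show ?thesis .
  qed
qed

text \<open>The decay \<open>1 / c^2\<close> makes the sum of the shifted kernels over all digits
  Lipschitz uniformly in \<open>n\<close>.\<close>

lemma gauss_kernel_lipschitz:
  assumes k: "c \<ge> 1" and xy: "c \<le> x" "c \<le> y"
  shows "\<bar>gauss_kernel x - gauss_kernel y\<bar> \<le> 2 / c^2 * \<bar>x - y\<bar>"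
proof -
  have main: "\<bar>gauss_kernel y - gauss_kernel x\<bar> \<le> 2 / c^2 * (y - x)" if c: "c \<le> x" "x < y" for x y
  proof -
    obtain z where z: "x < z" "z < y" "gauss_kernel y - gauss_kernel x = (y - x) * gauss_kernel_deriv z"
    proof -
      have "(gauss_kernel has_real_derivative gauss_kernel_deriv u) (at u)" if "x \<le> u" for u
        using that k c by (intro gauss_kernel_deriv) simp
      then show ?thesis using MVT2[of x y gauss_kernel gauss_kernel_deriv] c that by auto
    qed
    define d where "d = gauss_kernel_deriv z"
    have "\<bar>d\<bar> \<le> 2 / z^2" unfolding d_def using k z c by (intro gauss_kernel_deriv) simp
    also have "\<dots> \<le> 2 / c^2" using k z \<open>c \<le> x\<close> by (intro divide_left_mono power_mono) auto
    finally have "(y - x) * \<bar>d\<bar> \<le> (y - x) * (2 / c^2)" using \<open>x < y\<close> by (intro mult_left_mono) auto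
    then show ?thesis using \<open>x < y\<close> unfolding z(3) d_def[symmetric] abs_mult by (simp add: mult.commute)
  qed
  consider "x < y" | "x = y" | "y < x" by linarith
  then show ?thesis
    using main[of x y] main[of y x] xy by cases (simp_all add: abs_minus_commute)
qed

lemma sum_inverse_squares_le: "(\<Sum>k=1..n. 1 / (real k)^2) \<le> 2"
proof -
  have "(\<Sum>k=1..n. 1 / (real k)^2) \<le> 2 - 1 / real n" if "n \<ge> 1" for n
    using that
  proof (induction n rule: dec_induct)
    case (step n)
    have "1 / (real (Suc n))^2 \<le> 1 / (real n * real (Suc n))"
      using step by (intro divide_left_mono) (auto simp: power2_eq_square)
    also have "\<dots> = 1 / real n - 1 / real (Suc n)" using step by (simp add: field_simps)
    finally show ?case using step by simp
  qed simp
  then show ?thesis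
  proof (cases "n = 0")
    case False
    have "0 \<le> 1 / real n" by simp
    then show ?thesis using False \<open>\<And>n. n \<ge> 1 \<Longrightarrow> (\<Sum>k=1..n. 1 / (real k)^2) \<le> 2 - 1 / real n\<close>[of n] by linarith
  qed simp
qed

lemma integral_gauss_kernel_shift:
  "((\<lambda>y. \<Sum>k=1..n. gauss_kernel (real k + y)) has_integral kernel_integral (real n + 1)) {0..1}"
proof -
  have "((\<lambda>y. gauss_kernel (real k + y)) has_integral kernel_integral (real k + 1) - kernel_integral (real k + 0)) {0..1}"
    if k: "k \<in> {1..n}" for k
  proof (rule fundamental_theorem_of_calculus)
    fix y :: real assume y: "y \<in> {0..1}"
    have im: "(\<lambda>y. real k + y) ` {0..1} \<subseteq> {1..real k + 1}" using k by auto
    have "(kernel_integral has_real_derivative gauss_kernel (real k + y)) (at (real k + y) within {1..real k + 1})"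
      using y k by (intro kernel_integral_deriv) auto
    then have "(kernel_integral has_real_derivative gauss_kernel (real k + y)) (at (real k + y) within (\<lambda>y. real k + y) ` {0..1})"
      by (rule DERIV_subset[OF _ im])
    then have "((kernel_integral \<circ> (\<lambda>y. real k + y)) has_real_derivative gauss_kernel (real k + y) * 1) (at y within {0..1})"
      by (rule DERIV_image_chain) (auto intro!: derivative_eq_intros)
    then show "((\<lambda>y. kernel_integral (real k + y)) has_vector_derivative gauss_kernel (real k + y)) (at y within {0..1})"
      by (simp add: has_real_derivative_iff_has_vector_derivative comp_def)
  qed simp
  then have "((\<lambda>y. \<Sum>k=1..n. gauss_kernel (real k + y)) has_integral
      (\<Sum>k=1..n. kernel_integral (real k + 1) - kernel_integral (real k + 0))) {0..1}"
    by (intro has_integral_sum) auto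
  also have "(\<Sum>k=1..n. kernel_integral (real k + 1) - kernel_integral (real k + 0)) = kernel_integral (real n + 1)"
  proof (induction n)
    case 0
    then show ?case by (simp add: kernel_integral_def)
  qed (simp add: add.commute)
  finally show ?thesis .
qed

lemma log_power_has_integral:
  assumes m: "m \<ge> 1" and X: "X \<ge> 1"
  shows "((\<lambda>u. ln u / u ^ (m + 1)) has_integral 1 / (real m)^2 - (real m * ln X + 1) / ((real m)^2 * X ^ m)) {1..X}"
proof -
  let ?G = "\<lambda>u. - ((real m * ln u + 1) / ((real m)^2 * u ^ m))"
  have "((\<lambda>u. ln u / u ^ (m + 1)) has_integral ?G X - ?G 1) {1..X}"
  proof (rule fundamental_theorem_of_calculus[OF X])
    fix u assume "u \<in> {1..X}"
    then have u: "u > 0" by simp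
    obtain p where p: "m = Suc p" using m by (cases m) auto
    have "(?G has_real_derivative - ((real m * (1 / u) * ((real m)^2 * u ^ m)
        - (real m * ln u + 1) * ((real m)^2 * (real m * u ^ (m - 1)))) / ((real m)^2 * u ^ m)^2)) (at u within {1..X})"
      using u m by (auto intro!: derivative_eq_intros simp: power2_eq_square One_nat_def)
    also have "- ((real m * (1 / u) * ((real m)^2 * u ^ m)
        - (real m * ln u + 1) * ((real m)^2 * (real m * u ^ (m - 1)))) / ((real m)^2 * u ^ m)^2) = ln u / u ^ (m + 1)"
    proof -
      define v where "v = u ^ (m - 1)"
      have v: "v > 0" using u by (simp add: v_def)
      have e: "u ^ m = u * v" "u ^ (m + 1) = u * u * v" unfolding v_def p by (simp_all add: power_add)
      have M: "real m > 0" using m by simp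
      show ?thesis unfolding v_def[symmetric] e using u v M by (simp add: field_simps power2_eq_square)
    qed
    finally show "(?G has_vector_derivative ln u / u ^ (m + 1)) (at u within {1..X})"
      by (simp add: has_real_derivative_iff_has_vector_derivative)
  qed
  then show ?thesis by simp
qed

text \<open>A finite geometric expansion of \<open>1 / (u * (u + 1))\<close> in powers of
  \<open>1 / u\<close>; the explicit remainder avoids exchanging a series with the integral.\<close>

lemma gauss_kernel_expansion:
  assumes "u \<ge> 1"
  shows "\<bar>gauss_kernel u - (\<Sum>m=1..M. (-1) ^ (m + 1) * (ln u / u ^ (m + 1)))\<bar> \<le> ln u / u ^ (M + 1 + 1)"
proof -
  have u: "u > 0" using assms by simp
  have "gauss_kernel u - (\<Sum>m=1..M. (-1) ^ (m + 1) * (ln u / u ^ (m + 1))) = (-1) ^ M * ln u / (u ^ (M + 1) * (u + 1))"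
  proof (induction M)
    case (Suc M)
    have "(-1) ^ M * ln u / (u ^ (M + 1) * (u + 1)) - (-1) ^ (Suc M + 1) * (ln u / u ^ (Suc M + 1))
       = (-1) ^ Suc M * ln u / (u ^ (Suc M + 1) * (u + 1))"
    proof -
      define w where "w = u ^ M"
      define s :: real where "s = (-1) ^ M"
      have w: "w > 0" using u by (simp add: w_def)
      have e: "u ^ (M + 1) = u * w" "u ^ (Suc M + 1) = u * u * w" "(-1) ^ (Suc M + 1) = s" "(-1) ^ Suc M = - s"
        by (simp_all add: w_def s_def power_add)
      have "1 / (u * w * (u + 1)) - 1 / (u * u * w) = - (1 / (u * u * w * (u + 1)))"
        using u w by (simp add: divide_simps)
      then have "s * ln u * (1 / (u * w * (u + 1)) - 1 / (u * u * w)) = s * ln u * (- (1 / (u * u * w * (u + 1))))"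
        by (simp only:)
      then show ?thesis unfolding e s_def[symmetric] by (simp add: right_diff_distrib)
    qed
    then show ?case using Suc by simp
  qed (simp add: gauss_kernel_def)
  also have "\<bar>\<dots>\<bar> = ln u / (u ^ (M + 1) * (u + 1))" using assms by (simp add: abs_mult power_abs)
  also have "\<dots> \<le> ln u / (u ^ (M + 1) * u)" using assms by (intro divide_left_mono mult_left_mono) auto
  also have "u ^ (M + 1) * u = u ^ (M + 1 + 1)" by (simp only: power_add power_one_right)
  finally show ?thesis .
qed

text \<open>Over the half-line \<open>ln u / u ^ (m + 1)\<close> integrates to
  \<open>1 / m^2\<close>; each tail \<open>R m\<close> beyond \<open>X\<close> is at most
  \<open>(ln X + 1) / X\<close>.\<close>

lemma kernel_integral_expansion:
  assumes X: "X \<ge> 1"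
  shows "\<bar>kernel_integral X - (\<Sum>m=1..M. (-1) ^ (m + 1) / (real m)^2)\<bar>
    \<le> 1 / (real M + 1)^2 + real M * ((ln X + 1) / X)"
proof -
  define R where "R m = (real m * ln X + 1) / ((real m)^2 * X ^ m)" for m
  have lnX: "0 \<le> ln X" using X by simp
  have R: "0 \<le> R m \<and> R m \<le> (ln X + 1) / X" if m: "m \<ge> 1" for m
  proof -
    have "R m = (ln X / real m + 1 / (real m)^2) / X ^ m" using m by (simp add: R_def power2_eq_square field_simps)
    also have "\<dots> \<le> (ln X + 1) / X"
    proof (intro frac_le add_mono)
      show "ln X / real m \<le> ln X" using lnX m by (simp add: divide_le_eq mult_le_cancel_left1)
      have "1 \<le> (real m)^2" using m by (intro one_le_power) simp
      then show "1 / (real m)^2 \<le> 1" using frac_le[of 1 1 1 "(real m)^2"] by simp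
      show "X \<le> X ^ m" using X m by (intro self_le_power) auto
    qed (use X lnX in auto)
    finally show ?thesis using lnX X by (auto simp: R_def)
  qed
  have g: "(gauss_kernel has_integral kernel_integral X) {1..X}"
    unfolding kernel_integral_def
    by (intro integrable_integral integrable_continuous_interval continuous_gauss_kernel) simp
  have s: "((\<lambda>u. \<Sum>m=1..M. (-1) ^ (m + 1) * (ln u / u ^ (m + 1))) has_integral
      (\<Sum>m=1..M. (-1) ^ (m + 1) * (1 / (real m)^2 - R m))) {1..X}"
    unfolding R_def using X by (intro has_integral_sum has_integral_mult_right log_power_has_integral) auto
  have t: "((\<lambda>u. ln u / u ^ (M + 1 + 1)) has_integral 1 / (real (M + 1))^2 - R (M + 1)) {1..X}"
    unfolding R_def using X by (intro log_power_has_integral) auto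
  have d: "((\<lambda>u. gauss_kernel u - (\<Sum>m=1..M. (-1) ^ (m + 1) * (ln u / u ^ (m + 1)))) has_integral
      kernel_integral X - (\<Sum>m=1..M. (-1) ^ (m + 1) * (1 / (real m)^2 - R m))) {1..X}"
    using g s by (rule has_integral_diff)
  have "norm (integral {1..X} (\<lambda>u. gauss_kernel u - (\<Sum>m=1..M. (-1) ^ (m + 1) * (ln u / u ^ (m + 1)))))
      \<le> integral {1..X} (\<lambda>u. ln u / u ^ (M + 1 + 1))"
  proof (rule integral_norm_bound_integral)
    show "(\<lambda>u. gauss_kernel u - (\<Sum>m=1..M. (-1) ^ (m + 1) * (ln u / u ^ (m + 1)))) integrable_on {1..X}"
      using d by (rule has_integral_integrable)
    show "(\<lambda>u. ln u / u ^ (M + 1 + 1)) integrable_on {1..X}" using t by (rule has_integral_integrable)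
    fix u assume "u \<in> {1..X}"
    then show "norm (gauss_kernel u - (\<Sum>m=1..M. (-1) ^ (m + 1) * (ln u / u ^ (m + 1)))) \<le> ln u / u ^ (M + 1 + 1)"
      unfolding real_norm_def by (intro gauss_kernel_expansion) simp
  qed
  then have 1: "\<bar>kernel_integral X - (\<Sum>m=1..M. (-1) ^ (m + 1) * (1 / (real m)^2 - R m))\<bar> \<le> 1 / (real M + 1)^2"
    unfolding integral_unique[OF d] integral_unique[OF t] using R[of "M + 1"] by (simp add: add.commute)
  have "(\<Sum>m=1..M. (-1) ^ (m + 1) / (real m)^2) - (\<Sum>m=1..M. (-1) ^ (m + 1) * (1 / (real m)^2 - R m))
      = (\<Sum>m=1..M. (-1) ^ (m + 1) * R m)"
    unfolding sum_subtractf[symmetric] by (intro sum.cong) (auto simp: algebra_simps)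
  also have "\<bar>\<dots>\<bar> \<le> (\<Sum>m=1..M. (ln X + 1) / X)"
    using R by (intro order_trans[OF sum_abs] sum_mono) (auto simp: abs_mult power_abs)
  also have "\<dots> = real M * ((ln X + 1) / X)" by simp
  finally show ?thesis using 1 by linarith
qed

text \<open>The even terms add up to \<open>S N / 4\<close> and have to be subtracted twice from
  \<open>S (2 * N)\<close>.\<close>

lemma alternating_inverse_squares:
  "(\<lambda>N. \<Sum>m=1..2 * N. (-1) ^ (m + 1) / (real m)^2) \<longlonglongrightarrow> pi^2 / 12"
proof -
  define S where "S N = (\<Sum>m<N. 1 / (real m + 1)^2)" for N
  have S: "S \<longlonglongrightarrow> pi^2 / 6" using inverse_squares_sums unfolding S_def sums_def by (simp add: add.commute)
  have eq: "(\<Sum>m=1..2 * N. (-1) ^ (m + 1) / (real m)^2) = S (2 * N) - S N / 2" for N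
  proof (induction N)
    case (Suc N)
    have a: "2 * Suc N = Suc (Suc (2 * N))" by simp
    have "(\<Sum>m=1..2 * Suc N. (-1) ^ (m + 1) / (real m)^2)
        = (\<Sum>m=1..2 * N. (-1) ^ (m + 1) / (real m)^2) + 1 / (2 * real N + 1)^2 - 1 / (2 * real N + 2)^2"
      unfolding a by (simp add: add.commute)
    moreover have "S (2 * Suc N) = S (2 * N) + 1 / (2 * real N + 1)^2 + 1 / (2 * real N + 2)^2"
      unfolding a S_def by (simp add: add.assoc)
    moreover have "S (Suc N) / 2 = S N / 2 + 2 * (1 / (2 * real N + 2)^2)"
    proof -
      have "(2 * real N + 2)^2 = 4 * (real N + 1)^2" by (simp add: power2_eq_square algebra_simps)
      then show ?thesis by (simp add: S_def add_divide_distrib)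
    qed
    ultimately show ?case using Suc by linarith
  qed (simp add: S_def)
  have "(\<lambda>N. S (2 * N)) \<longlonglongrightarrow> pi^2 / 6"
    using LIMSEQ_subseq_LIMSEQ[OF S, of "\<lambda>N. 2 * N"] by (simp add: strict_mono_def comp_def)
  then have "(\<lambda>N. S (2 * N) - S N / 2) \<longlonglongrightarrow> pi^2 / 6 - pi^2 / 6 / 2" using S by (intro tendsto_intros) auto
  then show ?thesis by (simp add: eq)
qed

lemma kernel_integral_tendsto: "(\<lambda>n. kernel_integral (real n + 1)) \<longlonglongrightarrow> pi^2 / 12"
proof (rule LIMSEQ_I)
  fix r :: real assume r: "r > 0"
  have sq: "(\<lambda>N. 1 / (real (2 * N) + 1)^2) \<longlonglongrightarrow> 0"
  proof (rule tendsto_sandwich[OF _ _ tendsto_const LIMSEQ_inverse_real_of_nat])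
    show "\<forall>\<^sub>F N in sequentially. 1 / (real (2 * N) + 1)^2 \<le> inverse (real (Suc N))"
    proof (intro always_eventually allI)
      fix N
      have "real (Suc N) * 1 \<le> (real (2 * N) + 1) * (real (2 * N) + 1)" by (intro mult_mono) auto
      then show "1 / (real (2 * N) + 1)^2 \<le> inverse (real (Suc N))"
        unfolding inverse_eq_divide power2_eq_square by (intro frac_le) auto
    qed
  qed simp
  have "\<forall>\<^sub>F N in sequentially. 1 / (real (2 * N) + 1)^2 < r / 3" using sq r by (intro order_tendstoD) auto
  moreover have "\<forall>\<^sub>F N in sequentially. dist (\<Sum>m=1..2 * N. (-1) ^ (m + 1) / (real m)^2) (pi^2 / 12) < r / 3"
    using alternating_inverse_squares r by (intro tendstoD) auto
  ultimately have "\<forall>\<^sub>F N in sequentially. 1 / (real (2 * N) + 1)^2 < r / 3 \<and>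
      dist (\<Sum>m=1..2 * N. (-1) ^ (m + 1) / (real m)^2) (pi^2 / 12) < r / 3" by (rule eventually_conj)
  \<comment> \<open>\<open>N\<close> is fixed before \<open>n\<close>, because the number of terms
    multiplies the tail error, which vanishes only as \<open>n\<close> grows.\<close>
  then obtain N where N: "1 / (real (2 * N) + 1)^2 < r / 3"
    "dist (\<Sum>m=1..2 * N. (-1) ^ (m + 1) / (real m)^2) (pi^2 / 12) < r / 3"
    unfolding eventually_sequentially by blast
  have "((\<lambda>x::real. real (2 * N) * (ln x / x + 1 / x)) \<longlongrightarrow> real (2 * N) * (0 + 0)) at_top"
    by (intro tendsto_intros ln_x_over_x_tendsto_0 tendsto_divide_0[OF tendsto_const]
        filterlim_at_top_imp_at_infinity filterlim_ident) 
  then have "((\<lambda>n. real (2 * N) * (ln (real (Suc n)) / real (Suc n) + 1 / real (Suc n))) \<longlongrightarrow> real (2 * N) * (0 + 0)) sequentially"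
    by (rule filterlim_compose) (intro filterlim_compose[OF filterlim_real_sequentially] filterlim_Suc)
  then have "\<forall>\<^sub>F n in sequentially. real (2 * N) * (ln (real (Suc n)) / real (Suc n) + 1 / real (Suc n)) < r / 3"
    using r by (intro order_tendstoD) auto
  then obtain n0 where n0: "\<And>n. n \<ge> n0 \<Longrightarrow> real (2 * N) * (ln (real (Suc n)) / real (Suc n) + 1 / real (Suc n)) < r / 3"
    by (auto simp: eventually_sequentially)
  have "norm (kernel_integral (real n + 1) - pi^2 / 12) < r" if "n \<ge> n0" for n
  proof -
    have "\<bar>kernel_integral (real n + 1) - (\<Sum>m=1..2 * N. (-1) ^ (m + 1) / (real m)^2)\<bar>
      \<le> 1 / (real (2 * N) + 1)^2 + real (2 * N) * ((ln (real n + 1) + 1) / (real n + 1))"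
      by (rule kernel_integral_expansion) simp
    moreover have "real (2 * N) * ((ln (real n + 1) + 1) / (real n + 1)) < r / 3"
      using n0[OF that] by (simp add: add_divide_distrib add.commute)
    ultimately show ?thesis using N unfolding real_norm_def dist_real_def by linarith
  qed
  then show "\<exists>no. \<forall>n\<ge>no. norm (kernel_integral (real n + 1) - pi^2 / 12) < r" by blast
qed


section \<open>Exponent and measure for a fixed alphabet\<close>

context conformal_mean_pos begin

text \<open>\<open>f x + L * x\<close> increases, so \<open>f\<close> is a difference of monotone
  functions; after scaling into \<open>{0..1}\<close> the two parts cost \<open>2 * L * 24\<close>
  and \<open>L * 24\<close>.\<close>

lemma mean_minus_integral_lipschitz:
  assumes L: "L > 0" and lip: "\<And>x y. x \<in> {0..1} \<Longrightarrow> y \<in> {0..1} \<Longrightarrow> \<bar>f x - f y\<bar> \<le> L * \<bar>x - y\<bar>"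
  shows "\<bar>\<Lambda> f - integral {0..1} f\<bar> \<le> 72 * L / (real n + 1)"
proof -
  define g where "g x = (f x - f 0 + L * x) / (2 * L)" for x
  have fg: "f = (\<lambda>x. (2 * L) * g x + (f 0 - L * x))" using L by (simp add: g_def fun_eq_iff field_simps)
  have "mono01 g"
    unfolding mono01_def
  proof (intro conjI disjI1 monotone_onI ballI)
    fix x y :: real assume xy: "x \<in> {0..1}" "y \<in> {0..1}" "x \<le> y"
    have "f x - f y \<le> L * (y - x)" using lip[OF xy(1,2)] xy(3) by simp
    then show "g x \<le> g y" unfolding g_def using L by (intro divide_right_mono) (auto simp: algebra_simps)
  next
    fix x :: real assume x: "x \<in> {0..1}"
    have b: "\<bar>f x - f 0\<bar> \<le> L * x" using lip[OF x, of 0] x by simp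
    then show "0 \<le> g x" unfolding g_def using L by (intro divide_nonneg_pos) auto
    have "f x - f 0 + L * x \<le> 2 * (L * x)" using b by simp
    also have "\<dots> \<le> 2 * L" using x L by simp
    finally show "g x \<le> 1" unfolding g_def using L by simp
  qed
  note g = this
  have i: "mono01 (\<lambda>x. x)" by (auto simp: mono01_def monotone_on_def)
  have bg: "bdd01 g" using g by (rule bdd01_mono01)
  have gi: "g integrable_on {0..1}"
    using density_times_integrable'[of "\<lambda>x. x"] integrable_continuous_times_mono[of g "\<lambda>_. 1"] g
    by (auto simp: mono01_def absolutely_integrable_on_def)
  have ii: "(\<lambda>x::real. x) integrable_on {0..1}" by (intro integrable_continuous_interval continuous_intros)
  have "\<Lambda> f = \<Lambda> (\<lambda>x. (2 * L) * g x + (f 0 - L * x))" using fg by (rule arg_cong)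
  also have "\<dots> = \<Lambda> (\<lambda>x. (2 * L) * g x) + \<Lambda> (\<lambda>x. f 0 - L * x)"
    by (intro mean_add bdd01_mult[OF bdd01_const] bg bdd01_diff bdd01_const bdd01_id)
  also have "\<dots> = 2 * L * \<Lambda> g + (f 0 - L * \<Lambda> (\<lambda>x. x))"
    using mean_cmult[OF bg, of "2 * L"] mean_cmult[OF bdd01_id, of L]
      mean_diff[OF bdd01_const bdd01_mult[OF bdd01_const bdd01_id], of "f 0" L] by (simp add: mean_const)
  finally have 1: "\<Lambda> f = 2 * L * \<Lambda> g + (f 0 - L * \<Lambda> (\<lambda>x. x))" .
  have "integral {0..1} f = integral {0..1} (\<lambda>x. (2 * L) * g x + (f 0 - L * x))"
    using fg by (rule arg_cong)
  also have "\<dots> = integral {0..1} (\<lambda>x. (2 * L) * g x) + integral {0..1} (\<lambda>x. f 0 - L * x)"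
    using gi ii by (intro Henstock_Kurzweil_Integration.integral_add integrable_on_mult_right
      Henstock_Kurzweil_Integration.integrable_diff integrable_const_ivl)
  also have "integral {0..1} (\<lambda>x. f 0 - L * x) = integral {0..1::real} (\<lambda>_. f 0) - integral {0..1} (\<lambda>x. L * x)"
    by (rule Henstock_Kurzweil_Integration.integral_diff[OF integrable_const_ivl integrable_on_mult_right[OF ii]])
  finally have 2: "integral {0..1} f = 2 * L * integral {0..1} g + (f 0 - L * integral {0..1} (\<lambda>x. x))"
    unfolding integral_mult_right by simp
  define d where "d = 24 / (real n + 1)"
  have "\<bar>\<Lambda> f - integral {0..1} f\<bar> = \<bar>2 * L * (\<Lambda> g - integral {0..1} g) - L * (\<Lambda> (\<lambda>x. x) - integral {0..1} (\<lambda>x. x))\<bar>"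
    unfolding 1 2 by (simp add: algebra_simps)
  also have "\<dots> \<le> 2 * L * d + L * d"
  proof (rule order_trans[OF abs_triangle_ineq4 add_mono])
    show "\<bar>2 * L * (\<Lambda> g - integral {0..1} g)\<bar> \<le> 2 * L * d"
      unfolding abs_mult using mean_minus_integral[OF g] L by (intro mult_mono) (auto simp: d_def)
    show "\<bar>L * (\<Lambda> (\<lambda>x. x) - integral {0..1} (\<lambda>x. x))\<bar> \<le> L * d"
      unfolding abs_mult using mean_minus_integral[OF i] L by (intro mult_mono) (auto simp: d_def)
  qed
  also have "\<dots> = 72 * L / (real n + 1)" by (simp add: d_def)
  finally show ?thesis .
qed

definition mean_kernel :: real where
  "mean_kernel = \<Lambda> (\<lambda>y. \<Sum>k=1..n. gauss_kernel (real k + y))"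

lemma mean_kernel_approx: "\<bar>mean_kernel - kernel_integral (real n + 1)\<bar> \<le> 288 / (real n + 1)"
proof -
  have "\<bar>mean_kernel - integral {0..1} (\<lambda>y. \<Sum>k=1..n. gauss_kernel (real k + y))\<bar> \<le> 72 * 4 / (real n + 1)"
    unfolding mean_kernel_def
  proof (rule mean_minus_integral_lipschitz)
    fix x y :: real assume xy: "x \<in> {0..1}" "y \<in> {0..1}"
    have "\<bar>(\<Sum>k=1..n. gauss_kernel (real k + x)) - (\<Sum>k=1..n. gauss_kernel (real k + y))\<bar>
      \<le> (\<Sum>k=1..n. \<bar>gauss_kernel (real k + x) - gauss_kernel (real k + y)\<bar>)"
      unfolding sum_subtractf[symmetric] by (rule sum_abs)
    also have "\<dots> \<le> (\<Sum>k=1..n. 2 * (1 / (real k)^2) * \<bar>x - y\<bar>)"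
    proof (rule sum_mono)
      fix k assume "k \<in> {1..n}"
      then show "\<bar>gauss_kernel (real k + x) - gauss_kernel (real k + y)\<bar> \<le> 2 * (1 / (real k)^2) * \<bar>x - y\<bar>"
        using gauss_kernel_lipschitz[of "real k" "real k + x" "real k + y"] xy by simp
    qed
    also have "\<dots> = 2 * (\<Sum>k=1..n. 1 / (real k)^2) * \<bar>x - y\<bar>"
      by (simp only: sum_distrib_left sum_distrib_right)
    also have "\<dots> \<le> 4 * \<bar>x - y\<bar>" using sum_inverse_squares_le[of n] by (intro mult_right_mono) auto
    finally show "\<bar>(\<Sum>k=1..n. gauss_kernel (real k + x)) - (\<Sum>k=1..n. gauss_kernel (real k + y))\<bar> \<le> 4 * \<bar>x - y\<bar>" .
  qed simp
  then show ?thesis using integral_unique[OF integral_gauss_kernel_shift[of n]] by simp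
qed

text \<open>With \<open>e = 1 - h\<close>, \<open>exp z >= 1 + z\<close> at both signs squeezes
  \<open>u powr (2 * e) - 1\<close> between \<open>2 * e * ln u\<close> and
  \<open>u powr (2 * e)\<close> times that. Inserted into \<open>mean_excess\<close>, this
  determines \<open>1 - h\<close> up to the factor \<open>(n + 1) powr (2 * e)\<close>, which tends
  to 1.\<close>

lemma mean_kernel_bounds:
  shows "2 * (1 - h) * mean_kernel \<le> 1 / (real n + 1)"
    and "1 / (real n + 2) \<le> 2 * (1 - h) * (real n + 1) powr (2 * (1 - h)) * mean_kernel"
proof -
  let ?r = "\<lambda>y::real. 1 / (1 + y)"
  let ?D = "\<lambda>x. transfer h {1..n} ?r x - transfer 1 {1..n} ?r x"
  let ?P = "\<lambda>y. \<Sum>k=1..n. gauss_kernel (real k + y)"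
  define e where "e = 1 - h"
  have e: "0 < e" using h_less_1 by (simp add: e_def)
  have br: "bdd01 ?r" by (rule bdd01_inverse_shift') simp
  have bD: "bdd01 ?D" by (intro bdd01_diff bdd01_transfer br) auto
  have bP: "bdd01 ?P"
  proof (intro bdd01_continuous continuous_on_sum)
    fix k assume "k \<in> {1..n}"
    then have "\<And>x. x \<in> {0..1} \<Longrightarrow> 0 < real k + x" by auto
    then show "continuous_on {0..1} (\<lambda>y. gauss_kernel (real k + y))"
      unfolding gauss_kernel_def by (intro continuous_intros) (auto simp: less_imp_neq[symmetric] add_nonneg_eq_0_iff)
  qed
  have Dx: "?D x = (\<Sum>k=1..n. ((x + real k) powr (2 * e) - 1) / ((x + real k) * (x + real k + 1)))" if x: "x \<in> {0..1}" for x
  proof -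
    have x0: "x \<ge> 0" using x by simp
    have "?D x = (\<Sum>k=1..n. (x + real k) powr (2 - 2 * h) / ((x + real k) * (x + real k + 1))
        - (x + real k) powr (2 - 2 * 1) / ((x + real k) * (x + real k + 1)))"
      unfolding transfer_inverse_density[OF x0] by (rule sum_subtractf[symmetric])
    also have "\<dots> = (\<Sum>k=1..n. ((x + real k) powr (2 * e) - 1) / ((x + real k) * (x + real k + 1)))"
    proof (rule sum.cong[OF refl])
      fix k assume k: "k \<in> {1..n}"
      have "2 - 2 * h = 2 * e" by (simp add: e_def)
      then show "(x + real k) powr (2 - 2 * h) / ((x + real k) * (x + real k + 1))
        - (x + real k) powr (2 - 2 * 1) / ((x + real k) * (x + real k + 1))
        = ((x + real k) powr (2 * e) - 1) / ((x + real k) * (x + real k + 1))"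
        using k x0 by (simp add: diff_divide_distrib)
    qed
    finally show ?thesis .
  qed
  have bounds: "2 * e * ln u \<le> u powr (2 * e) - 1" "u powr (2 * e) - 1 \<le> 2 * e * u powr (2 * e) * ln u" if u: "u \<ge> 1" for u :: real
  proof -
    have ue: "u powr (2 * e) = exp (2 * e * ln u)" using u by (simp add: powr_def)
    show "2 * e * ln u \<le> u powr (2 * e) - 1" unfolding ue using exp_ge_add_one_self[of "2 * e * ln u"] by linarith
    have "1 - 2 * e * ln u \<le> exp (- (2 * e * ln u))" using exp_ge_add_one_self[of "- (2 * e * ln u)"] by simp
    then have "exp (2 * e * ln u) * (1 - 2 * e * ln u) \<le> exp (2 * e * ln u) * exp (- (2 * e * ln u))"
      by (intro mult_left_mono) auto
    also have "\<dots> = 1" by (simp flip: exp_add)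
    finally show "u powr (2 * e) - 1 \<le> 2 * e * u powr (2 * e) * ln u" unfolding ue by (simp add: algebra_simps)
  qed
  have "2 * e * mean_kernel = \<Lambda> (\<lambda>x. (2 * e) * ?P x)" unfolding mean_kernel_def using mean_cmult[OF bP] by simp
  also have "\<dots> \<le> \<Lambda> ?D"
  proof (rule mean_mono[OF bdd01_mult[OF bdd01_const bP] bD])
    fix x :: real assume x: "x \<in> {0..1}"
    show "(2 * e) * ?P x \<le> ?D x"
      unfolding Dx[OF x] sum_distrib_left
    proof (rule sum_mono)
      fix k assume k: "k \<in> {1..n}"
      have u: "1 \<le> x + real k" using x k by auto
      have "2 * e * gauss_kernel (real k + x) = 2 * e * ln (x + real k) / ((x + real k) * (x + real k + 1))"
        by (simp add: gauss_kernel_def add.commute)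
      also have "\<dots> \<le> ((x + real k) powr (2 * e) - 1) / ((x + real k) * (x + real k + 1))"
        using bounds(1)[OF u] u by (intro divide_right_mono) auto
      finally show "2 * e * gauss_kernel (real k + x) \<le> ((x + real k) powr (2 * e) - 1) / ((x + real k) * (x + real k + 1))" .
    qed
  qed
  also have "\<dots> \<le> 1 / (real n + 1)" unfolding mean_excess by (rule mean_tail_bounds)
  finally show "2 * (1 - h) * mean_kernel \<le> 1 / (real n + 1)" by (simp add: e_def)
  define c where "c = 2 * e * (real n + 1) powr (2 * e)"
  have "1 / (real n + 2) \<le> \<Lambda> ?D" unfolding mean_excess by (rule mean_tail_bounds)
  also have "\<dots> \<le> \<Lambda> (\<lambda>x. c * ?P x)"
  proof (rule mean_mono[OF bD bdd01_mult[OF bdd01_const bP]])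
    fix x :: real assume x: "x \<in> {0..1}"
    show "?D x \<le> c * ?P x"
      unfolding Dx[OF x] sum_distrib_left
    proof (rule sum_mono)
      fix k assume k: "k \<in> {1..n}"
      have u: "1 \<le> x + real k" "x + real k \<le> real n + 1" using x k by auto
      have "(x + real k) powr (2 * e) - 1 \<le> 2 * e * (x + real k) powr (2 * e) * ln (x + real k)"
        by (rule bounds(2)[OF u(1)])
      also have "\<dots> \<le> c * ln (x + real k)"
        unfolding c_def using u e by (intro mult_right_mono mult_left_mono powr_mono2) auto
      finally have "((x + real k) powr (2 * e) - 1) / ((x + real k) * (x + real k + 1))
        \<le> c * ln (x + real k) / ((x + real k) * (x + real k + 1))" using u by (intro divide_right_mono) auto
      also have "\<dots> = c * gauss_kernel (real k + x)" by (simp add: gauss_kernel_def add.commute)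
      finally show "((x + real k) powr (2 * e) - 1) / ((x + real k) * (x + real k + 1)) \<le> c * gauss_kernel (real k + x)" .
    qed
  qed
  also have "\<dots> = c * mean_kernel" unfolding mean_kernel_def by (rule mean_cmult[OF bP])
  finally show "1 / (real n + 2) \<le> 2 * (1 - h) * (real n + 1) powr (2 * (1 - h)) * mean_kernel"
    by (simp add: c_def e_def)
qed

text \<open>The interval \<open>{1 / (n + 1)..1 / (n div 2)}\<close> is, to first order, the one with the largest ratio of mass to
  length to the power \<open>h\<close>.\<close>

lemma ln_gauss_measure:
  assumes n: "n \<ge> 17"
  shows "0 < gauss_measure n" and "\<bar>- ln (gauss_measure n) - (1 - h) * ln (real n + 1)\<bar> \<le> 700 / (real n + 1)"
proof -
  \<comment> \<open>What matters is that \<open>l\<close> and \<open>n - l\<close> are comparable to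
    \<open>n\<close>: then \<open>ln len\<close> is \<open>- ln n\<close> up to a constant, and the
    constant gets multiplied by \<open>1 - h\<close>.\<close>
  define l where "l = n div 2"
  define e where "e = 1 - h"
  define d where "d = 1 / (real n + 1)"
  have d: "0 < d" by (simp add: d_def)
  have e: "0 < e" "e \<le> 9 * d" "e \<le> 1 / 2"
  proof -
    show "0 < e" using h_less_1 by (simp add: e_def)
    show "e \<le> 9 * d" using one_minus_h_le by (simp add: e_def d_def)
    \<comment> \<open>\<open>n >= 17\<close> is exactly what this takes; it gives
      \<open>h >= 1/2\<close>.\<close>
    also have "9 * d \<le> 1 / 2" using n by (simp add: d_def field_simps)
    finally show "e \<le> 1 / 2" .
  qed
  have ll: "1 \<le> l" "l \<le> n" "8 \<le> l" using n by (auto simp: l_def)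
  have "2 * l \<le> n" "n \<le> 2 * l + 1" by (auto simp: l_def)
  then have l2: "2 * real l \<le> real n" "real n \<le> 2 * real l + 1" by linarith+
  have l8: "8 \<le> real l" using ll by simp
  have lo: "1 / Cmass \<le> gauss_measure n" using ll by (rule_tac gauss_dim_measure) auto
  show pos: "0 < gauss_measure n" using lo Cmass_pos by (auto intro: less_le_trans[of 0 "1 / Cmass"])
  have "- ln (gauss_measure n) \<le> - ln (1 / Cmass)" using lo pos Cmass_pos by simp
  also have "\<dots> = ln Cmass" using Cmass_pos by (simp add: ln_div)
  also have "\<dots> = e * ln 2 + (e * ln 4 + e * ln (real n + 1) + ln (1 + 576 * d) - ln h)"
  proof -
    have "0 < 1 + 576 * d" using d by simp
    moreover have "Cmass = 2 powr e * (4 powr e * (real n + 1) powr e * (1 + 576 * d) / h)"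
      by (simp add: Cmass_def ratio_def e_def d_def)
    ultimately show ?thesis using h_pos by (simp add: ln_mult ln_div)
  qed
  \<comment> \<open>The extra terms are at most \<open>9 + 27 + 576 + 18 = 630\<close> times
    \<open>d\<close>.\<close>
  also have "\<dots> \<le> e * ln (real n + 1) + 700 * d"
  proof -
    have l24: "ln 2 \<le> (1::real)" "ln 4 \<le> (3::real)" using ln_le_minus_one[of 2] ln_le_minus_one[of 4] by auto
    have "e * ln 2 \<le> e * 1" "e * ln 4 \<le> e * 3" using e l24 by (auto intro: mult_left_mono)
    moreover have "ln (1 + 576 * d) \<le> 576 * d" using ln_le_minus_one[of "1 + 576 * d"] d by simp
    moreover have "- ln h \<le> 2 * e"
    proof -
      have "- ln h = ln (1 / h)" using h_pos by (simp add: ln_div)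
      also have "\<dots> \<le> 1 / h - 1" using h_pos by (intro ln_le_minus_one) auto
      also have "\<dots> = e / h" using h_pos by (simp add: e_def field_simps)
      also have "\<dots> \<le> e / (1 / 2)" using e h_pos unfolding e_def by (intro divide_left_mono) auto
      finally show ?thesis by simp
    qed
    ultimately show ?thesis using e d by linarith
  qed
  finally have up: "- ln (gauss_measure n) \<le> e * ln (real n + 1) + 700 * d" .
  define len where "len = 1 / real l - 1 / (real n + 1)"
  define \<beta> where "\<beta> = (\<Sum>k=l..n. (real k + 1) powr (- (2 * h)))"
  define q where "q = 1 / (real l + 1) - 1 / (real n + 2)"
  have len_eq: "len = (real n + 1 - real l) / (real l * (real n + 1))"
    unfolding len_def using l8 by (simp add: field_simps)
  have q_eq: "q = (real n + 1 - real l) / ((real l + 1) * (real n + 2))"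
    unfolding q_def using l8 by (simp add: field_simps)
  have nl: "real n + 1 - real l \<ge> real l" "real n + 1 - real l > 0" using l2 l8 by auto
  have len0: "0 < len" and q0: "0 < q" unfolding len_eq q_eq using nl l8 by simp_all
  have "q = (\<Sum>k=l..n. 1 / ((real k + 1) * (real k + 2)))"
  proof -
    have "(\<Sum>k=l..n. 1 / ((real k + 1) * (real k + 2))) = (\<Sum>k=l..n. - 1 / (real (Suc k) + 1) - (- 1 / (real k + 1)))"
      by (intro sum.cong) (auto simp: field_simps)
    also have "\<dots> = - 1 / (real (Suc n) + 1) - (- 1 / (real l + 1))" using ll by (intro sum_Suc_diff) auto
    finally show ?thesis by (simp add: q_def add.commute)
  qed
  \<comment> \<open>From \<open>- 2 * h = 2 * e - 2\<close>: the smallest factor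
    \<open>(l + 1) powr (2 * e)\<close> is taken out, and the telescoping \<open>q\<close> agrees
    with \<open>len\<close> up to a factor \<open>1 + O(1/n)\<close>.\<close>
  also have "(real l + 1) powr (2 * e) * \<dots> \<le> \<beta>"
    unfolding \<beta>_def sum_distrib_left
  proof (rule sum_mono)
    fix k assume k: "k \<in> {l..n}"
    have "(real l + 1) powr (2 * e) * (1 / ((real k + 1) * (real k + 2))) \<le> (real k + 1) powr (2 * e) * (1 / (real k + 1)^2)"
      using k e unfolding power2_eq_square by (intro mult_mono powr_mono2 frac_le) auto
    also have "1 / (real k + 1)^2 = (real k + 1) powr (- 2)" by (simp add: powr_minus powr_numeral divide_inverse)
    also have "(real k + 1) powr (2 * e) * (real k + 1) powr (- 2) = (real k + 1) powr (- (2 * h))"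
      by (simp add: e_def flip: powr_add)
    finally show "(real l + 1) powr (2 * e) * (1 / ((real k + 1) * (real k + 2))) \<le> (real k + 1) powr (- (2 * h))" .
  qed
  finally have \<beta>: "(real l + 1) powr (2 * e) * q \<le> \<beta>" .
  have lq: "0 < (real l + 1) powr (2 * e) * q" using q0 l8 by simp
  then have \<beta>0: "0 < \<beta>" using \<beta> by linarith
  have "gauss_measure n \<le> len powr h * ((1 + 1 / real l) powr (2 * h) / \<beta>)"
    unfolding len_def \<beta>_def by (rule gauss_dim_measure(3)[OF ll(1,2)])
  then have "ln (gauss_measure n) \<le> ln (len powr h * ((1 + 1 / real l) powr (2 * h) / \<beta>))"
    using pos by (simp add: ln_mono)
  also have "\<dots> = h * ln len + (2 * h * ln (1 + 1 / real l) - ln \<beta>)"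
  proof -
    define W where "W = 1 + 1 / real l"
    have "0 < W" using l8 unfolding W_def by (intro add_pos_pos) auto
    then show ?thesis unfolding W_def[symmetric] using len0 \<beta>0 by (simp add: ln_mult ln_div)
  qed
  finally have m1: "ln (gauss_measure n) \<le> h * ln len + (2 * h * ln (1 + 1 / real l) - ln \<beta>)" .
  have m2: "2 * e * ln (real l + 1) + ln q \<le> ln \<beta>"
  proof -
    have "ln ((real l + 1) powr (2 * e) * q) \<le> ln \<beta>" using \<beta> lq by (intro ln_mono)
    then show ?thesis using q0 l8 by (simp add: ln_mult)
  qed
  define A where "A = ln (1 + 1 / real l)"
  have A: "0 \<le> A" "A \<le> 3 * d"
  proof -
    show "0 \<le> A" using l8 by (simp add: A_def)
    have "A \<le> 1 / real l" unfolding A_def using ln_le_minus_one[of "1 + 1 / real l"] l8 by (simp add: add_pos_pos)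
    also have "\<dots> \<le> 3 * d" unfolding d_def using l2 l8 by (simp add: field_simps)
    finally show "A \<le> 3 * d" .
  qed
  have "q = len * ((real l / (real l + 1)) * ((real n + 1) / (real n + 2)))"
    unfolding len_eq q_eq using l8 by simp
  note q_split = this
  have ln_mult3: "ln (u * (v * w)) = ln u + (ln v + ln w)" if "0 < u" "0 < v" "0 < w" for u v w :: real
    using that by (simp add: ln_mult)
  have "ln q = ln len + (ln (real l / (real l + 1)) + ln ((real n + 1) / (real n + 2)))"
    unfolding q_split by (rule ln_mult3) (use len0 l8 in auto)
  moreover have "ln (real l / (real l + 1)) = - A"
  proof -
    have "1 + 1 / real l = (real l + 1) / real l" using l8 by (simp add: field_simps)
    then show ?thesis unfolding A_def using l8 by (simp add: ln_div)
  qed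
  moreover have "- d \<le> ln ((real n + 1) / (real n + 2))"
  proof -
    have "ln ((real n + 2) / (real n + 1)) \<le> (real n + 2) / (real n + 1) - 1" by (intro ln_le_minus_one) auto
    also have "\<dots> = d" by (simp add: d_def field_simps)
    finally show ?thesis by (simp add: ln_div)
  qed
  ultimately have m3: "ln len - A - d \<le> ln q" by linarith
  have m4: "- ln (real n + 1) \<le> ln len"
  proof -
    have "1 / (real n + 1) = real l / (real l * (real n + 1))" using l8 by simp
    also have "\<dots> \<le> len" unfolding len_eq using nl l8 by (intro divide_right_mono) auto
    finally have "ln (1 / (real n + 1)) \<le> ln len" by (intro ln_mono) auto
    then show ?thesis by (simp add: ln_div)
  qed
  have m5: "ln (real n + 1) - 1 \<le> ln (real l + 1)"
  proof -
    have "ln ((real n + 1) / 2) \<le> ln (real l + 1)" using l2 by (intro ln_mono) auto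
    then show ?thesis using ln_le_minus_one[of 2] by (simp add: ln_div)
  qed
  have "ln (gauss_measure n) \<le> h * ln len + 2 * h * A - (2 * e * ln (real l + 1) + (ln len - A - d))"
    using m1 m2 m3 unfolding A_def by linarith
  \<comment> \<open>The bracket is about \<open>- ln n + 2 * ln n\<close>, up to a constant that is
    multiplied by \<open>e\<close>.\<close>
  also have "\<dots> = - e * (ln len + 2 * ln (real l + 1)) + (2 * h + 1) * A + d"
    by (simp add: e_def algebra_simps)
  also have "\<dots> \<le> - e * (ln (real n + 1) - 2) + 3 * A + d"
  proof (intro add_mono order_refl)
    show "- e * (ln len + 2 * ln (real l + 1)) \<le> - e * (ln (real n + 1) - 2)"
      using m4 m5 e by (intro mult_left_mono_neg) auto
    show "(2 * h + 1) * A \<le> 3 * A" using A h_less_1 by (intro mult_right_mono) auto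
  qed
  also have "\<dots> \<le> - e * ln (real n + 1) + 700 * d"
    using A e d by (simp add: right_diff_distrib)
  finally have "ln (gauss_measure n) \<le> - e * ln (real n + 1) + 700 * d" .
  then show "\<bar>- ln (gauss_measure n) - (1 - h) * ln (real n + 1)\<bar> \<le> 700 / (real n + 1)"
  proof -
    assume "ln (gauss_measure n) \<le> - e * ln (real n + 1) + 700 * d"
    moreover have "700 / (real n + 1) = 700 * d" by (simp add: d_def)
    ultimately show ?thesis using up unfolding e_def[symmetric] abs_le_iff by simp
  qed
qed

end

text \<open>Gathers the estimates for each \<open>n\<close> outside the locale; \<open>P\<close> is
  \<open>mean_kernel\<close> for the chosen conformal mean.\<close>

lemma gauss_asymptotics:
  assumes n: "n \<ge> 17"
  shows "\<exists>P. 0 < 1 - gauss_dim n \<and> 1 - gauss_dim n \<le> 9 / (real n + 1)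
    \<and> \<bar>P - kernel_integral (real n + 1)\<bar> \<le> 288 / (real n + 1)
    \<and> 2 * (1 - gauss_dim n) * P \<le> 1 / (real n + 1)
    \<and> 1 / (real n + 2) \<le> 2 * (1 - gauss_dim n) * (real n + 1) powr (2 * (1 - gauss_dim n)) * P
    \<and> 0 < gauss_measure n
    \<and> \<bar>- ln (gauss_measure n) - (1 - gauss_dim n) * ln (real n + 1)\<bar> \<le> 700 / (real n + 1)"
proof -
  obtain h \<Lambda> where "conformal_mean n h \<Lambda>" using conformal_mean_exists[of n] n by auto
  then interpret conformal_mean n h \<Lambda> .
  have "9 / (real n + 1) \<le> 9 / 18" using n by (intro frac_le) auto
  then have "0 < h" using one_minus_h_le by linarith
  then interpret conformal_mean_pos n h \<Lambda> by unfold_locales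
  have "gauss_dim n = h" using n by (intro gauss_dim_measure(1)[of 1]) auto
  then show ?thesis
    using h_less_1 one_minus_h_le mean_kernel_approx mean_kernel_bounds ln_gauss_measure[OF n]
    by (intro exI[of _ mean_kernel]) simp
qed


section \<open>Limits as the alphabet grows\<close>

lemma gauss_dim_asymptotics: "(\<lambda>n. real n * (1 - gauss_dim n)) \<longlonglongrightarrow> 6 / pi\<^sup>2"
proof -
  define N where "N n = real n + 1" for n :: nat
  have ex: "\<forall>n. \<exists>P. n \<ge> 17 \<longrightarrow> (\<bar>P - kernel_integral (N n)\<bar> \<le> 288 / N n
    \<and> 2 * (1 - gauss_dim n) * P \<le> 1 / N n
    \<and> 1 / (real n + 2) \<le> 2 * (1 - gauss_dim n) * N n powr (2 * (1 - gauss_dim n)) * P)"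
  proof
    fix n
    show "\<exists>P. n \<ge> 17 \<longrightarrow> (\<bar>P - kernel_integral (N n)\<bar> \<le> 288 / N n
      \<and> 2 * (1 - gauss_dim n) * P \<le> 1 / N n
      \<and> 1 / (real n + 2) \<le> 2 * (1 - gauss_dim n) * N n powr (2 * (1 - gauss_dim n)) * P)"
    proof (cases "n \<ge> 17")
      case True
      then show ?thesis using gauss_asymptotics[OF True] unfolding N_def by blast
    qed simp
  qed
  obtain P where P: "\<And>n. n \<ge> 17 \<Longrightarrow> \<bar>P n - kernel_integral (N n)\<bar> \<le> 288 / N n"
    "\<And>n. n \<ge> 17 \<Longrightarrow> 2 * (1 - gauss_dim n) * P n \<le> 1 / N n"
    "\<And>n. n \<ge> 17 \<Longrightarrow> 1 / (real n + 2) \<le> 2 * (1 - gauss_dim n) * N n powr (2 * (1 - gauss_dim n)) * P n"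
    using choice[OF ex] by blast
  have Ntop: "filterlim N at_top sequentially"
  proof -
    have "N = (\<lambda>n. real (Suc n))" by (simp add: N_def fun_eq_iff)
    then show ?thesis using filterlim_compose[OF filterlim_real_sequentially filterlim_Suc] by simp
  qed
  have inv: "(\<lambda>n. c / N n) \<longlonglongrightarrow> 0" for c
    by (intro tendsto_divide_0[OF tendsto_const] filterlim_at_top_imp_at_infinity Ntop)
  have lnN: "(\<lambda>n. ln (N n) / N n) \<longlonglongrightarrow> 0"
    by (rule filterlim_compose[OF ln_x_over_x_tendsto_0 Ntop])
  have "(\<lambda>n. P n - kernel_integral (N n)) \<longlonglongrightarrow> 0"
  proof (rule Lim_null_comparison[OF _ inv[of 288]])
    show "\<forall>\<^sub>F n in sequentially. norm (P n - kernel_integral (N n)) \<le> 288 / N n"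
      using eventually_ge_at_top[of 17] by eventually_elim (use P(1) in simp)
  qed
  then have "(\<lambda>n. (P n - kernel_integral (N n)) + kernel_integral (N n)) \<longlonglongrightarrow> 0 + pi^2 / 12"
    using kernel_integral_tendsto unfolding N_def by (intro tendsto_add)
  then have Plim: "P \<longlonglongrightarrow> pi^2 / 12" by simp
  then have Ppos: "\<forall>\<^sub>F n in sequentially. 0 < P n" by (intro order_tendstoD(1)) auto
  \<comment> \<open>Bounds \<open>(n + 1) powr (2 * (1 - h))\<close> by means of
    \<open>1 - h <= 9 / (n + 1)\<close>; 18 = 2 * 9.\<close>
  define E where "E n = exp (18 * (ln (N n) / N n))" for n
  have E: "E \<longlonglongrightarrow> 1"
  proof -
    have "E \<longlonglongrightarrow> exp (18 * 0)" unfolding E_def by (intro tendsto_intros lnN)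
    then show ?thesis by simp
  qed
  have r1: "(\<lambda>n. real n / N n) \<longlonglongrightarrow> 1"
  proof -
    have "real n / N n = 1 - 1 / N n" for n by (simp add: N_def field_simps)
    then show ?thesis using tendsto_diff[OF tendsto_const inv[of 1], of 1] by simp
  qed
  have r2: "(\<lambda>n. real n / (N n + 1)) \<longlonglongrightarrow> 1"
  proof (rule tendsto_sandwich[OF _ _ _ r1])
    show "\<forall>\<^sub>F n in sequentially. real n / N n - 1 / N n \<le> real n / (N n + 1)"
    proof (intro always_eventually allI)
      fix n
      have "(real n - 1) * (N n + 1) \<le> real n * N n" by (simp add: N_def algebra_simps)
      then show "real n / N n - 1 / N n \<le> real n / (N n + 1)"
        by (simp add: N_def divide_simps flip: diff_divide_distrib) 
    qed
    show "\<forall>\<^sub>F n in sequentially. real n / (N n + 1) \<le> real n / N n"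
      by (intro always_eventually allI divide_left_mono) (auto simp: N_def)
    show "(\<lambda>n. real n / N n - 1 / N n) \<longlonglongrightarrow> 1"
      using tendsto_diff[OF r1 inv[of 1]] by simp
  qed
  have lim: "1 / (2 * (pi^2 / 12)) = 6 / pi\<^sup>2" by simp
  have up: "(\<lambda>n. real n / N n * (1 / (2 * P n))) \<longlonglongrightarrow> 6 / pi\<^sup>2"
  proof -
    have "(\<lambda>n. real n / N n * (1 / (2 * P n))) \<longlonglongrightarrow> 1 * (1 / (2 * (pi^2 / 12)))"
      by (intro tendsto_intros r1 Plim) auto
    then show ?thesis using lim by simp
  qed
  have lo: "(\<lambda>n. real n / (N n + 1) * (1 / (2 * (E n * P n)))) \<longlonglongrightarrow> 6 / pi\<^sup>2"
  proof -
    have "(\<lambda>n. real n / (N n + 1) * (1 / (2 * (E n * P n)))) \<longlonglongrightarrow> 1 * (1 / (2 * (1 * (pi^2 / 12))))"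
      by (intro tendsto_intros r2 Plim E) auto
    then show ?thesis using lim by simp
  qed
  show ?thesis
  proof (rule tendsto_sandwich[OF _ _ lo up])
    show "\<forall>\<^sub>F n in sequentially. real n / (N n + 1) * (1 / (2 * (E n * P n))) \<le> real n * (1 - gauss_dim n)"
      using eventually_ge_at_top[of 17] Ppos
    proof eventually_elim
      case (elim n)
      define e where "e = 1 - gauss_dim n"
      have e: "0 < e" "e \<le> 9 / N n" using gauss_asymptotics[OF elim(1)] by (auto simp: e_def N_def)
      have N0: "0 < N n" "0 \<le> ln (N n)" by (auto simp: N_def)
      have "N n powr (2 * e) = exp (2 * e * ln (N n))" using N0 by (simp add: powr_def)
      also have "\<dots> \<le> E n"
      proof -
        have "2 * e * ln (N n) \<le> 2 * (9 / N n) * ln (N n)" using e N0 by (intro mult_right_mono mult_left_mono) auto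
        then show ?thesis unfolding E_def by simp
      qed
      finally have "2 * e * N n powr (2 * e) * P n \<le> 2 * e * E n * P n"
        using e elim by (intro mult_right_mono mult_left_mono) auto
      then have "1 / (real n + 2) \<le> e * (2 * (E n * P n))"
        using P(3)[OF elim(1)] unfolding e_def[symmetric] by (simp add: mult_ac)
      moreover have "real n + 2 = N n + 1" by (simp add: N_def)
      ultimately have f: "1 / (N n + 1) \<le> e * (2 * (E n * P n))" by (simp only:)
      have EP: "0 < 2 * (E n * P n)" using elim by (simp add: E_def)
      have "1 / (N n + 1) / (2 * (E n * P n)) \<le> e" unfolding pos_divide_le_eq[OF EP] by (rule f)
      then have "real n * (1 / (N n + 1) / (2 * (E n * P n))) \<le> real n * e" by (intro mult_left_mono) auto
      then show ?case by (simp add: e_def)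
    qed
    show "\<forall>\<^sub>F n in sequentially. real n * (1 - gauss_dim n) \<le> real n / N n * (1 / (2 * P n))"
      using eventually_ge_at_top[of 17] Ppos
    proof eventually_elim
      case (elim n)
      have "(1 - gauss_dim n) * (2 * P n) \<le> 1 / N n" using P(2)[OF elim(1)] by (simp add: mult_ac)
      moreover have "0 < 2 * P n" using elim(2) by simp
      ultimately have "1 - gauss_dim n \<le> 1 / N n / (2 * P n)" by (simp only: pos_le_divide_eq)
      then have "real n * (1 - gauss_dim n) \<le> real n * (1 / N n / (2 * P n))" by (intro mult_left_mono) auto
      then show ?case by simp
    qed
  qed
qed

theorem theorem9p2:
  shows "((\<lambda>n::nat. (1 - gauss_measure n) / ((1 - gauss_dim n) * ln (real n))) \<longlonglongrightarrow> 1)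
       \<and> ((\<lambda>n::nat. real n * (1 - gauss_measure n) / ln (real n)) \<longlonglongrightarrow> 6 / pi\<^sup>2)"
proof -
  define x where "x n = - ln (gauss_measure n)" for n
  define a where "a n = real n * (1 - gauss_dim n)" for n
  have a: "a \<longlonglongrightarrow> 6 / pi\<^sup>2" unfolding a_def by (rule gauss_dim_asymptotics)
  have lntop: "filterlim (\<lambda>n. ln (real n)) at_top sequentially"
    by (rule filterlim_compose[OF ln_at_top filterlim_real_sequentially])
  have inv: "(\<lambda>n. c / ln (real n)) \<longlonglongrightarrow> 0" for c :: real
    by (intro tendsto_divide_0[OF tendsto_const] filterlim_at_top_imp_at_infinity lntop)
  have lnpos: "\<forall>\<^sub>F n in sequentially. 0 < ln (real n)"
    using lntop by (simp add: filterlim_at_top_dense)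
  have lr: "(\<lambda>n. ln (real n + 1) / ln (real n)) \<longlonglongrightarrow> 1"
  proof (rule tendsto_sandwich[OF _ _ tendsto_const])
    show "\<forall>\<^sub>F n in sequentially. 1 \<le> ln (real n + 1) / ln (real n)"
      using lnpos eventually_ge_at_top[of 1] by eventually_elim simp
    show "\<forall>\<^sub>F n in sequentially. ln (real n + 1) / ln (real n) \<le> 1 + 1 / ln (real n)"
      using lnpos eventually_ge_at_top[of 1]
    proof eventually_elim
      case (elim n)
      have "ln (real n + 1) - ln (real n) = ln ((real n + 1) / real n)" using elim by (simp add: ln_div)
      also have "\<dots> \<le> (real n + 1) / real n - 1" using elim by (intro ln_le_minus_one) auto
      also have "\<dots> \<le> 1" using elim by (simp add: field_simps)
      finally have "ln (real n + 1) \<le> ln (real n) + 1" by simp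
      then have "ln (real n + 1) / ln (real n) \<le> (ln (real n) + 1) / ln (real n)"
        using elim by (intro divide_right_mono) auto
      then show ?case using elim by (simp add: add_divide_distrib)
    qed
    show "(\<lambda>n. 1 + 1 / ln (real n)) \<longlonglongrightarrow> 1" using tendsto_add[OF tendsto_const inv[of 1], of 1] by simp
  qed
  \<comment> \<open>The error \<open>700 / (n + 1)\<close> in the logarithm of the measure, rescaled
    by \<open>n / ln n\<close>, is still \<open>O(1 / ln n)\<close>.\<close>
  define err where "err n = real n * (x n - (1 - gauss_dim n) * ln (real n + 1)) / ln (real n)" for n
  have err: "err \<longlonglongrightarrow> 0"
  proof (rule Lim_null_comparison[OF _ inv[of 700]])
    show "\<forall>\<^sub>F n in sequentially. norm (err n) \<le> 700 / ln (real n)"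
      using lnpos eventually_ge_at_top[of 17]
    proof eventually_elim
      case (elim n)
      have "real n * \<bar>x n - (1 - gauss_dim n) * ln (real n + 1)\<bar> \<le> real n * (700 / (real n + 1))"
        using gauss_asymptotics[OF elim(2)] unfolding x_def by (intro mult_left_mono) auto
      also have "\<dots> \<le> 700" by (simp add: field_simps)
      finally have "real n * \<bar>x n - (1 - gauss_dim n) * ln (real n + 1)\<bar> / ln (real n) \<le> 700 / ln (real n)"
        using elim by (intro divide_right_mono) auto
      then show ?case using elim by (simp add: err_def abs_mult)
    qed
  qed
  have xl: "(\<lambda>n. real n * x n / ln (real n)) \<longlonglongrightarrow> 6 / pi\<^sup>2"
  proof -
    have "(\<lambda>n. a n * (ln (real n + 1) / ln (real n)) + err n) \<longlonglongrightarrow> 6 / pi\<^sup>2 * 1 + 0"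
      by (intro tendsto_intros a lr err)
    moreover have "a n * (ln (real n + 1) / ln (real n)) + err n = real n * x n / ln (real n)" for n
      by (simp add: a_def err_def right_diff_distrib diff_divide_distrib)
    ultimately show ?thesis by simp
  qed
  have x0: "x \<longlonglongrightarrow> 0"
  proof -
    have "(\<lambda>n. ln (real n) / real n) \<longlonglongrightarrow> 0"
      by (rule filterlim_compose[OF ln_x_over_x_tendsto_0 filterlim_real_sequentially])
    then have "(\<lambda>n. real n * x n / ln (real n) * (ln (real n) / real n)) \<longlonglongrightarrow> 6 / pi\<^sup>2 * 0"
      by (intro tendsto_mult xl)
    then have "(\<lambda>n. real n * x n / ln (real n) * (ln (real n) / real n)) \<longlonglongrightarrow> 0" by simp
    moreover have "\<forall>\<^sub>F n in sequentially. real n * x n / ln (real n) * (ln (real n) / real n) = x n"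
      using lnpos eventually_ge_at_top[of 1] by eventually_elim simp
    ultimately show ?thesis by (rule Lim_transform_eventually)
  qed
  have ex: "(\<lambda>n. exp (- x n)) \<longlonglongrightarrow> 1"
  proof -
    have "(\<lambda>n. exp (- x n)) \<longlonglongrightarrow> exp (- 0)" by (intro tendsto_intros x0)
    then show ?thesis by simp
  qed
  \<comment> \<open>For \<open>H = exp (- x)\<close> the difference \<open>1 - H\<close> lies
    between \<open>x * exp (- x)\<close> and \<open>x\<close>, and \<open>x\<close> tends to
    0.\<close>
  have second: "(\<lambda>n. real n * (1 - gauss_measure n) / ln (real n)) \<longlonglongrightarrow> 6 / pi\<^sup>2"
  proof (rule tendsto_sandwich[OF _ _ _ xl])
    show "\<forall>\<^sub>F n in sequentially. real n * x n / ln (real n) * exp (- x n) \<le> real n * (1 - gauss_measure n) / ln (real n)"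
      using lnpos eventually_ge_at_top[of 17]
    proof eventually_elim
      case (elim n)
      have "0 < gauss_measure n" using gauss_asymptotics[OF elim(2)] by blast
      then have m: "gauss_measure n = exp (- x n)" by (simp add: x_def)
      have "(1 + x n) * exp (- x n) \<le> exp (x n) * exp (- x n)" by (intro mult_right_mono exp_ge_add_one_self) simp
      also have "\<dots> = 1" by (simp flip: exp_add)
      finally have "x n * exp (- x n) \<le> 1 - gauss_measure n" unfolding m by (simp add: distrib_right)
      then have "real n * (x n * exp (- x n)) / ln (real n) \<le> real n * (1 - gauss_measure n) / ln (real n)"
        using elim by (intro divide_right_mono mult_left_mono) auto
      then show ?case by (simp add: mult.assoc)
    qed
    show "\<forall>\<^sub>F n in sequentially. real n * (1 - gauss_measure n) / ln (real n) \<le> real n * x n / ln (real n)"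
      using lnpos eventually_ge_at_top[of 17]
    proof eventually_elim
      case (elim n)
      have "0 < gauss_measure n" using gauss_asymptotics[OF elim(2)] by blast
      then have m: "gauss_measure n = exp (- x n)" by (simp add: x_def)
      have "1 - gauss_measure n \<le> x n" unfolding m using exp_ge_add_one_self[of "- x n"] by simp
      then show ?case using elim by (intro divide_right_mono mult_left_mono) auto
    qed
    show "(\<lambda>n. real n * x n / ln (real n) * exp (- x n)) \<longlonglongrightarrow> 6 / pi\<^sup>2"
      using tendsto_mult[OF xl ex] by simp
  qed
  \<comment> \<open>The first limit is the second one divided by the nonzero limit of
    \<open>n * (1 - gauss_dim n)\<close>.\<close>
  have "(\<lambda>n. real n * (1 - gauss_measure n) / ln (real n) / a n) \<longlonglongrightarrow> (6 / pi\<^sup>2) / (6 / pi\<^sup>2)"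
    by (intro tendsto_divide second a) simp
  then have "(\<lambda>n. real n * (1 - gauss_measure n) / ln (real n) / a n) \<longlonglongrightarrow> 1" by simp
  moreover have "\<forall>\<^sub>F n in sequentially. real n * (1 - gauss_measure n) / ln (real n) / a n
      = (1 - gauss_measure n) / ((1 - gauss_dim n) * ln (real n))"
    using eventually_ge_at_top[of 1] by eventually_elim (simp add: a_def mult.commute)
  ultimately have "(\<lambda>n. (1 - gauss_measure n) / ((1 - gauss_dim n) * ln (real n))) \<longlonglongrightarrow> 1"
    by (rule Lim_transform_eventually)
  then show ?thesis using second by blast
qed

end
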